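(* Let $d_X,d_Y\ge1$, let $X\subset\mathbb{R}^{d_X}$ and $Y\subset\mathbb{R}^{d_Y}$ be open sets, and let $\Phi\in C^\infty(X\times Y,\mathbb{R})$. Assume that $$\nabla_x\Phi(x,y)\neq \mathbf 0,\qquad \nabla_y\Phi(x,y)\ne\mathbf 0\qquad\text{for all }(x,y)\in X\times Y,$$ and that for some integer $r\ge1$, $$\operatorname{rank}\left[\frac{\partial^2\Phi}{\partial x_i\partial y_j}(x,y)\right]_{1\le i\le d_X,\,1\le j\le d_Y}\ge r\qquad\text{for all }(x,y)\in X\times Y.$$ Let $A\subset X$ and $B\subset Y$ be compact sets, and let $\Delta_\Phi(A,B)=\{\Phi(x,y):x\in A,\ y\in B\}$. Then: (i) For any $0<u<1$, if $\dim_H A+\dim_H B>d_X+d_Y-r+u$, then $\dim_H(\Delta_\Phi(A,B))\ge u$. (ii) If $\dim_H A+\dim_H B>d_X+d_Y+1-r$, then $\mathcal{L}^1(\Delta_\Phi(A,B))>0$. (iii) If $\dim_H A+\dim_H B>d_X+d_Y+2-r$, then $\Delta_\Phi(A,B)$ has nonempty interior.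
   Context: $\dim_H$ denotes Hausdorff dimension and $\mathcal{L}^1$ denotes Lebesgue measure on $\mathbb{R}$. *)

theory Defs
  imports "HOL-Analysis.Analysis"
begin

section \<open>Hausdorff measure and dimension\<close>

text \<open>
  The term \<open>diam(U)\<^sup>s\<close> of a covering set, with the usual conventions: the empty set contributes
  \<open>0\<close> and a nonempty set contributes \<open>1\<close> when \<open>s = 0\<close>. The case distinction is needed because
  \<open>0 powr 0 = 0\<close> in HOL.
\<close>

definition diam_power :: "real \<Rightarrow> 'a::metric_space set \<Rightarrow> ennreal" where
  "diam_power s U =
     (if U = {} then 0 else if s = 0 then 1 else ennreal (diameter U powr s))"

text \<open>
  Boundedness is required explicitly because the real-valued \<^const>\<open>diameter\<close> is unspecified on
  unbounded sets.
\<close>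

definition hausdorff_premeasure :: "real \<Rightarrow> real \<Rightarrow> 'a::metric_space set \<Rightarrow> ennreal" where
  "hausdorff_premeasure s \<delta> A =
     (INF U \<in> {U :: nat \<Rightarrow> 'a set.
                 A \<subseteq> (\<Union>i. U i) \<and> (\<forall>i. bounded (U i) \<and> diameter (U i) \<le> \<delta>)}.
        (\<Sum>i. diam_power s (U i)))"

definition hausdorff_measure :: "real \<Rightarrow> 'a::metric_space set \<Rightarrow> ennreal" where
  "hausdorff_measure s A = (SUP \<delta> \<in> {0<..}. hausdorff_premeasure s \<delta> A)"

definition hausdorff_dim :: "'a::metric_space set \<Rightarrow> ereal" where
  "hausdorff_dim A = (INF s \<in> {s. 0 \<le> s \<and> hausdorff_measure s A = 0}. ereal s)"


section \<open>Smooth functions and partial derivatives\<close>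

text \<open>
  \<open>k\<close>-fold continuous differentiability, meant for open \<open>S\<close>; then only the values of \<open>f\<close> on \<open>S\<close>
  matter, although \<open>f\<close> is a total function.
\<close>

primrec Ck_on :: "nat \<Rightarrow> 'a::euclidean_space set \<Rightarrow> ('a \<Rightarrow> real) \<Rightarrow> bool" where
  "Ck_on 0 S f \<longleftrightarrow> continuous_on S f"
| "Ck_on (Suc k) S f \<longleftrightarrow>
     (\<forall>x\<in>S. f differentiable (at x)) \<and>
     (\<forall>v. Ck_on k S (\<lambda>x. frechet_derivative f (at x) v))"

definition smooth_on :: "'a::euclidean_space set \<Rightarrow> ('a \<Rightarrow> real) \<Rightarrow> bool" where
  "smooth_on S f \<longleftrightarrow> (\<forall>k. Ck_on k S f)"

definition partial_deriv :: "'n::finite \<Rightarrow> (real^'n \<Rightarrow> real) \<Rightarrow> real^'n \<Rightarrow> real" where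
  "partial_deriv i f x = deriv (\<lambda>t. f (x + t *\<^sub>R axis i 1)) 0"

definition gradient :: "(real^'n::finite \<Rightarrow> real) \<Rightarrow> real^'n \<Rightarrow> real^'n" where
  "gradient f x = (\<chi> i. partial_deriv i f x)"

definition mixed_hessian ::
    "((real^'m::finite) \<times> (real^'n::finite) \<Rightarrow> real) \<Rightarrow> real^'m \<Rightarrow> real^'n \<Rightarrow> real^'n^'m" where
  "mixed_hessian \<Phi> x y =
     (\<chi> i j. partial_deriv i (\<lambda>x'. partial_deriv j (\<lambda>y'. \<Phi> (x', y')) y) x)"


section \<open>The set of values on a product\<close>

definition Delta :: "('a \<times> 'b \<Rightarrow> real) \<Rightarrow> 'a set \<Rightarrow> 'b set \<Rightarrow> real set" where
  "Delta \<Phi> A B = {\<Phi> (x, y) | x y. x \<in> A \<and> y \<in> B}"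

end

(* Give A and B discrete Frostman measures mu, nu of dimensions alpha, beta at scale delta, and let rho
   be the push-forward of mu x nu under Phi. Hoermander's L2 argument gives
   |rho^(w)| <= C w^(-(alpha + beta - d_X - d_Y + r)/2) for frequencies w up to 1/delta, uniformly in delta:
   a Sobolev inequality at scale 1/w replaces mu by Lebesgue measure at the cost w^(d_X - alpha);
   expanding the square leaves phases Phi(x,y) - Phi(x,y'), which are non-stationary in one coordinate of x
   when y - y' is transversal to the kernel of the mixed Hessian; the at most d_Y - r directions of that kernel
   are removed by cutting nu into w^(d_Y - r) slabs and using Cauchy-Schwarz.
   If 2b is the resulting exponent of |rho^|^2, the energy of rho of every dimension below min(1, 2b) is bounded,
   rho has a bounded L2 density when 2b > 1, and an equicontinuous density when b > 1.
   All measures are finite sums of point masses, so no weak limits are needed; the conclusions for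
   Phi(A x B) follow by compactness as delta tends to 0. *)
theory Submission
  imports Defs
begin

text \<open>The difficulty is uniformity: the final constant may depend neither on the frequency,
  nor on the point masses, nor on the pair y, y'. Amplitudes are therefore treated as families with
  common bounds on finitely many derivatives, the parameters being indices. Differentiating an
  oscillatory sum costs one factor \<omega> and leaves an amplitude of the same class, so the
  Sobolev inequality can be iterated over the coordinates. A phase difference is divided by |y -
  y'|: the derivatives of the quotient are bounded uniformly in the pair, and the large parameter
  becomes \<omega>|y - y'|. Integration by parts runs in one coordinate, chosen per pair but fixed
  over the whole box; this forces the localisation to neighbourhoods in which the mixed Hessian is
  almost constant. More than \<beta> integrations by parts are made, so that the far pairs sum up to
  no more than the order of the pairs at distance 1 / \<omega>. The thresholds of the theorem are
  strict, so \<alpha> and \<beta> can be chosen strictly below the two dimensions and still leave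
  room in the exponent.\<close>

section \<open>Families of symbols\<close>

text \<open>Points of the \<open>x\<close>-space are functions on the coordinates, so that \<open>x(j := t)\<close> moves along the
  \<open>j\<close>-th axis and integrals over a box are integrals over a product measure \<^const>\<open>PiM\<close>.\<close>

abbreviation has_partial ::
    "(('m \<Rightarrow> real) \<Rightarrow> 'a::real_normed_vector) \<Rightarrow> 'm \<Rightarrow> 'a \<Rightarrow> ('m \<Rightarrow> real) \<Rightarrow> bool" where
  "has_partial f j D x \<equiv> ((\<lambda>t. f (x(j := t))) has_vector_derivative D) (at (x j))"

text \<open>Amplitudes of order k with bounds common to the whole family; parameters such as the
  frequency or a pair of points go into the index. Each partial derivative is given by a witness
  that is again such a family.\<close>

primrec symb :: "nat \<Rightarrow> 'i set \<Rightarrow> ('m \<Rightarrow> real) set \<Rightarrow> ('i \<Rightarrow> ('m \<Rightarrow> real) \<Rightarrow> complex) \<Rightarrow> bool" where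
  "symb 0 I U f \<longleftrightarrow>
     (\<forall>i\<in>I. continuous_on U (f i)) \<and> (\<exists>C. \<forall>i\<in>I. \<forall>x\<in>U. norm (f i x) \<le> C)"
| "symb (Suc k) I U f \<longleftrightarrow>
     ((\<forall>i\<in>I. continuous_on U (f i)) \<and> (\<exists>C. \<forall>i\<in>I. \<forall>x\<in>U. norm (f i x) \<le> C)) \<and>
     (\<forall>j. \<exists>g. symb k I U g \<and>
        (\<forall>i\<in>I. \<forall>x\<in>U. has_partial (f i) j (g i x) x))"

declare symb.simps [simp del]

lemma symb_0_iff: "symb 0 I U f \<longleftrightarrow>
    (\<forall>i\<in>I. continuous_on U (f i)) \<and> (\<exists>C. \<forall>i\<in>I. \<forall>x\<in>U. norm (f i x) \<le> C)"
  by (simp add: symb.simps)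

lemma symb_SucI:
  assumes "symb 0 I U f"
    and "\<And>j. \<exists>g. symb k I U g \<and>
          (\<forall>i\<in>I. \<forall>x\<in>U. has_partial (f i) j (g i x) x)"
  shows "symb (Suc k) I U f"
  using assms unfolding symb.simps by blast

lemma symb_cont: "symb k I U f \<Longrightarrow> i \<in> I \<Longrightarrow> continuous_on U (f i)"
  by (cases k) (auto simp: symb.simps simp del: fun_upd_apply)

lemma symb_bounded: "symb k I U f \<Longrightarrow> \<exists>C>0. \<forall>i\<in>I. \<forall>x\<in>U. norm (f i x) \<le> C"
proof -
  assume "symb k I U f"
  then obtain C where "\<forall>i\<in>I. \<forall>x\<in>U. norm (f i x) \<le> C" by (cases k) (auto simp: symb.simps simp del: fun_upd_apply)
  then show ?thesis by (intro exI[of _ "max C 1"]) (auto simp: le_max_iff_disj)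
qed

lemma symb_0: "symb k I U f \<Longrightarrow> symb 0 I U f"
  by (cases k) (auto simp: symb.simps simp del: fun_upd_apply)

lemma symb_deriv:
  "symb (Suc k) I U f \<Longrightarrow> \<exists>g. symb k I U g \<and>
     (\<forall>i\<in>I. \<forall>x\<in>U. has_partial (f i) j (g i x) x)"
  unfolding symb.simps by blast

lemma symb_Suc_imp: "symb (Suc k) I U f \<Longrightarrow> symb k I U f"
proof (induction k arbitrary: f)
  case (Suc k)
  then show ?case unfolding symb.simps(2)[of "Suc k"] symb.simps(2)[of k] by blast
qed (rule symb_0)

lemma symb_reindex: "symb k I U f \<Longrightarrow> h \<in> J \<rightarrow> I \<Longrightarrow> symb k J U (\<lambda>i. f (h i))"
proof (induction k arbitrary: f)
  case 0
  then show ?case by (fastforce simp: Pi_iff symb_0_iff)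
next
  case (Suc k)
  have 0: "symb 0 J U (\<lambda>i. f (h i))"
    using symb_0[OF Suc.prems(1)] Suc.prems(2) by (fastforce simp: Pi_iff symb_0_iff)
  have "\<exists>g. symb k J U g \<and>
      (\<forall>i\<in>J. \<forall>x\<in>U. has_partial (f (h i)) j (g i x) x)" for j
  proof -
    obtain g where g: "symb k I U g"
      "\<And>i x. i \<in> I \<Longrightarrow> x \<in> U \<Longrightarrow> has_partial (f i) j (g i x) x"
      using symb_deriv[OF Suc.prems(1), of j] by blast
    show ?thesis
      using Suc.IH[OF g(1) Suc.prems(2)] g(2) Suc.prems(2)
      unfolding Pi_iff by blast
  qed
  with 0 show ?case by (rule symb_SucI)
qed

lemma symb_const:
  assumes "\<And>i. i \<in> I \<Longrightarrow> norm (c i) \<le> C"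
  shows "symb k I U (\<lambda>i x. c i)"
  using assms
proof (induction k arbitrary: c C)
  case (Suc k)
  have "symb k I U (\<lambda>i x. 0)" by (rule Suc.IH[of _ 0]) auto
  then show ?case
    using Suc.prems
    by (intro symb_SucI exI[of _ "\<lambda>i x. 0"]) (auto simp: symb_0_iff)
qed (auto simp: symb_0_iff)

lemma symb_coord:
  assumes "\<And>x. x \<in> U \<Longrightarrow> \<bar>x l\<bar> \<le> C"
  shows "symb k I U (\<lambda>i x. of_real (x l))"
proof (cases k)
  case 0
  have "continuous_on U (\<lambda>x. complex_of_real (x l))"
    by (intro continuous_intros continuous_on_subset[OF continuous_on_product_coordinates]) auto
  then show ?thesis using 0 assms by (auto simp: symb_0_iff)
next
  case (Suc k')
  have c: "continuous_on U (\<lambda>x. complex_of_real (x l))"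
    by (intro continuous_intros continuous_on_subset[OF continuous_on_product_coordinates]) auto
  have "\<exists>g. symb k' I U g \<and>
        (\<forall>i\<in>I. \<forall>x\<in>U. ((\<lambda>t. complex_of_real ((x(j := t)) l)) has_vector_derivative g i x) (at (x j)))" for j
  proof (cases "j = l")
    case True
    have "((\<lambda>t. complex_of_real t) has_vector_derivative 1) (at s)" for s
      by (auto intro!: derivative_eq_intros)
    then show ?thesis using True by (intro exI[of _ "\<lambda>_ _. 1"]) (auto intro!: symb_const[of _ _ 1])
  next
    case False
    then show ?thesis
      by (intro exI[of _ "\<lambda>_ _. 0"]) (auto intro!: symb_const[of _ _ 0])
  qed
  moreover have "symb 0 I U (\<lambda>i x. complex_of_real (x l))"
    using c assms by (auto simp: symb_0_iff)
  ultimately show ?thesis unfolding Suc by (intro symb_SucI)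
qed

lemma symb_0_add: "symb 0 I U f \<Longrightarrow> symb 0 I U g \<Longrightarrow> symb 0 I U (\<lambda>i x. f i x + g i x)"
proof -
  assume 0: "symb 0 I U f" "symb 0 I U g"
  obtain C where C: "\<forall>i\<in>I. \<forall>x\<in>U. norm (f i x) \<le> C" using symb_bounded[OF 0(1)] by auto
  obtain D where D: "\<forall>i\<in>I. \<forall>x\<in>U. norm (g i x) \<le> D" using symb_bounded[OF 0(2)] by auto
  have "\<forall>i\<in>I. \<forall>x\<in>U. norm (f i x + g i x) \<le> C + D"
    using C D by (meson norm_triangle_le add_mono)
  then show ?thesis using 0 by (auto simp: symb_0_iff intro!: continuous_intros)
qed

lemma symb_add: "symb k I U f \<Longrightarrow> symb k I U g \<Longrightarrow> symb k I U (\<lambda>i x. f i x + g i x)"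
proof (induction k arbitrary: f g)
  case 0
  then show ?case by (rule symb_0_add)
next
  case (Suc k)
  have 0: "symb 0 I U (\<lambda>i x. f i x + g i x)"
    by (rule symb_0_add[OF symb_0[OF Suc.prems(1)] symb_0[OF Suc.prems(2)]])
  have "\<exists>h. symb k I U h \<and> (\<forall>i\<in>I. \<forall>x\<in>U.
      ((\<lambda>t. f i (x(j := t)) + g i (x(j := t))) has_vector_derivative h i x) (at (x j)))" for j
  proof -
    obtain f' where f': "symb k I U f'"
      "\<And>i x. i \<in> I \<Longrightarrow> x \<in> U \<Longrightarrow> has_partial (f i) j (f' i x) x"
      using symb_deriv[OF Suc.prems(1), of j] by blast
    obtain g' where g': "symb k I U g'"
      "\<And>i x. i \<in> I \<Longrightarrow> x \<in> U \<Longrightarrow> has_partial (g i) j (g' i x) x"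
      using symb_deriv[OF Suc.prems(2), of j] by blast
    have "((\<lambda>t. f i (x(j := t)) + g i (x(j := t))) has_vector_derivative (f' i x + g' i x)) (at (x j))"
      if "i \<in> I" "x \<in> U" for i x
      using has_vector_derivative_add[OF f'(2)[OF that] g'(2)[OF that]] .
    then show ?thesis using Suc.IH[OF f'(1) g'(1)] by blast
  qed
  with 0 show ?case by (rule symb_SucI)
qed

lemma symb_0_mult: "symb 0 I U f \<Longrightarrow> symb 0 I U g \<Longrightarrow> symb 0 I U (\<lambda>i x. f i x * g i x)"
proof -
  assume 0: "symb 0 I U f" "symb 0 I U g"
  obtain C where C: "C > 0" "\<forall>i\<in>I. \<forall>x\<in>U. norm (f i x) \<le> C" using symb_bounded[OF 0(1)] by auto
  obtain D where D: "D > 0" "\<forall>i\<in>I. \<forall>x\<in>U. norm (g i x) \<le> D" using symb_bounded[OF 0(2)] by auto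
  have "\<forall>i\<in>I. \<forall>x\<in>U. norm (f i x * g i x) \<le> C * D"
    using C D by (auto simp: norm_mult intro!: mult_mono)
  then show ?thesis using 0 by (auto simp: symb_0_iff intro!: continuous_intros)
qed

lemma symb_mult: "symb k I U f \<Longrightarrow> symb k I U g \<Longrightarrow> symb k I U (\<lambda>i x. f i x * g i x)"
proof (induction k arbitrary: f g)
  case 0
  then show ?case by (rule symb_0_mult)
next
  case (Suc k)
  have 0: "symb 0 I U (\<lambda>i x. f i x * g i x)"
    by (rule symb_0_mult[OF symb_0[OF Suc.prems(1)] symb_0[OF Suc.prems(2)]])
  have "\<exists>h. symb k I U h \<and> (\<forall>i\<in>I. \<forall>x\<in>U.
      ((\<lambda>t. f i (x(j := t)) * g i (x(j := t))) has_vector_derivative h i x) (at (x j)))" for j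
  proof -
    obtain f' where f': "symb k I U f'"
      "\<And>i x. i \<in> I \<Longrightarrow> x \<in> U \<Longrightarrow> has_partial (f i) j (f' i x) x"
      using symb_deriv[OF Suc.prems(1), of j] by blast
    obtain g' where g': "symb k I U g'"
      "\<And>i x. i \<in> I \<Longrightarrow> x \<in> U \<Longrightarrow> has_partial (g i) j (g' i x) x"
      using symb_deriv[OF Suc.prems(2), of j] by blast
    have s: "symb k I U (\<lambda>i x. f i x * g' i x + f' i x * g i x)"
      using symb_add[OF Suc.IH[OF symb_Suc_imp[OF Suc.prems(1)] g'(1)]
          Suc.IH[OF f'(1) symb_Suc_imp[OF Suc.prems(2)]]] .
    have "((\<lambda>t. f i (x(j := t)) * g i (x(j := t))) has_vector_derivative
            (f i x * g' i x + f' i x * g i x)) (at (x j))" if "i \<in> I" "x \<in> U" for i x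
      using has_vector_derivative_mult[OF f'(2)[OF that] g'(2)[OF that]] by simp
    with s show ?thesis by blast
  qed
  with 0 show ?case by (rule symb_SucI)
qed

lemma symb_cnj: "symb k I U f \<Longrightarrow> symb k I U (\<lambda>i x. cnj (f i x))"
proof (induction k arbitrary: f)
  case 0
  then show ?case by (auto simp: symb_0_iff intro!: continuous_intros)
next
  case (Suc k)
  have 0: "symb 0 I U (\<lambda>i x. cnj (f i x))"
    using symb_0[OF Suc(2)] by (auto simp: symb_0_iff intro!: continuous_intros)
  have "\<exists>h. symb k I U h \<and> (\<forall>i\<in>I. \<forall>x\<in>U.
      ((\<lambda>t. cnj (f i (x(j := t)))) has_vector_derivative h i x) (at (x j)))" for j
  proof -
    obtain f' where f': "symb k I U f'"
      "\<And>i x. i \<in> I \<Longrightarrow> x \<in> U \<Longrightarrow> has_partial (f i) j (f' i x) x"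
      using symb_deriv[OF Suc.prems(1), of j] by blast
    have "((\<lambda>t. cnj (f i (x(j := t)))) has_vector_derivative cnj (f' i x)) (at (x j))"
      if "i \<in> I" "x \<in> U" for i x
      using has_vector_derivative_cnj[OF f'(2)[OF that]] .
    then show ?thesis using Suc.IH[OF f'(1)] by blast
  qed
  with 0 show ?case by (rule symb_SucI)
qed

lemma symb_cmult: "symb k I U f \<Longrightarrow> symb k I U (\<lambda>i x. c * f i x)"
  using symb_mult[OF symb_const[of I "\<lambda>_. c" "norm c"]] by simp

text \<open>The uniform lower bound keeps the reciprocals uniformly bounded, and the derivative
  -f'/f^2 is a product of symbols of order k by the induction hypothesis. It allows division by the
  phase derivative in integration by parts.\<close>

lemma symb_inverse:
  assumes "c > 0"
  shows "symb k I U f \<Longrightarrow> (\<And>i x. i \<in> I \<Longrightarrow> x \<in> U \<Longrightarrow> c \<le> norm (f i x)) \<Longrightarrow>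
    symb k I U (\<lambda>i x. inverse (f i x))"
proof (induction k arbitrary: f)
  have base: "symb 0 I U (\<lambda>i x. inverse (f i x))"
    if f: "symb 0 I U f" and lower: "\<And>i x. i \<in> I \<Longrightarrow> x \<in> U \<Longrightarrow> c \<le> norm (f i x)" for f
  proof -
    have "norm (inverse (f i x)) \<le> inverse c" if "i \<in> I" "x \<in> U" for i x
      using lower[OF that] \<open>c > 0\<close> by (simp add: norm_inverse le_imp_inverse_le)
    moreover have "f i x \<noteq> 0" if "i \<in> I" "x \<in> U" for i x
      using lower[OF that] \<open>c > 0\<close> by auto
    ultimately show ?thesis using f by (auto simp: symb_0_iff intro!: continuous_intros)
  qed
  { case 0 then show ?case by (rule base) }
  case (Suc k)
  have nz: "f i x \<noteq> 0" if "i \<in> I" "x \<in> U" for i x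
    using Suc(3)[OF that] \<open>c > 0\<close> by auto
  have 0: "symb 0 I U (\<lambda>i x. inverse (f i x))"
    by (rule base[OF symb_0[OF Suc.prems(1)] Suc.prems(2)])
  have IH: "symb k I U (\<lambda>i x. inverse (f i x))"
    using Suc.IH[OF symb_Suc_imp[OF Suc.prems(1)] Suc.prems(2)] by blast
  have "\<exists>h. symb k I U h \<and> (\<forall>i\<in>I. \<forall>x\<in>U.
      ((\<lambda>t. inverse (f i (x(j := t)))) has_vector_derivative h i x) (at (x j)))" for j
  proof -
    obtain f' where f': "symb k I U f'"
      "\<And>i x. i \<in> I \<Longrightarrow> x \<in> U \<Longrightarrow> has_partial (f i) j (f' i x) x"
      using symb_deriv[OF Suc.prems(1), of j] by blast
    have "symb k I U (\<lambda>i x. - 1 * (f' i x * (inverse (f i x) * inverse (f i x))))"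
      using symb_cmult[OF symb_mult[OF f'(1) symb_mult[OF IH IH]]] .
    moreover have "((\<lambda>t. inverse (f i (x(j := t)))) has_vector_derivative
        - 1 * (f' i x * (inverse (f i x) * inverse (f i x)))) (at (x j))" if "i \<in> I" "x \<in> U" for i x
    proof -
      have "(inverse has_field_derivative - (inverse (f i x) * inverse (f i x))) (at (f i (x(j := x j))))"
        using DERIV_inverse'[OF DERIV_ident, of "f i x"] nz[OF that]
        by (simp add: power2_eq_square)
      from field_vector_diff_chain_at[OF f'(2)[OF that] this]
      show ?thesis by (simp add: o_def algebra_simps del: fun_upd_apply)
    qed
    ultimately show ?thesis by blast
  qed
  with 0 show ?case by (rule symb_SucI)
qed

section \<open>Smooth phases\<close>

abbreviation ddir :: "('a::euclidean_space \<Rightarrow> real) \<Rightarrow> 'a \<Rightarrow> 'a \<Rightarrow> real" where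
  "ddir G v \<equiv> \<lambda>z. frechet_derivative G (at z) v"

lemma smooth_on_ddir: "smooth_on S G \<Longrightarrow> smooth_on S (ddir G v)"
  unfolding smooth_on_def by (metis Ck_on.simps(2))

lemma smooth_on_continuous: "smooth_on S G \<Longrightarrow> continuous_on S G"
  unfolding smooth_on_def by (metis Ck_on.simps(1))

lemma smooth_on_has_derivative:
  "smooth_on S G \<Longrightarrow> z \<in> S \<Longrightarrow> (G has_derivative (\<lambda>v. ddir G v z)) (at z)"
  unfolding smooth_on_def by (metis Ck_on.simps(2) frechet_derivative_works)

lemma vec_upd: "(\<chi> i. (x(j := t)) i) = (\<chi> i. x i) + (t - x j) *\<^sub>R axis j (1::real)"
  by (simp add: vec_eq_iff axis_def)

lemma has_real_derivative_fst_upd: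
  fixes G :: "(real^'m::finite) \<times> (real^'n::finite) \<Rightarrow> real"
  assumes "smooth_on S G" "((\<chi> i. x i), y) \<in> S"
  shows "((\<lambda>t. G ((\<chi> i. (x(j := t)) i), y)) has_real_derivative
            ddir G (axis j 1, 0) ((\<chi> i. x i), y)) (at (x j))"
proof -
  let ?D = "\<lambda>v. ddir G v ((\<chi> i. x i), y)"
  have D: "(G has_derivative ?D) (at ((\<chi> i. x i), y))"
    using smooth_on_has_derivative[OF assms] .
  have "((\<lambda>t. ((\<chi> i. x i) + (t - x j) *\<^sub>R axis j (1::real), y)) has_derivative
      (\<lambda>h. (h *\<^sub>R axis j 1, 0))) (at (x j))"
    by (auto intro!: derivative_eq_intros)
  then have "((G \<circ> (\<lambda>t. ((\<chi> i. x i) + (t - x j) *\<^sub>R axis j (1::real), y))) has_derivative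
      (?D \<circ> (\<lambda>h. (h *\<^sub>R axis j 1, 0)))) (at (x j))"
    by (rule diff_chain_at) (use D in simp)
  moreover have "?D (h *\<^sub>R axis j 1, 0) = h * ?D (axis j 1, 0)" for h
    using linear_cmul[OF has_derivative_linear[OF D], of h "(axis j 1, 0)"] by simp
  ultimately show ?thesis
    unfolding has_field_derivative_def vec_upd o_def by (simp add: mult_commute_abs)
qed

lemma has_derivative_snd:
  assumes "smooth_on S G" "(x, y) \<in> S"
  shows "((\<lambda>y. G (x, y)) has_derivative (\<lambda>w. ddir G (0, w) (x, y))) (at y)"
proof -
  have D: "(G has_derivative (\<lambda>v. ddir G v (x, y))) (at (x, y))"
    using smooth_on_has_derivative[OF assms] .
  have "((\<lambda>y. (x, y)) has_derivative (\<lambda>w. (0, w))) (at y)"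
    by (auto intro!: derivative_eq_intros)
  from diff_chain_at[OF this, of G, OF D] show ?thesis by (simp add: o_def)
qed

lemma has_derivative_fst:
  assumes "smooth_on S G" "(x, y) \<in> S"
  shows "((\<lambda>x. G (x, y)) has_derivative (\<lambda>w. ddir G (w, 0) (x, y))) (at x)"
proof -
  have D: "(G has_derivative (\<lambda>v. ddir G v (x, y))) (at (x, y))"
    using smooth_on_has_derivative[OF assms] .
  have "((\<lambda>x. (x, y)) has_derivative (\<lambda>w. (w, 0))) (at x)"
    by (auto intro!: derivative_eq_intros)
  from diff_chain_at[OF this, of G, OF D] show ?thesis by (simp add: o_def)
qed

lemma linear_bound_Basis:
  fixes L :: "'a::euclidean_space \<Rightarrow> real"
  assumes "linear L" "\<And>b. b \<in> Basis \<Longrightarrow> \<bar>L b\<bar> \<le> C"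
  shows "\<bar>L w\<bar> \<le> real DIM('a) * C * norm w"
proof -
  have "L w = L (\<Sum>b\<in>Basis. (w \<bullet> b) *\<^sub>R b)" by (simp add: euclidean_representation)
  also have "\<dots> = (\<Sum>b\<in>Basis. (w \<bullet> b) * L b)"
    using assms(1) by (simp add: linear_sum linear_cmul)
  finally have "\<bar>L w\<bar> \<le> (\<Sum>b\<in>Basis. \<bar>(w \<bullet> b) * L b\<bar>)" by (simp add: sum_abs)
  also have "\<dots> \<le> (\<Sum>b\<in>(Basis::'a set). norm w * C)"
    by (intro sum_mono) (auto simp: abs_mult Basis_le_norm assms(2) intro!: mult_mono)
  finally show ?thesis by (simp add: mult_ac)
qed

lemma smooth_on_bounded_compact:
  assumes "smooth_on S G" "compact K" "K \<subseteq> S"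
  shows "\<exists>C>0. \<forall>z\<in>K. \<bar>G z\<bar> \<le> C"
proof -
  have "compact (G ` K)"
    using assms by (meson compact_continuous_image continuous_on_subset smooth_on_continuous)
  then have "bounded (G ` K)" by (rule compact_imp_bounded)
  then obtain C where "\<forall>z\<in>K. \<bar>G z\<bar> \<le> C" unfolding bounded_iff by auto
  then show ?thesis by (intro exI[of _ "max C 1"]) (auto simp: le_max_iff_disj)
qed

text \<open>Mean value theorem on the convex set \<open>K2\<close>, the y-derivatives being bounded
  by compactness. The constant does not depend on x, so it controls the quotients of
  \<open>symb_diff_quotient\<close> uniformly.\<close>

lemma smooth_on_lipschitz_snd:
  fixes G :: "(real^'m::finite) \<times> (real^'n::finite) \<Rightarrow> real"
  assumes "smooth_on S G" "compact K1" "compact K2" "convex K2" "K1 \<times> K2 \<subseteq> S"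
  shows "\<exists>C>0. \<forall>x\<in>K1. \<forall>y\<in>K2. \<forall>y'\<in>K2. \<bar>G (x, y) - G (x, y')\<bar> \<le> C * norm (y - y')"
proof -
  have "\<exists>C>0. \<forall>z\<in>K1 \<times> K2. \<bar>ddir G (0, b) z\<bar> \<le> C" for b
    using smooth_on_bounded_compact[OF smooth_on_ddir[OF assms(1)], of "K1 \<times> K2"] assms
    by (simp add: compact_Times)
  then obtain c where c: "\<And>b. c b > 0" "\<And>b z. z \<in> K1 \<times> K2 \<Longrightarrow> \<bar>ddir G (0, b) z\<bar> \<le> c b"
    by metis
  define C where "C = (\<Sum>b\<in>Basis. c b)"
  have cC: "c b \<le> C" if "b \<in> Basis" for b
    unfolding C_def using c(1) that by (intro member_le_sum) (auto intro: less_imp_le)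
  have "C > 0" unfolding C_def using c(1) by (intro sum_pos) auto
  have "\<bar>G (x, y) - G (x, y')\<bar> \<le> (real CARD('n) * C) * norm (y - y')"
    if "x \<in> K1" "y \<in> K2" "y' \<in> K2" for x y y'
  proof -
    have "norm (G (x, y) - G (x, y')) \<le> (real CARD('n) * C) * norm (y - y')"
    proof (rule differentiable_bound[OF assms(4)])
      fix z assume z: "z \<in> K2"
      have D: "((\<lambda>y. G (x, y)) has_derivative (\<lambda>w. ddir G (0, w) (x, z))) (at z)"
        using has_derivative_snd[OF assms(1)] assms(5) z that by auto
      then show "((\<lambda>y. G (x, y)) has_derivative (\<lambda>w. ddir G (0, w) (x, z))) (at z within K2)"
        by (rule has_derivative_at_withinI)
      have "\<bar>ddir G (0, b) (x, z)\<bar> \<le> C" if "b \<in> Basis" for b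
        using c(2)[of "(x, z)" b] cC[OF that] z \<open>x \<in> K1\<close> by auto
      from linear_bound_Basis[OF has_derivative_linear[OF D] this]
      show "onorm (\<lambda>w. ddir G (0, w) (x, z)) \<le> real CARD('n) * C"
        by (intro onorm_le) simp
    qed (use that in auto)
    then show ?thesis by simp
  qed
  then show ?thesis using \<open>C > 0\<close>
    by (intro exI[of _ "real CARD('n) * C"]) auto
qed

lemma has_vector_derivative_of_real_comp:
  "(f has_real_derivative d) (at t) \<Longrightarrow>
   ((\<lambda>t. complex_of_real (f t)) has_vector_derivative complex_of_real d) (at t)"
  by (rule has_vector_derivative_of_real)
     (simp add: has_real_derivative_iff_has_vector_derivative)

lemma continuous_on_vec_fun: "continuous_on U (\<lambda>x::'m::finite \<Rightarrow> real. \<chi> i. x i)"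
  by (intro continuous_on_vec_lambda continuous_on_subset[OF continuous_on_product_coordinates]) auto

lemma symb_smooth:
  fixes G :: "(real^'m::finite) \<times> (real^'n::finite) \<Rightarrow> real"
  assumes "compact K1" "compact K2" "K1 \<times> K2 \<subseteq> S" "\<And>x. x \<in> U \<Longrightarrow> (\<chi> i. x i) \<in> K1"
  shows "smooth_on S G \<Longrightarrow> symb k K2 U (\<lambda>y x. of_real (G ((\<chi> i. x i), y)))"
proof (induction k arbitrary: G)
  have base: "symb 0 K2 U (\<lambda>y x. complex_of_real (G ((\<chi> i. x i), y)))" if sm: "smooth_on S G" for G
  proof -
    obtain C where "\<forall>z\<in>K1 \<times> K2. \<bar>G z\<bar> \<le> C"
      using smooth_on_bounded_compact[OF sm, of "K1 \<times> K2"] assms by (auto simp: compact_Times)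
    moreover have "continuous_on U (\<lambda>x. complex_of_real (G ((\<chi> i. x i), y)))" if "y \<in> K2" for y
      by (intro continuous_on_of_real continuous_on_compose2[OF smooth_on_continuous[OF \<open>smooth_on S G\<close>]]
            continuous_intros continuous_on_vec_fun) (use assms that in auto)
    ultimately show ?thesis unfolding symb_0_iff using assms(4)
      by (intro conjI ballI exI[of _ C]) auto
  qed
  { case 0 then show ?case by (rule base) }
  case (Suc k)
  show ?case
  proof (rule symb_SucI[OF base[OF Suc.prems]])
    fix j
    let ?g = "\<lambda>y x. complex_of_real (ddir G (axis j 1, 0) ((\<chi> i. x i), y))"
    have "((\<lambda>t. complex_of_real (G ((\<chi> i. (x(j := t)) i), y))) has_vector_derivative ?g y x) (at (x j))"
      if "y \<in> K2" "x \<in> U" for x y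
      by (rule has_vector_derivative_of_real_comp, rule has_real_derivative_fst_upd[OF Suc.prems])
         (use assms that in auto)
    with Suc.IH[OF smooth_on_ddir[OF Suc.prems]]
    show "\<exists>g. symb k K2 U g \<and> (\<forall>y\<in>K2. \<forall>x\<in>U.
       ((\<lambda>t. complex_of_real (G ((\<chi> i. (x(j := t)) i), y))) has_vector_derivative g y x) (at (x j)))"
      by blast
  qed
qed

text \<open>Only x is differentiated, and an x-derivative of the quotient is the quotient of
  \<open>ddir G (axis j 1, 0)\<close>. Induction over all smooth \<open>G\<close> thus bounds every
  order by a Lipschitz constant, although the denominators are arbitrarily small.\<close>

lemma symb_diff_quotient:
  fixes G :: "(real^'m::finite) \<times> (real^'n::finite) \<Rightarrow> real"
  assumes "compact K1" "compact K2" "convex K2" "K1 \<times> K2 \<subseteq> S" "\<And>x. x \<in> U \<Longrightarrow> (\<chi> i. x i) \<in> K1"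
  shows "smooth_on S G \<Longrightarrow> symb k {z\<in>K2 \<times> K2. fst z \<noteq> snd z} U
    (\<lambda>z x. of_real ((G ((\<chi> i. x i), fst z) - G ((\<chi> i. x i), snd z)) / norm (fst z - snd z)))"
    (is "_ \<Longrightarrow> symb k ?I U (?q G)")
proof (induction k arbitrary: G)
  have base: "symb 0 ?I U (?q G)" if sm: "smooth_on S G" for G
  proof -
    obtain C where C: "\<forall>x\<in>K1. \<forall>y\<in>K2. \<forall>y'\<in>K2. \<bar>G (x, y) - G (x, y')\<bar> \<le> C * norm (y - y')"
      using smooth_on_lipschitz_snd[OF sm assms(1-4)] by auto
    have "norm (?q G z x) \<le> C" if "z \<in> ?I" "x \<in> U" for z x
    proof -
      have "\<bar>G ((\<chi> i. x i), fst z) - G ((\<chi> i. x i), snd z)\<bar> \<le> C * norm (fst z - snd z)"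
        using C that assms(5) by auto
      moreover have "norm (fst z - snd z) > 0" using that by auto
      ultimately show ?thesis
        by (simp add: norm_divide divide_le_eq flip: of_real_diff)
    qed
    moreover have "continuous_on U (?q G z)" if "z \<in> ?I" for z
      using that
      by (intro continuous_on_of_real continuous_on_divide continuous_on_diff
            continuous_on_compose2[OF smooth_on_continuous[OF \<open>smooth_on S G\<close>]]
            continuous_on_Pair continuous_on_const continuous_on_vec_fun) (use assms in auto)
    ultimately show ?thesis unfolding symb_0_iff by blast
  qed
  { case 0 then show ?case by (rule base) }
  case (Suc k)
  show ?case
  proof (rule symb_SucI[OF base[OF Suc.prems]])
    fix j
    have "((\<lambda>t. ?q G z (x(j := t))) has_vector_derivative ?q (ddir G (axis j 1, 0)) z x) (at (x j))"
      if "z \<in> ?I" "x \<in> U" for x z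
      by (rule has_vector_derivative_of_real_comp, intro DERIV_cdivide DERIV_diff has_real_derivative_fst_upd[OF Suc.prems])
         (use assms that in auto)
    with Suc.IH[OF smooth_on_ddir[OF Suc.prems]]
    show "\<exists>g. symb k ?I U g \<and> (\<forall>z\<in>?I. \<forall>x\<in>U.
       ((\<lambda>t. ?q G z (x(j := t))) has_vector_derivative g z x) (at (x j)))"
      by blast
  qed
qed

text \<open>The directional derivatives come in the order of \<open>mixed_hessian\<close>, first y
  and then x. The inner identity holds on the open set \<open>X\<close>, hence near x, which is all
  that the outer derivative sees.\<close>

lemma mixed_hessian_eq:
  fixes \<Phi> :: "(real^'m::finite) \<times> (real^'n::finite) \<Rightarrow> real"
  assumes "smooth_on (X \<times> Y) \<Phi>" "open X" "x \<in> X" "y \<in> Y"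
  shows "mixed_hessian \<Phi> x y $ i $ j = ddir (ddir \<Phi> (0, axis j 1)) (axis i 1, 0) (x, y)"
proof -
  have 1: "partial_deriv j (\<lambda>y'. \<Phi> (x', y')) y = ddir \<Phi> (0, axis j 1) (x', y)" if "x' \<in> X" for x'
  proof -
    have D: "((\<lambda>y. \<Phi> (x', y)) has_derivative (\<lambda>w. ddir \<Phi> (0, w) (x', y))) (at y)"
      using has_derivative_snd[OF assms(1)] that assms(4) by auto
    have "((\<lambda>t::real. y + t *\<^sub>R axis j 1) has_derivative (\<lambda>h. h *\<^sub>R axis j 1)) (at 0)"
      by (auto intro!: derivative_eq_intros)
    from diff_chain_at[OF this, of "\<lambda>y. \<Phi> (x', y)"] D
    have "((\<lambda>t. \<Phi> (x', y + t *\<^sub>R axis j 1)) has_derivative (\<lambda>h. ddir \<Phi> (0, h *\<^sub>R axis j 1) (x', y))) (at 0)"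
      by (simp add: o_def)
    moreover have "ddir \<Phi> (0, h *\<^sub>R axis j 1) (x', y) = h * ddir \<Phi> (0, axis j 1) (x', y)" for h
      using linear_cmul[OF has_derivative_linear[OF D], of h "axis j 1"] by simp
    ultimately have "((\<lambda>t. \<Phi> (x', y + t *\<^sub>R axis j 1)) has_real_derivative ddir \<Phi> (0, axis j 1) (x', y)) (at 0)"
      unfolding has_field_derivative_def by (simp add: mult_commute_abs)
    then show ?thesis unfolding partial_deriv_def by (rule DERIV_imp_deriv)
  qed
  let ?H = "ddir \<Phi> (0, axis j 1)"
  have D: "((\<lambda>x. ?H (x, y)) has_derivative (\<lambda>w. ddir ?H (w, 0) (x, y))) (at x)"
    using has_derivative_fst[OF smooth_on_ddir[OF assms(1)]] assms(3,4) by auto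
  have "((\<lambda>t::real. x + t *\<^sub>R axis i 1) has_derivative (\<lambda>h. h *\<^sub>R axis i 1)) (at 0)"
    by (auto intro!: derivative_eq_intros)
  from diff_chain_at[OF this, of "\<lambda>x. ?H (x, y)"] D
  have "((\<lambda>t. ?H (x + t *\<^sub>R axis i 1, y)) has_derivative (\<lambda>h. ddir ?H (h *\<^sub>R axis i 1, 0) (x, y))) (at 0)"
    by (simp add: o_def)
  moreover have "ddir ?H (h *\<^sub>R axis i 1, 0) (x, y) = h * ddir ?H (axis i 1, 0) (x, y)" for h
    using linear_cmul[OF has_derivative_linear[OF D], of h "axis i 1"] by simp
  ultimately have 2: "((\<lambda>t. ?H (x + t *\<^sub>R axis i 1, y)) has_real_derivative ddir ?H (axis i 1, 0) (x, y)) (at 0)"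
    unfolding has_field_derivative_def by (simp add: mult_commute_abs)
  have "((\<lambda>t::real. x + t *\<^sub>R axis i 1) \<longlongrightarrow> x) (at 0)"
    by (auto intro!: tendsto_eq_intros)
  then have "\<forall>\<^sub>F t in at 0. x + t *\<^sub>R axis i 1 \<in> X"
    using assms(2,3) by (rule topological_tendstoD)
  then have "\<forall>\<^sub>F t in nhds 0. x + t *\<^sub>R axis i (1::real) \<in> X"
    unfolding eventually_at_filter
    by (rule eventually_mono) (use assms(3) in \<open>metis UNIV_I add.right_neutral scale_zero_left\<close>)
  then have "\<forall>\<^sub>F t in nhds 0. partial_deriv j (\<lambda>y'. \<Phi> (x + t *\<^sub>R axis i 1, y')) y = ?H (x + t *\<^sub>R axis i 1, y)"
    by (rule eventually_mono) (rule 1)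
  then have "((\<lambda>t. partial_deriv j (\<lambda>y'. \<Phi> (x + t *\<^sub>R axis i 1, y')) y) has_real_derivative
      ddir ?H (axis i 1, 0) (x, y)) (at 0)"
    using 2 by (subst DERIV_cong_ev[OF refl _ refl])
  then have "partial_deriv i (\<lambda>x'. partial_deriv j (\<lambda>y'. \<Phi> (x', y')) y) x = ddir ?H (axis i 1, 0) (x, y)"
    unfolding partial_deriv_def[of i] by (rule DERIV_imp_deriv)
  then show ?thesis by (simp add: mixed_hessian_def)
qed

text \<open>Differences in \<open>y\<close> of the difference quotients in \<open>x\<close> are estimated by the mean value theorem
  in both variables; this avoids interchanging the order of the second derivatives.\<close>

lemma gradient_difference_estimate:
  fixes \<Phi> :: "(real^'m::finite) \<times> (real^'n::finite) \<Rightarrow> real"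
  assumes "smooth_on (X \<times> Y) \<Phi>" "open X" "open Y" "x0 \<in> X" "y0 \<in> Y" "\<epsilon> > 0"
  shows "\<exists>\<rho>>0. ball x0 \<rho> \<subseteq> X \<and> ball y0 \<rho> \<subseteq> Y \<and> (\<forall>i. \<forall>x\<in>ball x0 \<rho>. \<forall>y\<in>ball y0 \<rho>. \<forall>y'\<in>ball y0 \<rho>.
     \<bar>ddir \<Phi> (axis i 1, 0) (x, y) - ddir \<Phi> (axis i 1, 0) (x, y')
        - (mixed_hessian \<Phi> x0 y0 *v (y - y')) $ i\<bar> \<le> \<epsilon> * norm (y - y'))"
proof -
  define H where "H i j = ddir (ddir \<Phi> (0, axis j 1)) (axis i 1, 0)" for i :: 'm and j :: 'n
  define M where "M = mixed_hessian \<Phi> x0 y0"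
  have M: "M $ i $ j = H i j (x0, y0)" for i j
    unfolding M_def H_def using mixed_hessian_eq[OF assms(1,2,4,5)] .
  \<comment> \<open>Passing from bounds on the partial derivatives in y to a bound in terms of
    \<open>norm (y - y')\<close> loses a factor \<open>CARD('n)\<close>.\<close>
  define e where "e = \<epsilon> / real CARD('n)"
  have "e > 0" using assms(6) by (simp add: e_def)
  have o: "open (X \<times> Y)" using assms(2,3) by (rule open_Times)
  have "\<exists>d>0. \<forall>z. dist z (x0, y0) < d \<longrightarrow> z \<in> X \<times> Y \<and> dist (H i j z) (H i j (x0, y0)) < e" for i j
  proof -
    have "continuous_on (X \<times> Y) (H i j)"
      unfolding H_def by (intro smooth_on_continuous smooth_on_ddir assms(1))
    then have "isCont (H i j) (x0, y0)"
      using o assms(4,5) by (simp add: continuous_on_eq_continuous_at)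
    then have "\<exists>d1>0. \<forall>z. dist z (x0, y0) < d1 \<longrightarrow> dist (H i j z) (H i j (x0, y0)) < e"
      using \<open>e > 0\<close> unfolding continuous_at_eps_delta by blast
    moreover have "\<exists>d2>0. ball (x0, y0) d2 \<subseteq> X \<times> Y"
      using o assms(4,5) by (simp add: open_contains_ball)
    ultimately obtain d1 d2 where "d1 > 0" "d2 > 0" 
      "\<forall>z. dist z (x0, y0) < d1 \<longrightarrow> dist (H i j z) (H i j (x0, y0)) < e" "ball (x0, y0) d2 \<subseteq> X \<times> Y"
      by blast
    then show ?thesis
      by (intro exI[of _ "min d1 d2"]) (auto simp: subset_iff dist_commute)
  qed
  then obtain d where d: "\<And>i j. d i j > 0"
    "\<And>i j z. dist z (x0, y0) < d i j \<Longrightarrow> z \<in> X \<times> Y \<and> dist (H i j z) (H i j (x0, y0)) < e"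
    by metis
  \<comment> \<open>Half of the minimum, because the distance in the product is estimated by the sum
    of the two distances.\<close>
  define \<rho> where "\<rho> = Min (range (\<lambda>(i, j). d i j)) / 2"
  have "Min (range (\<lambda>(i, j). d i j)) > 0" using d(1) by (subst Min_gr_iff) auto
  then have "\<rho> > 0" by (simp add: \<rho>_def)
  have \<rho>d: "2 * \<rho> \<le> d i j" for i j
    unfolding \<rho>_def by (simp, intro Min_le) (auto simp: image_iff)
  have near: "(x, y) \<in> X \<times> Y \<and> \<bar>H i j (x, y) - M $ i $ j\<bar> < e"
    if "x \<in> ball x0 \<rho>" "y \<in> ball y0 \<rho>" for x y i j
  proof -
    have "dist (x, y) (x0, y0) \<le> dist x x0 + dist y y0"
      unfolding dist_Pair_Pair by (rule sqrt_sum_squares_le_sum) auto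
    also have "\<dots> < d i j" using that \<rho>d[of i j] by (auto simp: dist_commute)
    finally show ?thesis using d(2)[of "(x, y)" i j] by (auto simp: M dist_real_def)
  qed
  have "ball x0 \<rho> \<subseteq> X" "ball y0 \<rho> \<subseteq> Y"
    using near \<open>\<rho> > 0\<close> centre_in_ball by blast+
  moreover have "\<bar>ddir \<Phi> (axis i 1, 0) (x, y) - ddir \<Phi> (axis i 1, 0) (x, y')
        - (M *v (y - y')) $ i\<bar> \<le> \<epsilon> * norm (y - y')"
    if x: "x \<in> ball x0 \<rho>" and y: "y \<in> ball y0 \<rho>" and y': "y' \<in> ball y0 \<rho>" for i x y y'
  proof -
    have D: "((\<lambda>t. \<Phi> (x + t *\<^sub>R axis i 1, y)) has_real_derivative ddir \<Phi> (axis i 1, 0) (x, y)) (at 0)"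
      if "y \<in> ball y0 \<rho>" for y
    proof -
      have "((\<chi> j. vec_nth x j), y) \<in> X \<times> Y" using near[OF x that] by simp
      from has_real_derivative_fst_upd[OF assms(1) this, of i]
      have "((\<lambda>t. \<Phi> (x + (t - x $ i) *\<^sub>R axis i 1, y)) has_real_derivative ddir \<Phi> (axis i 1, 0) (x, y)) (at (0 + x $ i))"
        unfolding vec_upd by simp
      then show ?thesis by (subst (asm) DERIV_shift) simp
    qed
    \<comment> \<open>A second difference of \<Phi>, in x by a step t and in y from y to y', divided
      by t. It is bounded for all small nonzero t, and the claim is its limit as t tends to
      0.\<close>
    let ?q = "\<lambda>t. (\<Phi> (x + t *\<^sub>R axis i 1, y) - \<Phi> (x + t *\<^sub>R axis i 1, y') - (\<Phi> (x, y) - \<Phi> (x, y'))) / t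
         - (M *v (y - y')) $ i"
    have lim: "((\<lambda>t. \<bar>?q t\<bar>) \<longlongrightarrow> \<bar>ddir \<Phi> (axis i 1, 0) (x, y) - ddir \<Phi> (axis i 1, 0) (x, y')
        - (M *v (y - y')) $ i\<bar>) (at 0)"
      using DERIV_diff[OF D[OF y] D[OF y']] unfolding DERIV_def
      by (intro tendsto_rabs tendsto_diff tendsto_const) simp
    have "((\<lambda>t::real. x + t *\<^sub>R axis i 1) \<longlongrightarrow> x) (at 0)"
      by (auto intro!: tendsto_eq_intros)
    then have "\<forall>\<^sub>F t in at 0. x + t *\<^sub>R axis i 1 \<in> ball x0 \<rho>"
      using x by (rule topological_tendstoD[OF _ open_ball])
    moreover have "\<forall>\<^sub>F t in at (0::real). t \<noteq> 0" by (simp add: eventually_at_filter)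
    ultimately have "\<forall>\<^sub>F t in at 0. \<bar>?q t\<bar> \<le> \<epsilon> * norm (y - y')"
    proof eventually_elim
      case (elim t)
      define x' where "x' = x + t *\<^sub>R axis i (1::real)"
      have x': "x' \<in> ball x0 \<rho>" using elim(1) by (simp add: x'_def)
      have seg: "x + s *\<^sub>R (t *\<^sub>R axis i 1) \<in> ball x0 \<rho>" if "0 \<le> s" "s \<le> 1" for s
      proof -
        have "x + s *\<^sub>R (t *\<^sub>R axis i 1) = (1 - s) *\<^sub>R x + s *\<^sub>R x'"
          by (simp add: x'_def algebra_simps)
        also have "\<dots> \<in> ball x0 \<rho>"
          using convexD[OF convex_ball x x', of "1 - s" s] that by simp
        finally show ?thesis .
      qed
      have inner: "\<bar>ddir \<Phi> (0, axis j 1) (x', z) - ddir \<Phi> (0, axis j 1) (x, z) - t * (M $ i $ j)\<bar> \<le> e * \<bar>t\<bar>"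
        if z: "z \<in> ball y0 \<rho>" for z j
      proof -
        let ?f = "\<lambda>s. ddir \<Phi> (0, axis j 1) (x + s *\<^sub>R axis i 1, z) - s * (M $ i $ j)"
        have Df: "(?f has_real_derivative H i j (x + s *\<^sub>R axis i 1, z) - M $ i $ j) (at s)"
          if "x + s *\<^sub>R axis i 1 \<in> ball x0 \<rho>" for s
        proof -
          have "((\<chi> l. vec_nth (x + s *\<^sub>R axis i 1) l), z) \<in> X \<times> Y"
            unfolding vec_lambda_eta using near[OF that z] by simp
          from has_real_derivative_fst_upd[OF smooth_on_ddir[OF assms(1), of "(0, axis j 1)"] this, of i]
          have *: "((\<lambda>u. ddir \<Phi> (0, axis j 1) (x + u *\<^sub>R axis i 1 - (x $ i) *\<^sub>R axis i 1, z)) has_real_derivative 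
             H i j (x + s *\<^sub>R axis i 1, z)) (at (s + x $ i))"
            unfolding vec_upd vec_lambda_eta H_def by (simp add: algebra_simps)
          have "((\<lambda>u. ddir \<Phi> (0, axis j 1) (x + u *\<^sub>R axis i 1, z)) has_real_derivative 
             H i j (x + s *\<^sub>R axis i 1, z)) (at s)"
            using * by (subst (asm) DERIV_shift) (simp add: algebra_simps)
          then show ?thesis by (auto intro!: derivative_eq_intros)
        qed
        have "norm (?f t - ?f 0) \<le> e * norm (t - 0)"
        proof (rule field_differentiable_bound[of "closed_segment 0 t"])
          fix s assume "s \<in> closed_segment 0 t"
          then obtain u where u: "0 \<le> u" "u \<le> 1" "s = u * t" by (auto simp: in_segment)
          have s: "x + s *\<^sub>R axis i 1 \<in> ball x0 \<rho>" using seg[OF u(1,2)] u(3) by simp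
          show "(?f has_field_derivative H i j (x + s *\<^sub>R axis i 1, z) - M $ i $ j) (at s within closed_segment 0 t)"
            using Df[OF s] by (rule has_field_derivative_at_within)
          show "norm (H i j (x + s *\<^sub>R axis i 1, z) - M $ i $ j) \<le> e"
            using near[OF s z, of i j] by simp
        qed auto
        then show ?thesis by (simp add: x'_def)
      qed
      let ?k = "\<lambda>z. \<Phi> (x', z) - \<Phi> (x, z) - t * (M *v z) $ i"
      \<comment> \<open>\<open>inner\<close> bounds the y-partials of \<open>?k\<close> by the mean
        value theorem in x; a second mean value theorem, in y, yields a bound proportional both to
        |t| and to the distance of y and y'.\<close>
      have "norm (?k y - ?k y') \<le> (real CARD('n) * (e * \<bar>t\<bar>)) * norm (y - y')"
      proof (rule differentiable_bound[OF convex_ball[of y0 \<rho>]])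
        fix z assume z: "z \<in> ball y0 \<rho>"
        let ?k' = "\<lambda>w. ddir \<Phi> (0, w) (x', z) - ddir \<Phi> (0, w) (x, z) - t * (M *v w) $ i"
        have "((\<lambda>z. (M *v z) $ i) has_derivative (\<lambda>w. (M *v w) $ i)) (at z)"
          by (intro bounded_linear_imp_has_derivative bounded_linear_compose[OF bounded_linear_vec_nth]
                linear_linear[THEN iffD2] matrix_vector_mul_linear)
        then have Dk: "(?k has_derivative ?k') (at z)"
          by (intro has_derivative_diff has_derivative_mult_right has_derivative_snd[OF assms(1)])
            (use near[OF x z] near[OF x' z] in auto)
        then show "(?k has_derivative ?k') (at z within ball y0 \<rho>)"
          by (rule has_derivative_at_withinI)
        have "\<bar>?k' b\<bar> \<le> e * \<bar>t\<bar>" if bB: "b \<in> Basis" for b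
        proof -
          obtain j where b: "b = axis j 1" using bB by (auto simp: Basis_vec_def)
          show ?thesis using inner[OF z, of j] by (simp add: b matrix_vector_mul_component inner_axis)
        qed
        from linear_bound_Basis[OF has_derivative_linear[OF Dk] this]
        show "onorm ?k' \<le> real CARD('n) * (e * \<bar>t\<bar>)"
          by (intro onorm_le) simp
      qed (use y y' in auto)
      also have "real CARD('n) * (e * \<bar>t\<bar>) = \<epsilon> * \<bar>t\<bar>" by (simp add: e_def)
      also have "?k y - ?k y' = t * ?q t"
        using elim(2) by (simp add: x'_def field_simps matrix_vector_mult_diff_distrib)
      finally have "\<bar>t\<bar> * \<bar>?q t\<bar> \<le> \<bar>t\<bar> * (\<epsilon> * norm (y - y'))"
        by (simp add: abs_mult mult_ac)
      then show ?case using elim(2) by simp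
    qed
    from tendsto_upperbound[OF lim this] show ?thesis by simp
  qed
  ultimately show ?thesis using \<open>\<rho> > 0\<close> unfolding M_def by blast
qed

section \<open>One-dimensional estimates in a weighted box\<close>

text \<open>Three nested boxes around c: point masses lie within \<open>\<rho>\<close> of c in every
  coordinate, the weight lives on \<open>side\<close> of half-width \<open>2 * \<rho>\<close>, and
  symbols are defined on the open box \<open>U\<close> of half-width \<open>3 * \<rho>\<close>. So
  derivatives exist at the ends of \<open>side\<close>, and intervals of length at most
  \<open>\<rho> / 2\<close> that start at a point mass stay where \<open>\<eta>\<close> is at least
  \<open>\<rho>\<^sup>2\<close>.\<close>

locale weighted_box =
  fixes c :: "'m::finite \<Rightarrow> real" and \<rho> :: real and N :: nat
  assumes \<rho>_pos: "\<rho> > 0"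
begin

definition U :: "('m \<Rightarrow> real) set" where "U = {x. \<forall>j. \<bar>x j - c j\<bar> < 3 * \<rho>}"

definition \<eta> :: "'m \<Rightarrow> real \<Rightarrow> real" where "\<eta> j t = 4 * \<rho>\<^sup>2 - (t - c j)\<^sup>2"

definition side :: "'m \<Rightarrow> real set" where "side j = {c j - 2 * \<rho>..c j + 2 * \<rho>}"

lemma open_U: "open U"
proof -
  have "U = (\<Inter>j. {x. \<bar>x j - c j\<bar> < 3 * \<rho>})" by (auto simp: U_def)
  moreover have "open {x :: 'm \<Rightarrow> real. \<bar>x j - c j\<bar> < 3 * \<rho>}" for j
    by (intro open_Collect_less continuous_intros continuous_on_product_coordinates)
  ultimately show ?thesis by auto
qed

lemma upd_in_U: "x \<in> U \<Longrightarrow> t \<in> side j \<Longrightarrow> x(j := t) \<in> U"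
  using \<rho>_pos by (auto simp: U_def side_def abs_less_iff)

lemma continuous_on_upd: "continuous_on S (\<lambda>t. x(j := t :: real))"
proof (rule continuous_on_coordinatewise_then_product)
  show "continuous_on S (\<lambda>t. (x(j := t)) i)" for i by (cases "i = j") auto
qed

lemma continuous_on_line:
  assumes "continuous_on U f" "x \<in> U"
  shows "continuous_on (side j) (\<lambda>t. f (x(j := t)))"
  by (rule continuous_on_compose2[OF assms(1) continuous_on_upd]) (use upd_in_U assms in auto)

lemma vector_derivative_line:
  assumes "\<And>x. x \<in> U \<Longrightarrow> has_partial f j (g x) x" "x(j := t) \<in> U"
  shows "((\<lambda>t. f (x(j := t))) has_vector_derivative g (x(j := t))) (at t)"
  using assms(1)[OF assms(2)] by simp

lemma real_derivative_line:
  assumes "\<And>x. x \<in> U \<Longrightarrow> ((\<lambda>t. f (x(j := t))) has_real_derivative g x) (at (x j))" "x(j := t) \<in> U"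
  shows "((\<lambda>t. f (x(j := t))) has_real_derivative g (x(j := t))) (at t)"
  using assms(1)[OF assms(2)] by simp

lemma symb_coord_U: "symb k I U (\<lambda>i x. of_real (x j))"
proof (rule symb_coord)
  fix x assume "x \<in> U"
  then have "\<bar>x j - c j\<bar> < 3 * \<rho>" by (auto simp: U_def)
  then show "\<bar>x j\<bar> \<le> \<bar>c j\<bar> + 3 * \<rho>" by linarith
qed

lemma has_vector_derivative_cis_phase:
  assumes "(\<psi> has_real_derivative d) (at t)"
  shows "((\<lambda>t. cis (\<Lambda> * \<psi> t)) has_vector_derivative (\<i> * of_real (\<Lambda> * d) * cis (\<Lambda> * \<psi> t))) (at t)"
proof -
  have "((\<lambda>t. \<i> * of_real (\<Lambda> * \<psi> t)) has_vector_derivative (\<i> * of_real (\<Lambda> * d))) (at t)"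
    by (intro has_vector_derivative_mult_right has_vector_derivative_of_real_comp DERIV_cmult assms)
  from field_vector_diff_chain_at[OF this DERIV_exp]
  show ?thesis by (simp add: o_def cis_conv_exp)
qed

text \<open>The weight \<open>\<eta>\<^sup>N\<close> vanishes to order \<open>N\<close> at the ends of the interval, so \<open>N\<close> integrations
  by parts produce no boundary terms.\<close>

lemma nonstationary_phase_1d:
  fixes \<psi> d :: "'i \<Rightarrow> ('m \<Rightarrow> real) \<Rightarrow> real"
  assumes \<psi>: "\<And>i x. i \<in> I \<Longrightarrow> x \<in> U \<Longrightarrow> ((\<lambda>t. \<psi> i (x(j := t))) has_real_derivative d i x) (at (x j))"
    and \<psi>c: "\<And>i. i \<in> I \<Longrightarrow> continuous_on U (\<psi> i)"
    and d: "symb n I U (\<lambda>i x. of_real (d i x))"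
    and lower: "c0 > 0" "\<And>i x. i \<in> I \<Longrightarrow> x \<in> U \<Longrightarrow> c0 \<le> \<bar>d i x\<bar>"
  shows "symb n I U a \<Longrightarrow> \<exists>D>0. \<forall>i\<in>I. \<forall>x\<in>U. \<forall>\<Lambda>>0.
     norm (integral (side j) (\<lambda>t. of_real (\<eta> j t ^ n) * (cis (\<Lambda> * \<psi> i (x(j := t))) * a i (x(j := t)))))
       \<le> D / \<Lambda> ^ n"
  using d
proof (induction n arbitrary: a)
  case 0
  obtain C where C: "C > 0" "\<forall>i\<in>I. \<forall>x\<in>U. norm (a i x) \<le> C" using symb_bounded[OF 0(1)] by auto
  have "norm (integral (side j) (\<lambda>t. cis (\<Lambda> * \<psi> i (x(j := t))) * a i (x(j := t)))) \<le> C * (4 * \<rho>)"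
    if "i \<in> I" "x \<in> U" for i x \<Lambda>
  proof -
    have "norm (integral (side j) (\<lambda>t. cis (\<Lambda> * \<psi> i (x(j := t))) * a i (x(j := t)))) \<le>
        C * (c j + 2 * \<rho> - (c j - 2 * \<rho>))"
      unfolding side_def
    proof (rule integral_bound)
      show "continuous_on {c j - 2 * \<rho>..c j + 2 * \<rho>} (\<lambda>t. cis (\<Lambda> * \<psi> i (x(j := t))) * a i (x(j := t)))"
        using continuous_on_line[OF symb_cont[OF 0(1) that(1)] that(2), of j]
          continuous_on_line[OF \<psi>c[OF that(1)] that(2), of j]
        by (auto simp: side_def cis_conv_exp intro!: continuous_intros simp del: fun_upd_apply)
      show "norm (cis (\<Lambda> * \<psi> i (x(j := t))) * a i (x(j := t))) \<le> C" if "t \<in> {c j - 2 * \<rho>..c j + 2 * \<rho>}" for t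
        using C(2) \<open>i \<in> I\<close> upd_in_U[OF \<open>x \<in> U\<close>, of t j] that
        by (auto simp: norm_mult side_def simp del: fun_upd_apply)
    qed (use \<rho>_pos in auto)
    then show ?thesis by simp
  qed
  then show ?case using C(1) \<rho>_pos by (intro exI[of _ "C * (4 * \<rho>)"]) (auto simp del: fun_upd_apply)
next
  case (Suc n)
  \<comment> \<open>The amplitude divided by the phase derivative: the exponential times
    \<open>a\<close> is, up to the factor \<open>\<i> * \<Lambda>\<close>, the derivative of the
    exponential times \<open>b\<close>.\<close>
  define b where "b i x = a i x * inverse (of_real (d i x))" for i x
  have b: "symb (Suc n) I U b"
    unfolding b_def
    by (rule symb_mult[OF Suc.prems(1) symb_inverse[OF lower(1) Suc.prems(2)]]) (simp add: lower(2))
  obtain b' where b': "symb n I U b'"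
    "\<forall>i\<in>I. \<forall>x\<in>U. has_partial (b i) j (b' i x) x"
    using symb_deriv[OF b, of j] by blast
  \<comment> \<open>The amplitude left after one integration by parts: the t-derivative of
    \<open>\<eta> j t ^ Suc n\<close> times \<open>b\<close>, with the common factor
    \<open>\<eta> j t ^ n\<close> taken out. It is spelled out in sums and products so that the
    symbol rules apply.\<close>
  define e where "e i x = of_real (- 2 * real (Suc n)) * ((of_real (x j) + of_real (- c j)) * b i x)
     + (of_real (4 * \<rho>\<^sup>2) + - 1 * ((of_real (x j) + of_real (- c j)) * (of_real (x j) + of_real (- c j)))) * b' i x"
    for i :: 'i and x
  have s: "symb n I U (\<lambda>i x. of_real (x j) + of_real (- c j))"
    by (rule symb_add[OF symb_coord_U symb_const[of _ _ "\<bar>c j\<bar>"]]) auto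
  have s2: "symb n I U (\<lambda>i x. of_real (4 * \<rho>\<^sup>2))"
    by (rule symb_const[of _ _ "norm (complex_of_real (4 * \<rho>\<^sup>2))"]) (rule order_refl)
  have s3: "symb n I U (\<lambda>i x. of_real (- c j))"
    by (rule symb_const[of _ _ "norm (complex_of_real (- c j))"]) (rule order_refl)
  have e: "symb n I U e"
    unfolding e_def
    by (intro symb_add[of n I U] symb_cmult[of n I U] symb_mult[of n I U] s b' symb_Suc_imp[OF b]
          symb_coord_U s2 s3)
  obtain D where D: "D > 0" "\<forall>i\<in>I. \<forall>x\<in>U. \<forall>\<Lambda>>0.
     norm (integral (side j) (\<lambda>t. of_real (\<eta> j t ^ n) * (cis (\<Lambda> * \<psi> i (x(j := t))) * e i (x(j := t)))))
       \<le> D / \<Lambda> ^ n"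
    using Suc.IH[OF e symb_Suc_imp[OF Suc.prems(2)]] by blast
  have "norm (integral (side j) (\<lambda>t. of_real (\<eta> j t ^ Suc n) * (cis (\<Lambda> * \<psi> i (x(j := t))) * a i (x(j := t)))))
       \<le> D / \<Lambda> ^ Suc n" if i: "i \<in> I" and x: "x \<in> U" and L: "\<Lambda> > 0" for i x \<Lambda>
  proof -
    let ?E = "\<lambda>t. cis (\<Lambda> * \<psi> i (x(j := t)))"
    let ?g = "\<lambda>t. complex_of_real (\<eta> j t ^ Suc n) * (?E t * b i (x(j := t)))"
    let ?f1 = "\<lambda>t. of_real (\<eta> j t ^ Suc n) * (?E t * a i (x(j := t)))"
    let ?f2 = "\<lambda>t. of_real (\<eta> j t ^ n) * (?E t * e i (x(j := t)))"
    have dg: "(?g has_vector_derivative (\<i> * of_real \<Lambda> * ?f1 t + ?f2 t)) (at t)" if t: "t \<in> side j" for t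
    proof -
      have xt: "x(j := t) \<in> U" using upd_in_U[OF x t] .
      have nz: "d i (x(j := t)) \<noteq> 0" using lower(2)[OF i xt] lower(1) by auto
      have E: "(?E has_vector_derivative (\<i> * of_real (\<Lambda> * d i (x(j := t))) * ?E t)) (at t)"
        by (rule has_vector_derivative_cis_phase[OF real_derivative_line[OF \<psi>[OF i] xt]])
      have B: "((\<lambda>t. b i (x(j := t))) has_vector_derivative b' i (x(j := t))) (at t)"
        by (rule vector_derivative_line[OF _ xt]) (use b'(2) i in blast)
      have "((\<lambda>t. \<eta> j t ^ Suc n) has_real_derivative (real (Suc n) * (- 2 * (t - c j)) * \<eta> j t ^ n)) (at t)"
        unfolding \<eta>_def by (rule derivative_eq_intros refl | simp)+
      then have H: "((\<lambda>t. complex_of_real (\<eta> j t ^ Suc n)) has_vector_derivative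
            of_real (real (Suc n) * (- 2 * (t - c j)) * \<eta> j t ^ n)) (at t)"
        by (rule has_vector_derivative_of_real_comp)
      have "\<i> * of_real \<Lambda> * ?f1 t + ?f2 t = complex_of_real (\<eta> j t ^ Suc n) *
          (?E t * b' i (x(j := t)) + \<i> * of_real (\<Lambda> * d i (x(j := t))) * ?E t * b i (x(j := t))) +
          of_real (real (Suc n) * (- 2 * (t - c j)) * \<eta> j t ^ n) * (?E t * b i (x(j := t)))"
      proof -
        have a: "a i (x(j := t)) = of_real (d i (x(j := t))) * b i (x(j := t))"
          using nz by (simp add: b_def)
        show ?thesis unfolding a e_def \<eta>_def
          by (simp add: algebra_simps power2_eq_square)
      qed
      with has_vector_derivative_mult[OF H has_vector_derivative_mult[OF E B]]
      show ?thesis by simp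
    qed
    have lr: "c j - 2 * \<rho> \<le> c j + 2 * \<rho>" using \<rho>_pos by simp
    have tot: "((\<lambda>t. \<i> * of_real \<Lambda> * ?f1 t + ?f2 t) has_integral (?g (c j + 2 * \<rho>) - ?g (c j - 2 * \<rho>))) (side j)"
      unfolding side_def
      by (rule fundamental_theorem_of_calculus[OF lr])
         (use dg in \<open>auto simp: side_def intro: has_vector_derivative_at_within simp del: fun_upd_apply\<close>)
    have ends: "?g (c j + 2 * \<rho>) = 0" "?g (c j - 2 * \<rho>) = 0"
      by (auto simp: \<eta>_def power2_eq_square)
    have "continuous_on (side j) ?f2"
      using continuous_on_line[OF symb_cont[OF e i] x, of j] continuous_on_line[OF \<psi>c[OF i] x, of j]
      by (auto simp: \<eta>_def cis_conv_exp intro!: continuous_intros simp del: fun_upd_apply)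
    then have "?f2 integrable_on side j" unfolding side_def by (rule integrable_continuous_real)
    then have f2: "(?f2 has_integral integral (side j) ?f2) (side j)" by (rule integrable_integral)
    have "((\<lambda>t. \<i> * of_real \<Lambda> * ?f1 t) has_integral - integral (side j) ?f2) (side j)"
      using has_integral_diff[OF tot f2] unfolding ends by simp
    from has_integral_mult_right[OF this, of "1 / (\<i> * of_real \<Lambda>)"]
    have "(?f1 has_integral (1 / (\<i> * of_real \<Lambda>)) * (- integral (side j) ?f2)) (side j)"
      using L by simp
    then have "norm (integral (side j) ?f1) = norm (integral (side j) ?f2) / \<Lambda>"
      using L by (simp add: integral_unique norm_mult norm_divide)
    also have "\<dots> \<le> (D / \<Lambda> ^ n) / \<Lambda>"
      using D(2) i x L by (intro divide_right_mono) auto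
    finally show ?thesis by (simp add: mult.commute)
  qed
  then show ?case using D(1) by blast
qed

section \<open>The weighted product measure\<close>

definition wt :: "'m \<Rightarrow> real \<Rightarrow> real" where "wt j t = indicator (side j) t * \<eta> j t ^ N"

definition M :: "'m \<Rightarrow> real measure" where "M j = density lborel (\<lambda>t. ennreal (wt j t))"

text \<open>Turns a function that is continuous on \<open>U\<close> only into a Borel function on
  the whole product space. The product of the measures \<open>M j\<close> lives on the product of
  the intervals \<open>side j\<close>, inside \<open>U\<close>, so integrals are unaffected.\<close>

definition zero_ext :: "(('m \<Rightarrow> real) \<Rightarrow> 'b::real_vector) \<Rightarrow> ('m \<Rightarrow> real) \<Rightarrow> 'b" where
  "zero_ext f x = (if x \<in> U then f x else 0)"

lemma \<eta>_nonneg: "t \<in> side j \<Longrightarrow> 0 \<le> \<eta> j t"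
proof -
  assume "t \<in> side j"
  then have "\<bar>t - c j\<bar> \<le> 2 * \<rho>" by (auto simp: side_def abs_le_iff)
  then have "(t - c j)\<^sup>2 \<le> (2 * \<rho>)\<^sup>2" using \<rho>_pos abs_le_square_iff[of "t - c j" "2 * \<rho>"] by simp
  then show ?thesis by (simp add: \<eta>_def power_mult_distrib)
qed

lemma wt_nonneg: "0 \<le> wt j t"
  using \<eta>_nonneg by (auto simp: wt_def indicator_def)

lemma wt_le: "wt j t \<le> (4 * \<rho>\<^sup>2) ^ N * indicator (side j) t"
proof (cases "t \<in> side j")
  case True
  have "\<eta> j t ^ N \<le> (4 * \<rho>\<^sup>2) ^ N"
    by (rule power_mono) (use \<eta>_nonneg[OF True] in \<open>auto simp: \<eta>_def\<close>)
  then show ?thesis using True by (simp add: wt_def)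
qed (simp add: wt_def)

lemma wt_measurable [measurable]: "wt j \<in> borel_measurable borel"
  unfolding wt_def \<eta>_def side_def by measurable

lemma sets_M [simp, measurable_cong]: "sets (M j) = sets borel"
  by (simp add: M_def)

lemma space_M [simp]: "space (M j) = UNIV"
  by (simp add: M_def)

lemma finite_measure_M: "finite_measure (M j)"
proof
  have "emeasure (M j) (space (M j)) = (\<integral>\<^sup>+ t. ennreal (wt j t) \<partial>lborel)"
    by (simp add: M_def emeasure_density)
  also have "\<dots> \<le> (\<integral>\<^sup>+ t. ennreal ((4 * \<rho>\<^sup>2) ^ N) * indicator (side j) t \<partial>lborel)"
    by (intro nn_integral_mono) (use wt_le in \<open>simp add: ennreal_leI flip: ennreal_indicator ennreal_mult''\<close>)
  also have "\<dots> = ennreal ((4 * \<rho>\<^sup>2) ^ N) * emeasure lborel (side j)"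
    by (subst nn_integral_cmult_indicator) (auto simp: side_def)
  also have "\<dots> < \<infinity>" using \<rho>_pos by (simp add: side_def ennreal_mult_less_top)
  finally show "emeasure (M j) (space (M j)) \<noteq> \<infinity>" by simp
qed

sublocale product_sigma_finite M
  by (rule product_sigma_finite.intro) (rule finite_measure.axioms(1)[OF finite_measure_M])

lemma finite_measure_PiM: "finite_measure (Pi\<^sub>M J M)"
proof
  have "finite J" by simp
  have "space (Pi\<^sub>M J M) = Pi\<^sub>E J (\<lambda>_. UNIV)" by (simp add: space_PiM)
  then have "emeasure (Pi\<^sub>M J M) (space (Pi\<^sub>M J M)) = (\<Prod>j\<in>J. emeasure (M j) UNIV)"
    using emeasure_PiM[OF \<open>finite J\<close>, of "\<lambda>_. UNIV"] by simp
  also have "\<dots> \<noteq> \<infinity>"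
    using finite_measure.emeasure_finite[OF finite_measure_M] by (simp add: ennreal_prod_eq_top)
  finally show "emeasure (Pi\<^sub>M J M) (space (Pi\<^sub>M J M)) \<noteq> \<infinity>" .
qed

lemma sets_PiM_M: "sets (Pi\<^sub>M UNIV M) = sets borel"
proof -
  have "sets (Pi\<^sub>M UNIV M) = sets (Pi\<^sub>M UNIV (\<lambda>_::'m. borel :: real measure))"
    by (intro sets_PiM_cong) auto
  then show ?thesis using sets_PiM_equal_borel by simp
qed

lemma zero_ext_measurable:
  fixes f :: "('m \<Rightarrow> real) \<Rightarrow> 'b::real_normed_vector"
  assumes "continuous_on U f"
  shows "zero_ext f \<in> borel_measurable borel"
proof -
  have "(\<lambda>x. indicator U x *\<^sub>R f x) \<in> borel_measurable borel"
    by (rule borel_measurable_continuous_on_indicator[OF _ assms]) (simp add: open_U)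
  moreover have "(\<lambda>x. indicator U x *\<^sub>R f x) = zero_ext f" by (auto simp: zero_ext_def)
  ultimately show ?thesis by simp
qed

lemma zero_ext_line_measurable:
  fixes f :: "('m \<Rightarrow> real) \<Rightarrow> 'b::real_normed_vector"
  assumes "continuous_on U f"
  shows "(\<lambda>t. zero_ext f (x(j := t))) \<in> borel_measurable borel"
  by (rule measurable_compose[OF borel_measurable_continuous_onI[OF continuous_on_upd] zero_ext_measurable[OF assms]])

lemma zero_ext_integrable:
  fixes f :: "('m \<Rightarrow> real) \<Rightarrow> 'b::{banach, second_countable_topology}"
  assumes "continuous_on U f" "\<And>x. x \<in> U \<Longrightarrow> norm (f x) \<le> B"
  shows "integrable (Pi\<^sub>M UNIV M) (zero_ext f)"
proof (rule finite_measure.integrable_const_bound[OF finite_measure_PiM, of _ "max B 0"])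
  show "AE x in Pi\<^sub>M UNIV M. norm (zero_ext f x) \<le> max B 0"
    by (rule AE_I2) (use assms(2) in \<open>auto simp: zero_ext_def le_max_iff_disj\<close>)
  show "zero_ext f \<in> borel_measurable (Pi\<^sub>M UNIV M)"
    using zero_ext_measurable[OF assms(1)] measurable_cong_sets[OF sets_PiM_M refl] by blast
qed

text \<open>Fubini: the integral along the j-th coordinate is the one-dimensional one with weight
  \<open>\<eta> j t ^ N\<close>, bounded uniformly in the other coordinates, and these carry finite
  total mass.\<close>

lemma oscillatory_integral_bound:
  fixes \<psi> d :: "'i \<Rightarrow> ('m \<Rightarrow> real) \<Rightarrow> real"
  assumes \<psi>: "\<And>i x. i \<in> I \<Longrightarrow> x \<in> U \<Longrightarrow> ((\<lambda>t. \<psi> i (x(j := t))) has_real_derivative d i x) (at (x j))"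
    and \<psi>c: "\<And>i. i \<in> I \<Longrightarrow> continuous_on U (\<psi> i)"
    and d: "symb N I U (\<lambda>i x. of_real (d i x))"
    and lower: "c0 > 0" "\<And>i x. i \<in> I \<Longrightarrow> x \<in> U \<Longrightarrow> c0 \<le> \<bar>d i x\<bar>"
    and a: "symb N I U a"
  shows "\<exists>D>0. \<forall>i\<in>I. \<forall>\<Lambda>>0.
     norm (\<integral>x. zero_ext (\<lambda>x. cis (\<Lambda> * \<psi> i x) * a i x) x \<partial>Pi\<^sub>M UNIV M) \<le> D / \<Lambda> ^ N"
proof -
  obtain D where D: "D > 0" "\<forall>i\<in>I. \<forall>x\<in>U. \<forall>\<Lambda>>0.
     norm (integral (side j) (\<lambda>t. of_real (\<eta> j t ^ N) * (cis (\<Lambda> * \<psi> i (x(j := t))) * a i (x(j := t)))))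
       \<le> D / \<Lambda> ^ N"
    using nonstationary_phase_1d[OF \<psi> \<psi>c d lower a] by blast
  obtain B where B: "B > 0" "\<forall>i\<in>I. \<forall>x\<in>U. norm (a i x) \<le> B" using symb_bounded[OF a] by auto
  let ?P = "Pi\<^sub>M (UNIV - {j}) M"
  define m where "m = measure ?P (space ?P)"
  have "norm (\<integral>x. zero_ext (\<lambda>x. cis (\<Lambda> * \<psi> i x) * a i x) x \<partial>Pi\<^sub>M UNIV M) \<le> (D * (m + 1)) / \<Lambda> ^ N"
    if i: "i \<in> I" and L: "\<Lambda> > 0" for i \<Lambda>
  proof -
    let ?h = "\<lambda>x. cis (\<Lambda> * \<psi> i x) * a i x"
    let ?f = "zero_ext ?h"
    have cont: "continuous_on U ?h"
      unfolding cis_conv_exp by (intro continuous_intros \<psi>c[OF i] symb_cont[OF a i])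
    have int: "integrable (Pi\<^sub>M UNIV M) ?f"
      by (rule zero_ext_integrable[OF cont, of B]) (use B i in \<open>auto simp: norm_mult\<close>)
    have ins: "insert j (UNIV - {j}) = UNIV" by auto
    have inner: "norm (\<integral>y. ?f (x(j := y)) \<partial>M j) \<le> D / \<Lambda> ^ N" for x
    proof -
      have dens: "(\<integral>y. ?f (x(j := y)) \<partial>M j) = (\<integral>y. wt j y *\<^sub>R ?f (x(j := y)) \<partial>lborel)"
        unfolding M_def
        by (rule integral_density) (use zero_ext_line_measurable[OF cont] wt_nonneg in auto)
      show ?thesis
      \<comment> \<open>A line in direction j either stays in \<open>U\<close> over all of
        \<open>side j\<close> or misses \<open>U\<close> there; its point over \<open>c j\<close>
        decides which.\<close>
      proof (cases "x(j := c j) \<in> U")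
        case True
        let ?g = "\<lambda>t. complex_of_real (\<eta> j t ^ N) * ?h ((x(j := c j))(j := t))"
        have inU: "x(j := y) \<in> U" if "y \<in> side j" for y
          using upd_in_U[OF True that] by simp
        have "(\<lambda>y. wt j y *\<^sub>R ?f (x(j := y))) = (\<lambda>y. indicator (side j) y *\<^sub>R ?g y)"
          using inU by (auto simp: wt_def indicator_def zero_ext_def scaleR_conv_of_real simp del: fun_upd_apply)
        then have "(\<integral>y. wt j y *\<^sub>R ?f (x(j := y)) \<partial>lborel) = (LINT y:side j|lborel. ?g y)"
          by (simp add: set_lebesgue_integral_def)
        also have "\<dots> = integral (side j) ?g"
        proof (rule set_borel_integral_eq_integral)
          have "continuous_on (side j) ?g"
            using continuous_on_line[OF cont True, of j]
            by (auto simp: \<eta>_def intro!: continuous_intros simp del: fun_upd_apply)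
          then show "set_integrable lborel (side j) ?g"
            unfolding side_def by (rule borel_integrable_atLeastAtMost')
        qed
        finally show ?thesis using D(2)[rule_format, OF i True L] dens by (simp del: fun_upd_apply)
      next
        case False
        have "x(j := y) \<notin> U" if "y \<in> side j" for y
          using upd_in_U[of "x(j := y)" "c j" j] False \<rho>_pos by (auto simp: side_def)
        then have "(\<lambda>y. wt j y *\<^sub>R ?f (x(j := y))) = (\<lambda>y. 0)"
          by (auto simp: wt_def indicator_def zero_ext_def simp del: fun_upd_apply)
        then show ?thesis using dens D(1) L by simp
      qed
    qed
    have "integral\<^sup>L (Pi\<^sub>M UNIV M) ?f = (\<integral>x. (\<integral>y. ?f (x(j := y)) \<partial>M j) \<partial>?P)"
      using product_integral_insert[of "UNIV - {j}" j ?f] int unfolding ins by simp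
    then have "norm (integral\<^sup>L (Pi\<^sub>M UNIV M) ?f) \<le> (\<integral>x. norm (\<integral>y. ?f (x(j := y)) \<partial>M j) \<partial>?P)"
      by (simp only: integral_norm_bound)
    also have "\<dots> \<le> (\<integral>x. D / \<Lambda> ^ N \<partial>?P)"
    proof (rule Bochner_Integration.integral_mono')
      show "integrable ?P (\<lambda>x. D / \<Lambda> ^ N)"
        by (rule finite_measure.integrable_const[OF finite_measure_PiM])
      show "0 \<le> D / \<Lambda> ^ N" using D(1) L by simp
    qed (rule inner)
    also have "\<dots> = (D / \<Lambda> ^ N) * m" by (simp add: m_def)
    also have "\<dots> \<le> (D * (m + 1)) / \<Lambda> ^ N"
      using D(1) L by (simp add: field_simps)
    finally show ?thesis .
  qed
  moreover have "D * (m + 1) > 0" using D(1) by (simp add: m_def add_nonneg_pos)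
  ultimately show ?thesis by blast
qed

lemma \<eta>_lower: "\<bar>t - c j\<bar> \<le> 3 / 2 * \<rho> \<Longrightarrow> \<rho>\<^sup>2 \<le> \<eta> j t"
proof -
  assume "\<bar>t - c j\<bar> \<le> 3 / 2 * \<rho>"
  then have "(t - c j)\<^sup>2 \<le> (3 / 2 * \<rho>)\<^sup>2" using \<rho>_pos abs_le_square_iff[of "t - c j" "3 / 2 * \<rho>"] by simp
  then have "4 * (t - c j)\<^sup>2 \<le> 9 * \<rho>\<^sup>2" by (simp add: power_mult_distrib power_divide)
  then show ?thesis unfolding \<eta>_def using zero_le_power2[of \<rho>] by linarith
qed

text \<open>\<open>(norm (f p))\<^sup>2\<close> is minus the integral over an interval of length l
  of the derivative of |f|^2 times a linear cutoff falling from 1 to 0. The term 2|f||f'| is split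
  by the arithmetic-geometric mean into |f|^2 / l + l |f'|^2. On the interval the weight is at least
  \<open>(\<rho>\<^sup>2) ^ N\<close>, so Lebesgue measure may be replaced by
  \<open>M j\<close>.\<close>

lemma sobolev_1d:
  fixes f g :: "('m \<Rightarrow> real) \<Rightarrow> complex"
  assumes f: "continuous_on U f" "\<And>x. x \<in> U \<Longrightarrow> has_partial f j (g x) x"
    and g: "continuous_on U g"
    and p: "p \<in> U" "\<bar>p j - c j\<bar> \<le> \<rho>" and l: "0 < l" "l \<le> \<rho> / 2"
  shows "ennreal ((norm (f p))\<^sup>2) \<le>
    (\<integral>\<^sup>+ y. ennreal (indicator {p j..p j + l} y *
        (2 / l * (norm (zero_ext f (p(j := y))))\<^sup>2 + l * (norm (zero_ext g (p(j := y))))\<^sup>2) / (\<rho>\<^sup>2) ^ N) \<partial>M j)"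
proof -
  let ?S = "{p j..p j + l}"
  have S: "?S \<subseteq> side j" using p(2) l \<rho>_pos by (auto simp: side_def abs_le_iff)
  have inU: "p(j := t) \<in> U" if "t \<in> ?S" for t using upd_in_U[OF p(1)] S that by blast
  let ?F = "\<lambda>t. f (p(j := t))" and ?F' = "\<lambda>t. g (p(j := t))"
  have cF: "continuous_on ?S ?F" and cF': "continuous_on ?S ?F'"
    using continuous_on_subset[OF continuous_on_line[OF f(1) p(1)] S]
      continuous_on_subset[OF continuous_on_line[OF g p(1)] S] by blast+
  let ?q = "\<lambda>t. 2 / l * (norm (?F t))\<^sup>2 + l * (norm (?F' t))\<^sup>2"
  let ?G' = "\<lambda>t. (1 - (t - p j) / l) * (2 * (?F t \<bullet> ?F' t)) + (- (1 / l)) * (?F t \<bullet> ?F t)"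
  have "(?G' has_integral ((1 - (p j + l - p j) / l) * (?F (p j + l) \<bullet> ?F (p j + l)) -
      (1 - (p j - p j) / l) * (?F (p j) \<bullet> ?F (p j)))) ?S"
  proof (rule fundamental_theorem_of_calculus)
    show "((\<lambda>t. (1 - (t - p j) / l) * (?F t \<bullet> ?F t)) has_vector_derivative ?G' t) (at t within ?S)"
      if t: "t \<in> ?S" for t
    proof -
      have D: "(?F has_derivative (\<lambda>h. h *\<^sub>R ?F' t)) (at t)"
        using vector_derivative_line[of f j g p t] f(2) inU[OF t]
        unfolding has_vector_derivative_def by blast
      have I: "((\<lambda>t. ?F t \<bullet> ?F t) has_real_derivative 2 * (?F t \<bullet> ?F' t)) (at t)"
        using has_derivative_inner[OF D D] unfolding has_field_derivative_def
        by (simp add: inner_commute algebra_simps mult_commute_abs)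
      have "((\<lambda>t. 1 - (t - p j) / l) has_real_derivative - (1 / l)) (at t)"
        using l(1) by (auto intro!: derivative_eq_intros)
      from DERIV_mult[OF this I]
      have "((\<lambda>t. (1 - (t - p j) / l) * (?F t \<bullet> ?F t)) has_real_derivative ?G' t) (at t)"
        by (rule DERIV_cong) (simp only: ac_simps)
      then show ?thesis
        unfolding has_real_derivative_iff_has_vector_derivative
        by (rule has_vector_derivative_at_within)
    qed
  qed (use l in simp)
  moreover have "(1 - (p j + l - p j) / l) * (?F (p j + l) \<bullet> ?F (p j + l)) -
      (1 - (p j - p j) / l) * (?F (p j) \<bullet> ?F (p j)) = - (norm (f p))\<^sup>2"
    using l(1) by (simp add: power2_norm_eq_inner)
  ultimately have "(?G' has_integral - (norm (f p))\<^sup>2) ?S" by (simp only:)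
  from has_integral_neg[OF this]
  have G: "((\<lambda>t. - ?G' t) has_integral (norm (f p))\<^sup>2) ?S" by (simp only: minus_minus)
  have "?q integrable_on ?S"
    by (intro integrable_continuous_real continuous_intros cF cF')
  then have q: "(?q has_integral integral ?S ?q) ?S" by (rule integrable_integral)
  have le: "(norm (f p))\<^sup>2 \<le> integral ?S ?q"
  proof (rule has_integral_le[OF G q])
    fix t assume t: "t \<in> ?S"
    have b: "0 \<le> 1 - (t - p j) / l" "1 - (t - p j) / l \<le> 1" using t l(1) by auto
    have "\<bar>(1 - (t - p j) / l) * (2 * (?F t \<bullet> ?F' t))\<bar> \<le> 1 * (2 * (norm (?F t) * norm (?F' t)))"
      unfolding abs_mult using b Cauchy_Schwarz_ineq2[of "?F t" "?F' t"] by (intro mult_mono) auto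
    also have "\<dots> \<le> 1 / l * (norm (?F t))\<^sup>2 + l * (norm (?F' t))\<^sup>2"
    proof -
      have "0 \<le> (norm (?F t) - l * norm (?F' t))\<^sup>2 / l" using l(1) by simp
      also have "\<dots> = 1 / l * (norm (?F t))\<^sup>2 + l * (norm (?F' t))\<^sup>2 - 2 * (norm (?F t) * norm (?F' t))"
        using l(1) by (simp add: power2_eq_square field_simps)
      finally show ?thesis by simp
    qed
    finally have "- ?G' t \<le> 1 / l * (norm (?F t))\<^sup>2 + l * (norm (?F' t))\<^sup>2 + (1 / l) * (?F t \<bullet> ?F t)"
      by (simp add: abs_le_iff)
    then show "- ?G' t \<le> ?q t" by (simp add: power2_norm_eq_inner)
  qed
  let ?Q = "\<lambda>y. indicator ?S y * (2 / l * (norm (zero_ext f (p(j := y))))\<^sup>2 + l * (norm (zero_ext g (p(j := y))))\<^sup>2)"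
  have Qnn: "0 \<le> ?Q y" for y using l(1) by (simp add: indicator_def)
  have Qm: "?Q \<in> borel_measurable borel"
    using zero_ext_line_measurable[OF f(1), of p j] zero_ext_line_measurable[OF g, of p j]
    by (intro borel_measurable_times borel_measurable_add borel_measurable_power borel_measurable_norm
        borel_measurable_const borel_measurable_indicator) auto
  have "(?Q has_integral integral ?S ?q) UNIV"
  proof -
    have "?Q = (\<lambda>y. if y \<in> ?S then ?q y else 0)"
      using inU by (auto simp: zero_ext_def indicator_def simp del: fun_upd_apply)
    then show ?thesis using q has_integral_restrict_UNIV[of ?S ?q] by simp
  qed
  from nn_integral_has_integral_lborel[OF Qm Qnn this]
  have "ennreal (integral ?S ?q) = (\<integral>\<^sup>+ y. ennreal (?Q y) \<partial>lborel)" by simp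
  also have "\<dots> \<le> (\<integral>\<^sup>+ y. ennreal (wt j y) * ennreal (?Q y / (\<rho>\<^sup>2) ^ N) \<partial>lborel)"
  proof (rule nn_integral_mono)
    fix y
    have "?Q y \<le> wt j y * (?Q y / (\<rho>\<^sup>2) ^ N)"
    proof (cases "y \<in> ?S")
      case True
      then have "\<bar>y - c j\<bar> \<le> 3 / 2 * \<rho>"
        using p(2) l unfolding atLeastAtMost_iff abs_le_iff by linarith
      from power_mono[OF \<eta>_lower[OF this], of N] True S
      have "(\<rho>\<^sup>2) ^ N \<le> wt j y" by (auto simp: wt_def)
      then have "(\<rho>\<^sup>2) ^ N * (?Q y / (\<rho>\<^sup>2) ^ N) \<le> wt j y * (?Q y / (\<rho>\<^sup>2) ^ N)"
        by (intro mult_right_mono divide_nonneg_nonneg Qnn) auto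
      then show ?thesis using \<rho>_pos by simp
    qed simp
    then show "ennreal (?Q y) \<le> ennreal (wt j y) * ennreal (?Q y / (\<rho>\<^sup>2) ^ N)"
      using wt_nonneg by (simp add: ennreal_leI flip: ennreal_mult')
  qed
  also have "\<dots> = (\<integral>\<^sup>+ y. ennreal (?Q y / (\<rho>\<^sup>2) ^ N) \<partial>M j)"
    unfolding M_def using Qm by (subst nn_integral_density) auto
  finally show ?thesis using le by (meson ennreal_leI order_trans)
qed

end

section \<open>Iterated Sobolev inequality\<close>

lemma nn_integral_sum_list:
  "(\<And>b. b \<in> set bs \<Longrightarrow> f b \<in> borel_measurable M) \<Longrightarrow>
   (\<integral>\<^sup>+x. (\<Sum>b\<leftarrow>bs. f b x) \<partial>M) = (\<Sum>b\<leftarrow>bs. \<integral>\<^sup>+x. f b x \<partial>M)"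
proof (induction bs)
  case (Cons b bs)
  have "(\<lambda>x. \<Sum>b\<leftarrow>bs. f b x) \<in> borel_measurable M" if "\<And>b. b \<in> set bs \<Longrightarrow> f b \<in> borel_measurable M" for bs
    using that by (induction bs) auto
  then show ?case using Cons by (simp add: nn_integral_add)
qed simp

text \<open>The setting of the L2 argument, with the points y as parameters from a metric space.
  \<open>phase_quot_symb\<close> makes the phase difference divided by \<open>dist y y'\<close> an
  admissible phase with bounds uniform in the pair.\<close>

locale phase_box = weighted_box c \<rho> N for c :: "'m::finite \<Rightarrow> real" and \<rho> :: real and N :: nat +
  fixes \<phi> :: "'y::metric_space \<Rightarrow> ('m \<Rightarrow> real) \<Rightarrow> real" and V :: "'y set"
    and d\<phi> :: "'m \<Rightarrow> 'y \<Rightarrow> ('m \<Rightarrow> real) \<Rightarrow> real"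
  assumes phase_cont: "\<And>y. y \<in> V \<Longrightarrow> continuous_on U (\<phi> y)"
    and phase_deriv: "\<And>j y x. y \<in> V \<Longrightarrow> x \<in> U \<Longrightarrow>
          ((\<lambda>t. \<phi> y (x(j := t))) has_real_derivative d\<phi> j y x) (at (x j))"
    and phase_symb: "\<And>k j. symb k V U (\<lambda>y x. of_real (d\<phi> j y x))"
    and phase_quot_symb: "\<And>k j. symb k {z \<in> V \<times> V. fst z \<noteq> snd z} U
          (\<lambda>z x. of_real ((d\<phi> j (fst z) x - d\<phi> j (snd z) x) / dist (fst z) (snd z)))"
begin

abbreviation P :: "(real \<times> 'y) set" where "P \<equiv> {1..} \<times> V"

definition osc ::
  "(real \<times> 'y \<Rightarrow> ('m \<Rightarrow> real) \<Rightarrow> complex) \<Rightarrow> real \<Rightarrow> 'y set \<Rightarrow> ('y \<Rightarrow> real) \<Rightarrow> ('m \<Rightarrow> real) \<Rightarrow> complex" where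
  "osc a \<omega> R \<nu> x = (\<Sum>y\<in>R. of_real (\<nu> y) * (cis (\<omega> * \<phi> y x) * a (\<omega>, y) x))"

lemma osc_continuous:
  assumes "symb k P U a" "1 \<le> \<omega>" "R \<subseteq> V"
  shows "continuous_on U (osc a \<omega> R \<nu>)"
  unfolding osc_def cis_conv_exp
  by (intro continuous_intros phase_cont symb_cont[OF assms(1)]) (use assms in auto)

text \<open>Differentiating the exponential gives \<omega> times a symbol; differentiating the
  amplitude gives a symbol, that is \<omega> times a symbol of size 1 / \<omega>. As all frequencies
  in \<open>P\<close> are at least 1, both belong to one bounded family, and the class of
  oscillatory sums is closed under \<open>1 / \<omega>\<close> times a partial derivative.\<close>

lemma osc_derivative:
  assumes "symb (Suc k) P U a"
  shows "\<exists>b. symb k P U b \<and> (\<forall>\<omega>\<ge>1. \<forall>R \<nu>. \<forall>x\<in>U. R \<subseteq> V \<longrightarrow>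
     ((\<lambda>t. osc a \<omega> R \<nu> (x(j := t))) has_vector_derivative of_real \<omega> * osc b \<omega> R \<nu> x) (at (x j)))"
proof -
  obtain a' where a': "symb k P U a'"
    "\<forall>i\<in>P. \<forall>x\<in>U. has_partial (a i) j (a' i x) x"
    using symb_deriv[OF assms, of j] by blast
  define b where "b i x = \<i> * (of_real (d\<phi> j (snd i) x) * a i x) + of_real (1 / fst i) * a' i x" for i x
  have s1: "symb k P U (\<lambda>i x. of_real (d\<phi> j (snd i) x))"
    by (rule symb_reindex[OF phase_symb]) auto
  have s2: "symb k P U (\<lambda>i x. complex_of_real (1 / fst i))"
    by (rule symb_const[of _ _ 1]) (auto simp: norm_divide)
  have b: "symb k P U b"
    unfolding b_def
    by (rule symb_add[OF symb_cmult[OF symb_mult[OF s1 symb_Suc_imp[OF assms]]] symb_mult[OF s2 a'(1)]])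
  have "((\<lambda>t. osc a \<omega> R \<nu> (x(j := t))) has_vector_derivative of_real \<omega> * osc b \<omega> R \<nu> x) (at (x j))"
    if L: "1 \<le> \<omega>" and x: "x \<in> U" and R: "R \<subseteq> V" for \<omega> R \<nu> x
  proof -
    have "((\<lambda>t. osc a \<omega> R \<nu> (x(j := t))) has_vector_derivative
        (\<Sum>y\<in>R. of_real (\<nu> y) * (cis (\<omega> * \<phi> y x) * a' (\<omega>, y) x
            + \<i> * of_real (\<omega> * d\<phi> j y x) * cis (\<omega> * \<phi> y x) * a (\<omega>, y) x))) (at (x j))"
      unfolding osc_def
    proof (intro has_vector_derivative_sum has_vector_derivative_mult_right)
      fix y assume "y \<in> R"
      then have y: "y \<in> V" using R by auto
      have 1: "((\<lambda>t. a (\<omega>, y) (x(j := t))) has_vector_derivative a' (\<omega>, y) x) (at (x j))"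
        using a'(2) L y x by auto
      show "((\<lambda>t. cis (\<omega> * \<phi> y (x(j := t))) * a (\<omega>, y) (x(j := t))) has_vector_derivative
          (cis (\<omega> * \<phi> y x) * a' (\<omega>, y) x + \<i> * of_real (\<omega> * d\<phi> j y x) * cis (\<omega> * \<phi> y x) * a (\<omega>, y) x)) (at (x j))"
        using has_vector_derivative_mult[OF has_vector_derivative_cis_phase[OF phase_deriv[OF y x, of j]] 1]
        by (simp only: fun_upd_triv)
    qed
    moreover have "(\<Sum>y\<in>R. of_real (\<nu> y) * (cis (\<omega> * \<phi> y x) * a' (\<omega>, y) x
            + \<i> * of_real (\<omega> * d\<phi> j y x) * cis (\<omega> * \<phi> y x) * a (\<omega>, y) x)) = of_real \<omega> * osc b \<omega> R \<nu> x"
      unfolding osc_def sum_distrib_left b_def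
      by (intro sum.cong refl) (use L in \<open>simp add: field_simps\<close>)
    ultimately show ?thesis by simp
  qed
  then show ?thesis using b by blast
qed

definition freeze :: "'m set \<Rightarrow> ('m \<Rightarrow> real) \<Rightarrow> ('m \<Rightarrow> real) \<Rightarrow> 'm \<Rightarrow> real" where
  "freeze J p x l = (if l \<in> J then x l else p l)"

text \<open>The Sobolev integrand once the coordinates in \<open>J\<close> have been treated: these
  run over a box of side \<open>1 / \<omega>\<close> with corner p, the others stay at p. The factor
  \<open>\<omega> / (\<rho>\<^sup>2) ^ N\<close> per coordinate normalises the box and undoes the
  weight.\<close>

definition tent where
  "tent b \<omega> R \<nu> J p x = ennreal ((\<omega> / (\<rho>\<^sup>2) ^ N) ^ card J * (\<Prod>j\<in>J. indicator {p j..p j + 1 / \<omega>} (x j)) *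
      (norm (zero_ext (osc b \<omega> R \<nu>) (freeze J p x)))\<^sup>2)"

lemma tent_measurable:
  assumes "symb k P U b" "1 \<le> \<omega>" "R \<subseteq> V"
  shows "tent b \<omega> R \<nu> J p \<in> borel_measurable (Pi\<^sub>M J M)"
proof -
  have m: "freeze J p \<in> measurable (Pi\<^sub>M J M) borel"
  proof -
    have "freeze J p \<in> measurable (Pi\<^sub>M J M) (Pi\<^sub>M UNIV M)"
    proof (rule measurable_PiM_single')
      show "(\<lambda>x. freeze J p x i) \<in> measurable (Pi\<^sub>M J M) (M i)" for i
        by (cases "i \<in> J") (auto simp: freeze_def)
    qed (auto simp: freeze_def)
    then show ?thesis using measurable_cong_sets[OF refl sets_PiM_M] by blast
  qed
  have 1: "(\<lambda>x. zero_ext (osc b \<omega> R \<nu>) (freeze J p x)) \<in> borel_measurable (Pi\<^sub>M J M)"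
    by (rule measurable_compose[OF m zero_ext_measurable[OF osc_continuous[OF assms]]])
  have 2: "(\<lambda>x. indicator {p j..p j + 1 / \<omega>} (x j) :: real) \<in> borel_measurable (Pi\<^sub>M J M)" if "j \<in> J" for j
    using that by measurable
  show ?thesis unfolding tent_def using 1 2 by measurable
qed

lemma tent_upd:
  assumes "i \<notin> J" "1 \<le> \<omega>"
  shows "ennreal (\<omega> / (\<rho>\<^sup>2) ^ N * indicator {p i..p i + 1 / \<omega>} y) * tent b \<omega> R \<nu> J (p(i := y)) x
    = tent b \<omega> R \<nu> (insert i J) p (x(i := y))"
proof -
  have "finite J" by simp
  have f: "freeze (insert i J) p (x(i := y)) = freeze J (p(i := y)) x"
    using assms(1) by (auto simp: freeze_def fun_eq_iff)
  have pr: "(\<Prod>j\<in>insert i J. indicator {p j..p j + 1 / \<omega>} ((x(i := y)) j) :: real) =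
     indicator {p i..p i + 1 / \<omega>} y * (\<Prod>j\<in>J. indicator {(p(i := y)) j..(p(i := y)) j + 1 / \<omega>} (x j))"
    using assms(1) by (auto simp: prod.insert[OF \<open>finite J\<close> assms(1)] intro!: prod.cong)
  show ?thesis unfolding tent_def f pr using assms \<rho>_pos
    by (simp add: ennreal_mult'[symmetric] mult_ac prod_nonneg card_insert_disjoint)
qed

lemma freeze_empty [simp]: "freeze {} p x = p"
  by (auto simp: freeze_def fun_eq_iff)

text \<open>The one-dimensional inequality with \<open>l = 1 / \<omega>\<close>, one coordinate at a
  time; each costs one derivative of the amplitude. A treated coordinate moves away from p, so
  closeness within \<open>\<rho>\<close> is demanded only for coordinates still to be treated, and
  \<open>2 * \<rho>\<close> for all.\<close>

lemma sobolev_iterated: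
  "symb (k + card J) P U a \<Longrightarrow> \<exists>bs. (\<forall>b\<in>set bs. symb k P U b) \<and>
     (\<forall>\<omega> R \<nu> p. 1 \<le> \<omega> \<longrightarrow> 2 / \<rho> \<le> \<omega> \<longrightarrow> R \<subseteq> V \<longrightarrow> (\<forall>j\<in>J. \<bar>p j - c j\<bar> \<le> \<rho>) \<longrightarrow> (\<forall>j. \<bar>p j - c j\<bar> \<le> 2 * \<rho>) \<longrightarrow>
       ennreal ((norm (osc a \<omega> R \<nu> p))\<^sup>2) \<le> (\<Sum>b\<leftarrow>bs. \<integral>\<^sup>+x. tent b \<omega> R \<nu> J p x \<partial>Pi\<^sub>M J M))"
proof -
  have "finite J" by simp
  then show "symb (k + card J) P U a \<Longrightarrow> ?thesis"
  proof (induction J arbitrary: a rule: finite_induct)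
    case empty
    have "(\<Sum>b\<leftarrow>[a]. \<integral>\<^sup>+x. tent b \<omega> R \<nu> {} p x \<partial>Pi\<^sub>M {} M) = ennreal ((norm (osc a \<omega> R \<nu> p))\<^sup>2)"
      if "\<forall>j. \<bar>p j - c j\<bar> \<le> 2 * \<rho>" for \<omega> R \<nu> p
    proof -
      have "\<bar>p j - c j\<bar> < 3 * \<rho>" for j using that[rule_format, of j] \<rho>_pos by linarith
      then have "p \<in> U" by (simp add: U_def)
      then show ?thesis
        by (simp add: tent_def zero_ext_def PiM_empty)
    qed
    then show ?case using empty by (intro exI[of _ "[a]"]) auto
  next
    case (insert i J)
    have a: "symb (Suc (k + card J)) P U a" using insert by simp
    obtain b where b: "symb (k + card J) P U b" and Db: "\<And>\<omega> R \<nu> x. 1 \<le> \<omega> \<Longrightarrow> x \<in> U \<Longrightarrow> R \<subseteq> V \<Longrightarrow>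
     ((\<lambda>t. osc a \<omega> R \<nu> (x(i := t))) has_vector_derivative of_real \<omega> * osc b \<omega> R \<nu> x) (at (x i))"
      using osc_derivative[OF a, of i] by blast
    obtain as where as: "\<forall>b\<in>set as. symb k P U b" and
      IHa: "\<And>\<omega> R \<nu> p. 1 \<le> \<omega> \<Longrightarrow> 2 / \<rho> \<le> \<omega> \<Longrightarrow> R \<subseteq> V \<Longrightarrow> \<forall>j\<in>J. \<bar>p j - c j\<bar> \<le> \<rho> \<Longrightarrow> \<forall>j. \<bar>p j - c j\<bar> \<le> 2 * \<rho> \<Longrightarrow>
       ennreal ((norm (osc a \<omega> R \<nu> p))\<^sup>2) \<le> (\<Sum>b\<leftarrow>as. \<integral>\<^sup>+x. tent b \<omega> R \<nu> J p x \<partial>Pi\<^sub>M J M)"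
      using insert.IH[OF symb_Suc_imp[OF a]] by blast
    obtain bs where bs: "\<forall>b\<in>set bs. symb k P U b" and
      IHb: "\<And>\<omega> R \<nu> p. 1 \<le> \<omega> \<Longrightarrow> 2 / \<rho> \<le> \<omega> \<Longrightarrow> R \<subseteq> V \<Longrightarrow> \<forall>j\<in>J. \<bar>p j - c j\<bar> \<le> \<rho> \<Longrightarrow> \<forall>j. \<bar>p j - c j\<bar> \<le> 2 * \<rho> \<Longrightarrow>
       ennreal ((norm (osc b \<omega> R \<nu> p))\<^sup>2) \<le> (\<Sum>b\<leftarrow>bs. \<integral>\<^sup>+x. tent b \<omega> R \<nu> J p x \<partial>Pi\<^sub>M J M)"
      using insert.IH[OF b] by blast
    \<comment> \<open>With \<open>l = 1 / \<omega>\<close> the integrand is \<omega> times (2 |osc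
      a|^2 + |osc b|^2); the coefficient 2 is encoded by listing the amplitudes for \<open>a\<close>
      twice.\<close>
    let ?L = "as @ as @ bs"
    have L: "\<forall>b\<in>set ?L. symb k P U b" using as bs by auto
    have "ennreal ((norm (osc a \<omega> R \<nu> p))\<^sup>2) \<le> (\<Sum>b\<leftarrow>?L. \<integral>\<^sup>+x. tent b \<omega> R \<nu> (insert i J) p x \<partial>Pi\<^sub>M (insert i J) M)"
      if l1: "1 \<le> \<omega>" and l2: "2 / \<rho> \<le> \<omega>" and R: "R \<subseteq> V" and p1: "\<forall>j\<in>insert i J. \<bar>p j - c j\<bar> \<le> \<rho>"
        and p2: "\<forall>j. \<bar>p j - c j\<bar> \<le> 2 * \<rho>" for \<omega> R \<nu> p
    proof -
      let ?K = "\<omega> / (\<rho>\<^sup>2) ^ N" and ?ind = "\<lambda>y. indicator {p i..p i + 1 / \<omega>} y :: real"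
      have il: "1 / \<omega> \<le> \<rho> / 2" "0 < 1 / \<omega>" using l1 l2 \<rho>_pos by (auto simp: field_simps)
      have "\<bar>p j - c j\<bar> < 3 * \<rho>" for j using p2[rule_format, of j] \<rho>_pos by linarith
      then have pU: "p \<in> U" by (simp add: U_def)
      have pi: "\<bar>p i - c i\<bar> \<le> \<rho>" using p1 by simp
      have "ennreal ((norm (osc a \<omega> R \<nu> p))\<^sup>2) \<le> (\<integral>\<^sup>+ y. ennreal (?ind y *
          (2 / (1 / \<omega>) * (norm (zero_ext (osc a \<omega> R \<nu>) (p(i := y))))\<^sup>2 +
           (1 / \<omega>) * (norm (zero_ext (\<lambda>x. of_real \<omega> * osc b \<omega> R \<nu> x) (p(i := y))))\<^sup>2) / (\<rho>\<^sup>2) ^ N) \<partial>M i)"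
        by (rule sobolev_1d[OF osc_continuous[OF a l1 R] Db[OF l1 _ R] _ pU pi il(2,1)])
           (auto intro!: continuous_intros osc_continuous[OF b l1 R])
      also have "\<dots> \<le> (\<integral>\<^sup>+ y. (\<Sum>b\<leftarrow>?L. \<integral>\<^sup>+x. tent b \<omega> R \<nu> (insert i J) p (x(i := y)) \<partial>Pi\<^sub>M J M) \<partial>M i)"
      proof (rule nn_integral_mono)
        fix y
        have KT: "(\<Sum>b\<leftarrow>?L. \<integral>\<^sup>+x. tent b \<omega> R \<nu> (insert i J) p (x(i := y)) \<partial>Pi\<^sub>M J M) =
            ennreal (?K * ?ind y) * (\<Sum>b\<leftarrow>?L. \<integral>\<^sup>+x. tent b \<omega> R \<nu> J (p(i := y)) x \<partial>Pi\<^sub>M J M)"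
        proof -
          have "(\<integral>\<^sup>+x. tent b \<omega> R \<nu> (insert i J) p (x(i := y)) \<partial>Pi\<^sub>M J M) =
            ennreal (?K * ?ind y) * (\<integral>\<^sup>+x. tent b \<omega> R \<nu> J (p(i := y)) x \<partial>Pi\<^sub>M J M)" if "b \<in> set ?L" for b
          proof -
            have "symb k P U b" using L that by blast
            from nn_integral_cmult[OF tent_measurable[OF this l1 R]] show ?thesis
              by (simp only: tent_upd[OF insert.hyps(2) l1, symmetric])
          qed
          then show ?thesis unfolding sum_list_const_mult[symmetric]
            by (intro arg_cong[where f = sum_list] map_cong refl)
        qed
        show "ennreal (?ind y *
          (2 / (1 / \<omega>) * (norm (zero_ext (osc a \<omega> R \<nu>) (p(i := y))))\<^sup>2 +
           (1 / \<omega>) * (norm (zero_ext (\<lambda>x. of_real \<omega> * osc b \<omega> R \<nu> x) (p(i := y))))\<^sup>2) / (\<rho>\<^sup>2) ^ N)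
           \<le> (\<Sum>b\<leftarrow>?L. \<integral>\<^sup>+x. tent b \<omega> R \<nu> (insert i J) p (x(i := y)) \<partial>Pi\<^sub>M J M)"
        proof (cases "y \<in> {p i..p i + 1 / \<omega>}")
          case True
          let ?q = "p(i := y)"
          have yi: "\<bar>y - c i\<bar> \<le> 2 * \<rho>" using True pi il \<rho>_pos unfolding atLeastAtMost_iff abs_le_iff by linarith
          have qU: "?q \<in> U" using upd_in_U[OF pU, of y i] yi by (auto simp: side_def abs_le_iff)
          have q1: "\<forall>j\<in>J. \<bar>?q j - c j\<bar> \<le> \<rho>" and q2: "\<forall>j. \<bar>?q j - c j\<bar> \<le> 2 * \<rho>"
            using p1 p2 yi insert.hyps(2) by auto
          have A: "(norm (zero_ext (osc a \<omega> R \<nu>) ?q))\<^sup>2 = (norm (osc a \<omega> R \<nu> ?q))\<^sup>2"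
            and B: "(norm (zero_ext (\<lambda>x. of_real \<omega> * osc b \<omega> R \<nu> x) ?q))\<^sup>2 = \<omega>\<^sup>2 * (norm (osc b \<omega> R \<nu> ?q))\<^sup>2"
            using qU l1 by (auto simp: zero_ext_def norm_mult power_mult_distrib simp del: fun_upd_apply)
          have "?ind y * (2 / (1 / \<omega>) * (norm (osc a \<omega> R \<nu> ?q))\<^sup>2 +
             (1 / \<omega>) * (\<omega>\<^sup>2 * (norm (osc b \<omega> R \<nu> ?q))\<^sup>2)) / (\<rho>\<^sup>2) ^ N =
             (?K * ?ind y) * ((norm (osc a \<omega> R \<nu> ?q))\<^sup>2 + ((norm (osc a \<omega> R \<nu> ?q))\<^sup>2 + (norm (osc b \<omega> R \<nu> ?q))\<^sup>2))"
            using l1 \<rho>_pos by (simp add: field_simps power2_eq_square)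
          then have "ennreal (?ind y * (2 / (1 / \<omega>) * (norm (osc a \<omega> R \<nu> ?q))\<^sup>2 +
             (1 / \<omega>) * (\<omega>\<^sup>2 * (norm (osc b \<omega> R \<nu> ?q))\<^sup>2)) / (\<rho>\<^sup>2) ^ N) = ennreal ((?K * ?ind y) *
              ((norm (osc a \<omega> R \<nu> ?q))\<^sup>2 + ((norm (osc a \<omega> R \<nu> ?q))\<^sup>2 + (norm (osc b \<omega> R \<nu> ?q))\<^sup>2)))"
            by (rule arg_cong)
          also have "\<dots> = ennreal (?K * ?ind y) * (ennreal ((norm (osc a \<omega> R \<nu> ?q))\<^sup>2) +
               (ennreal ((norm (osc a \<omega> R \<nu> ?q))\<^sup>2) + ennreal ((norm (osc b \<omega> R \<nu> ?q))\<^sup>2)))"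
          proof -
            have k0: "0 \<le> ?K * ?ind y" using l1 by (simp add: indicator_def)
            show ?thesis
              by (subst ennreal_mult'[OF k0]) (simp only: ennreal_plus zero_le_power2 add_nonneg_nonneg)
          qed
          also have "\<dots> \<le> ennreal (?K * ?ind y) * (\<Sum>b\<leftarrow>?L. \<integral>\<^sup>+x. tent b \<omega> R \<nu> J ?q x \<partial>Pi\<^sub>M J M)"
            unfolding map_append sum_list_append
            by (intro mult_left_mono add_mono IHa[OF l1 l2 R q1 q2] IHb[OF l1 l2 R q1 q2]) auto
          finally show ?thesis unfolding KT A B .
        qed simp
      qed
      also have "\<dots> = (\<Sum>b\<leftarrow>?L. \<integral>\<^sup>+ y. \<integral>\<^sup>+x. tent b \<omega> R \<nu> (insert i J) p (x(i := y)) \<partial>Pi\<^sub>M J M \<partial>M i)"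
      proof (rule nn_integral_sum_list)
        fix b assume "b \<in> set ?L"
        then have b: "symb k P U b" using L by auto
        have "(\<lambda>(x, y). x(i := y)) \<in> measurable (Pi\<^sub>M J M \<Otimes>\<^sub>M M i) (Pi\<^sub>M (insert i J) M)"
          by (rule measurable_add_dim)
        then have "(\<lambda>(y, x). x(i := y)) \<in> measurable (M i \<Otimes>\<^sub>M Pi\<^sub>M J M) (Pi\<^sub>M (insert i J) M)"
          by (subst measurable_pair_swap_iff) (simp add: case_prod_beta')
        from measurable_compose[OF this tent_measurable[OF b l1 R]]
        have "(\<lambda>(y, x). tent b \<omega> R \<nu> (insert i J) p (x(i := y))) \<in> borel_measurable (M i \<Otimes>\<^sub>M Pi\<^sub>M J M)"
          by (simp add: case_prod_beta')
        then show "(\<lambda>y. \<integral>\<^sup>+x. tent b \<omega> R \<nu> (insert i J) p (x(i := y)) \<partial>Pi\<^sub>M J M) \<in> borel_measurable (M i)"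
          by (rule sigma_finite_measure.borel_measurable_nn_integral[OF finite_measure.axioms(1)[OF finite_measure_PiM]])
      qed
      also have "\<dots> = (\<Sum>b\<leftarrow>?L. \<integral>\<^sup>+x. tent b \<omega> R \<nu> (insert i J) p x \<partial>Pi\<^sub>M (insert i J) M)"
      proof (rule arg_cong[where f = sum_list], rule map_cong[OF refl])
        fix b assume "b \<in> set ?L"
        then have "symb k P U b" using L by auto
        from product_nn_integral_insert_rev[OF insert.hyps(1,2) tent_measurable[OF this l1 R]]
        show "(\<integral>\<^sup>+ y. \<integral>\<^sup>+x. tent b \<omega> R \<nu> (insert i J) p (x(i := y)) \<partial>Pi\<^sub>M J M \<partial>M i) =
            (\<integral>\<^sup>+x. tent b \<omega> R \<nu> (insert i J) p x \<partial>Pi\<^sub>M (insert i J) M)" by simp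
      qed
      finally show ?thesis .
    qed
    with L show ?case by blast
  qed
qed

end

section \<open>Almost orthogonality\<close>

context phase_box
begin

text \<open>The direction j may vary with the pair but not with x, since integration by parts runs
  along entire lines of the box. Pairs closer than \<open>K / \<omega>\<close> are exempt: for them
  the trivial bound is good enough.\<close>

definition separated_phases :: "real \<Rightarrow> real \<Rightarrow> real \<Rightarrow> 'y set \<Rightarrow> bool" where
  "separated_phases c0 K \<omega> R \<longleftrightarrow> (\<forall>y\<in>R. \<forall>y'\<in>R. K \<le> \<omega> * dist y y' \<longrightarrow>
     (\<exists>j. \<forall>x\<in>U. c0 * dist y y' \<le> \<bar>d\<phi> j y x - d\<phi> j y' x\<bar>))"

text \<open>The almost-orthogonality kernel: 1 for pairs within \<open>1 / \<omega>\<close>,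
  diagonal included, and \<open>(\<omega> * dist y y') powr (- N)\<close> in size beyond.\<close>

definition near_sum :: "real \<Rightarrow> 'y set \<Rightarrow> ('y \<Rightarrow> real) \<Rightarrow> real" where
  "near_sum \<omega> R \<nu> = (\<Sum>y\<in>R. \<Sum>y'\<in>R. \<nu> y * \<nu> y' / (\<omega> * max (dist y y') (1 / \<omega>)) ^ N)"

abbreviation pair_term where
  "pair_term b \<omega> y y' x \<equiv> cis (\<omega> * (\<phi> y x - \<phi> y' x)) * (b (\<omega>, y) x * cnj (b (\<omega>, y') x))"

lemma pair_term_integrable:
  assumes "symb N P U b" "1 \<le> \<omega>" "y \<in> V" "y' \<in> V"
  shows "integrable (Pi\<^sub>M UNIV M) (zero_ext (pair_term b \<omega> y y'))"
proof -
  obtain B where B: "B > 0" "\<forall>i\<in>P. \<forall>x\<in>U. norm (b i x) \<le> B" using symb_bounded[OF assms(1)] by auto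
  show ?thesis
  proof (rule zero_ext_integrable[where B = "B * B"])
    show "continuous_on U (pair_term b \<omega> y y')"
      unfolding cis_conv_exp
      by (intro continuous_intros phase_cont symb_cont[OF assms(1)]) (use assms in auto)
    show "norm (pair_term b \<omega> y y' x) \<le> B * B" if "x \<in> U" for x
      using B that assms by (auto simp: norm_mult intro!: mult_mono)
  qed
qed

text \<open>For distinct points the phase difference is written as
  \<open>\<omega> * dist y y'\<close> times a normalised phase, whose j-th derivative is at least
  \<open>c0\<close> in absolute value. Nonstationary phase then gains \<open>N\<close> powers of the
  parameter.\<close>

lemma pair_term_bound:
  assumes b: "symb N P U b" and c0: "c0 > 0"
  shows "\<exists>D>0. \<forall>\<omega>\<ge>1. \<forall>y\<in>V. \<forall>y'\<in>V.
     norm (\<integral>x. zero_ext (pair_term b \<omega> y y') x \<partial>Pi\<^sub>M UNIV M) \<le> D \<and>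
     (y \<noteq> y' \<and> (\<exists>j. \<forall>x\<in>U. c0 * dist y y' \<le> \<bar>d\<phi> j y x - d\<phi> j y' x\<bar>) \<longrightarrow>
      norm (\<integral>x. zero_ext (pair_term b \<omega> y y') x \<partial>Pi\<^sub>M UNIV M) \<le> D / (\<omega> * dist y y') ^ N)"
proof -
  \<comment> \<open>One family of parameters per direction j, as the direction of the lower bound
    depends on the pair. There are finitely many directions, so their constants can be
    added.\<close>
  define I where "I j = {i \<in> {1::real..} \<times> {z \<in> V \<times> V. fst z \<noteq> snd z}.
      \<forall>x\<in>U. c0 * dist (fst (snd i)) (snd (snd i)) \<le> \<bar>d\<phi> j (fst (snd i)) x - d\<phi> j (snd (snd i)) x\<bar>}"
    for j
  define \<psi> where "\<psi> i x = (\<phi> (fst (snd i)) x - \<phi> (snd (snd i)) x) / dist (fst (snd i)) (snd (snd i))"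
    for i :: "real \<times> 'y \<times> 'y" and x
  define d where "d j i x = (d\<phi> j (fst (snd i)) x - d\<phi> j (snd (snd i)) x) / dist (fst (snd i)) (snd (snd i))"
    for j and i :: "real \<times> 'y \<times> 'y" and x
  define a where "a i x = b (fst i, fst (snd i)) x * cnj (b (fst i, snd (snd i)) x)"
    for i :: "real \<times> 'y \<times> 'y" and x
  have "\<exists>D>0. \<forall>i\<in>I j. \<forall>\<Lambda>>0.
     norm (\<integral>x. zero_ext (\<lambda>x. cis (\<Lambda> * \<psi> i x) * a i x) x \<partial>Pi\<^sub>M UNIV M) \<le> D / \<Lambda> ^ N" for j
  proof (rule oscillatory_integral_bound[where d = "d j" and ?c0.0 = c0 and j = j])
    show "((\<lambda>t. \<psi> i (x(j := t))) has_real_derivative d j i x) (at (x j))" if "i \<in> I j" "x \<in> U" for i x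
      unfolding \<psi>_def d_def using that
      by (intro DERIV_cdivide DERIV_diff phase_deriv) (auto simp: I_def)
    show "continuous_on U (\<psi> i)" if "i \<in> I j" for i
      unfolding \<psi>_def using that by (intro continuous_intros phase_cont) (auto simp: I_def)
    show "symb N (I j) U (\<lambda>i x. complex_of_real (d j i x))"
      unfolding d_def by (rule symb_reindex[OF phase_quot_symb]) (auto simp: I_def)
    show "c0 \<le> \<bar>d j i x\<bar>" if "i \<in> I j" "x \<in> U" for i x
    proof -
      have "dist (fst (snd i)) (snd (snd i)) > 0" using that by (auto simp: I_def)
      then show ?thesis using that by (auto simp: I_def d_def pos_le_divide_eq)
    qed
    have "symb N (I j) U (\<lambda>i x. b (fst i, fst (snd i)) x)"
      by (rule symb_reindex[OF b]) (auto simp: I_def)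
    moreover have "symb N (I j) U (\<lambda>i x. b (fst i, snd (snd i)) x)"
      by (rule symb_reindex[OF b]) (auto simp: I_def)
    ultimately show "symb N (I j) U a"
      unfolding a_def by (intro symb_mult symb_cnj)
  qed (rule c0)
  then obtain D where D: "\<And>j. D j > 0" "\<And>j i \<Lambda>. i \<in> I j \<Longrightarrow> \<Lambda> > 0 \<Longrightarrow>
     norm (\<integral>x. zero_ext (\<lambda>x. cis (\<Lambda> * \<psi> i x) * a i x) x \<partial>Pi\<^sub>M UNIV M) \<le> D j / \<Lambda> ^ N"
    by metis
  obtain B where B: "B > 0" "\<forall>i\<in>P. \<forall>x\<in>U. norm (b i x) \<le> B" using symb_bounded[OF b] by auto
  define m where "m = measure (Pi\<^sub>M UNIV M) (space (Pi\<^sub>M UNIV M))"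
  define D0 where "D0 = (\<Sum>j\<in>UNIV. D j) + B * B * m"
  have Dj: "D j \<le> D0" for j
  proof -
    have "D j \<le> (\<Sum>j\<in>UNIV. D j)" using D(1) by (intro member_le_sum) (auto intro: less_imp_le)
    moreover have "0 \<le> B * B * m" using B(1) by (simp add: m_def)
    ultimately show ?thesis unfolding D0_def by linarith
  qed
  have "D0 > 0" using D(1) Dj by (meson less_le_trans)
  moreover have "norm (\<integral>x. zero_ext (pair_term b \<omega> y y') x \<partial>Pi\<^sub>M UNIV M) \<le> D0"
    if "1 \<le> \<omega>" "y \<in> V" "y' \<in> V" for \<omega> y y'
  proof -
    have "norm (\<integral>x. zero_ext (pair_term b \<omega> y y') x \<partial>Pi\<^sub>M UNIV M) \<le>
        (\<integral>x. norm (zero_ext (pair_term b \<omega> y y') x) \<partial>Pi\<^sub>M UNIV M)" by (rule integral_norm_bound)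
    also have "\<dots> \<le> (\<integral>x. B * B \<partial>Pi\<^sub>M UNIV M)"
    proof (rule Bochner_Integration.integral_mono')
      show "integrable (Pi\<^sub>M UNIV M) (\<lambda>x. B * B)"
        by (rule finite_measure.integrable_const[OF finite_measure_PiM])
      show "norm (zero_ext (pair_term b \<omega> y y') x) \<le> B * B" for x
        using B that by (auto simp: zero_ext_def norm_mult intro!: mult_mono)
    qed (use B in simp)
    also have "\<dots> = B * B * m" by (simp add: m_def)
    also have "\<dots> \<le> D0" using D(1) by (simp add: D0_def sum_nonneg less_imp_le)
    finally show ?thesis .
  qed
  moreover have "norm (\<integral>x. zero_ext (pair_term b \<omega> y y') x \<partial>Pi\<^sub>M UNIV M) \<le> D0 / (\<omega> * dist y y') ^ N"
    if w: "1 \<le> \<omega>" and y: "y \<in> V" "y' \<in> V" "y \<noteq> y'"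
      and j: "\<forall>x\<in>U. c0 * dist y y' \<le> \<bar>d\<phi> j y x - d\<phi> j y' x\<bar>" for \<omega> y y' j
  proof -
    have i: "(\<omega>, y, y') \<in> I j" using w y j by (simp add: I_def)
    have L: "\<omega> * dist y y' > 0" using w y by simp
    have "(\<lambda>x. cis (\<omega> * dist y y' * \<psi> (\<omega>, y, y') x) * a (\<omega>, y, y') x) = pair_term b \<omega> y y'"
      using y by (simp add: \<psi>_def a_def)
    with D(2)[OF i L]
    have "norm (\<integral>x. zero_ext (pair_term b \<omega> y y') x \<partial>Pi\<^sub>M UNIV M) \<le> D j / (\<omega> * dist y y') ^ N"
      by simp
    also have "\<dots> \<le> D0 / (\<omega> * dist y y') ^ N"
      using Dj L by (intro divide_right_mono) auto
    finally show ?thesis .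
  qed
  ultimately show ?thesis by blast
qed

text \<open>Expanding the square gives a double sum of pair integrals: far pairs decay by
  \<open>pair_term_bound\<close>, near pairs are bounded trivially, and the factor
  \<open>K ^ N\<close> makes the kernel of \<open>near_sum\<close> dominate both.\<close>

lemma osc_L2_bound:
  assumes b: "symb N P U b" and c0: "c0 > 0" and K: "K \<ge> 1"
  shows "\<exists>D>0. \<forall>\<omega>\<ge>1. \<forall>R \<nu>. finite R \<longrightarrow> R \<subseteq> V \<longrightarrow> (\<forall>y\<in>R. 0 \<le> \<nu> y) \<longrightarrow> separated_phases c0 K \<omega> R \<longrightarrow>
     (\<integral>\<^sup>+x. ennreal ((norm (zero_ext (osc b \<omega> R \<nu>) x))\<^sup>2) \<partial>Pi\<^sub>M UNIV M) \<le> ennreal (D * near_sum \<omega> R \<nu>)"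
proof -
  obtain D where D: "D > 0" "\<And>\<omega> y y'. 1 \<le> \<omega> \<Longrightarrow> y \<in> V \<Longrightarrow> y' \<in> V \<Longrightarrow>
     norm (\<integral>x. zero_ext (pair_term b \<omega> y y') x \<partial>Pi\<^sub>M UNIV M) \<le> D"
     "\<And>\<omega> y y' j. 1 \<le> \<omega> \<Longrightarrow> y \<in> V \<Longrightarrow> y' \<in> V \<Longrightarrow> y \<noteq> y' \<Longrightarrow>
        \<forall>x\<in>U. c0 * dist y y' \<le> \<bar>d\<phi> j y x - d\<phi> j y' x\<bar> \<Longrightarrow>
      norm (\<integral>x. zero_ext (pair_term b \<omega> y y') x \<partial>Pi\<^sub>M UNIV M) \<le> D / (\<omega> * dist y y') ^ N"
    using pair_term_bound[OF b c0] by blast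
  have "(\<integral>\<^sup>+x. ennreal ((norm (zero_ext (osc b \<omega> R \<nu>) x))\<^sup>2) \<partial>Pi\<^sub>M UNIV M) \<le> ennreal (D * K ^ N * near_sum \<omega> R \<nu>)"
    if w: "1 \<le> \<omega>" and R: "finite R" "R \<subseteq> V" and nu: "\<forall>y\<in>R. 0 \<le> \<nu> y" and sep: "separated_phases c0 K \<omega> R" for \<omega> R \<nu>
  proof -
    let ?I = "\<lambda>y y'. \<integral>x. zero_ext (pair_term b \<omega> y y') x \<partial>Pi\<^sub>M UNIV M"
    have pair: "norm (?I y y') \<le> D * K ^ N / (\<omega> * max (dist y y') (1 / \<omega>)) ^ N"
      if y: "y \<in> R" "y' \<in> R" for y y'
    proof (cases "K \<le> \<omega> * dist y y'")
      case True
      then have ge: "1 \<le> \<omega> * dist y y'" using K by simp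
      then have "y \<noteq> y'" by auto
      moreover obtain j where "\<forall>x\<in>U. c0 * dist y y' \<le> \<bar>d\<phi> j y x - d\<phi> j y' x\<bar>"
        using sep True y unfolding separated_phases_def by blast
      ultimately have "norm (?I y y') \<le> D / (\<omega> * dist y y') ^ N"
        using D(3) w y R by blast
      also have "max (dist y y') (1 / \<omega>) = dist y y'" using ge w by (simp add: max_def field_simps)
      then have "D / (\<omega> * dist y y') ^ N = D * 1 / (\<omega> * max (dist y y') (1 / \<omega>)) ^ N" by simp
      also have "\<dots> \<le> D * K ^ N / (\<omega> * max (dist y y') (1 / \<omega>)) ^ N"
        using D(1) K w by (intro divide_right_mono mult_left_mono) (auto simp: le_max_iff_disj)
      finally show ?thesis .
    next
      case False
      \<comment> \<open>For a near pair the denominator of the kernel is at most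
        \<open>K ^ N\<close>, so the trivial bound \<open>D\<close> is already of the required
        form.\<close>
      have le: "\<omega> * max (dist y y') (1 / \<omega>) \<le> K" using False K w by (auto simp: max_def)
      have ge: "1 \<le> \<omega> * max (dist y y') (1 / \<omega>)" using w by (simp add: max_def field_simps)
      have "norm (?I y y') \<le> D" using D(2) w y R by blast
      also have "D \<le> D * K ^ N / (\<omega> * max (dist y y') (1 / \<omega>)) ^ N"
      proof -
        have "(\<omega> * max (dist y y') (1 / \<omega>)) ^ N \<le> K ^ N" using le ge by (intro power_mono) auto
        moreover have "0 < (\<omega> * max (dist y y') (1 / \<omega>)) ^ N" using ge by simp
        ultimately show ?thesis using D(1) by (simp add: pos_le_divide_eq)
      qed
      finally show ?thesis .
    qed
    have eq: "complex_of_real ((norm (zero_ext (osc b \<omega> R \<nu>) x))\<^sup>2) =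
        (\<Sum>y\<in>R. \<Sum>y'\<in>R. of_real (\<nu> y * \<nu> y') * zero_ext (pair_term b \<omega> y y') x)" for x
    proof (cases "x \<in> U")
      case True
      have "complex_of_real ((norm (osc b \<omega> R \<nu> x))\<^sup>2) = osc b \<omega> R \<nu> x * cnj (osc b \<omega> R \<nu> x)"
        by (rule complex_norm_square)
      also have "\<dots> = (\<Sum>y\<in>R. \<Sum>y'\<in>R. of_real (\<nu> y * \<nu> y') * pair_term b \<omega> y y' x)"
        unfolding osc_def cnj_sum sum_product
      proof (intro sum.cong refl)
        fix y y'
        have "cis (\<omega> * (\<phi> y x - \<phi> y' x)) = cis (\<omega> * \<phi> y x) * cnj (cis (\<omega> * \<phi> y' x))"
          by (simp add: cis_cnj cis_mult algebra_simps)
        then show "complex_of_real (\<nu> y) * (cis (\<omega> * \<phi> y x) * b (\<omega>, y) x) *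
            cnj (complex_of_real (\<nu> y') * (cis (\<omega> * \<phi> y' x) * b (\<omega>, y') x)) =
            of_real (\<nu> y * \<nu> y') * pair_term b \<omega> y y' x"
          by (simp add: mult_ac)
      qed
      finally show ?thesis using True by (simp add: zero_ext_def)
    qed (simp add: zero_ext_def)
    have int1: "integrable (Pi\<^sub>M UNIV M) (\<lambda>x. of_real (\<nu> y * \<nu> y') * zero_ext (pair_term b \<omega> y y') x)"
      if "y \<in> R" "y' \<in> R" for y y'
      using that R by (intro integrable_mult_right pair_term_integrable b w) auto
    have intC: "integrable (Pi\<^sub>M UNIV M) (\<lambda>x. complex_of_real ((norm (zero_ext (osc b \<omega> R \<nu>) x))\<^sup>2))"
      unfolding eq by (intro Bochner_Integration.integrable_sum int1)
    then have intR: "integrable (Pi\<^sub>M UNIV M) (\<lambda>x. (norm (zero_ext (osc b \<omega> R \<nu>) x))\<^sup>2)"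
      by (simp only: complex_of_real_integrable_eq)
    have nn: "(\<integral>\<^sup>+x. ennreal ((norm (zero_ext (osc b \<omega> R \<nu>) x))\<^sup>2) \<partial>Pi\<^sub>M UNIV M) =
        ennreal (\<integral>x. (norm (zero_ext (osc b \<omega> R \<nu>) x))\<^sup>2 \<partial>Pi\<^sub>M UNIV M)"
      by (rule nn_integral_eq_integral[OF intR]) simp
    have "(\<integral>x. (norm (zero_ext (osc b \<omega> R \<nu>) x))\<^sup>2 \<partial>Pi\<^sub>M UNIV M) \<le> D * K ^ N * near_sum \<omega> R \<nu>"
    proof -
      have "(\<integral>x. (norm (zero_ext (osc b \<omega> R \<nu>) x))\<^sup>2 \<partial>Pi\<^sub>M UNIV M) \<le>
          norm (complex_of_real (\<integral>x. (norm (zero_ext (osc b \<omega> R \<nu>) x))\<^sup>2 \<partial>Pi\<^sub>M UNIV M))"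
        unfolding norm_of_real by simp
      moreover have "complex_of_real (\<integral>x. (norm (zero_ext (osc b \<omega> R \<nu>) x))\<^sup>2 \<partial>Pi\<^sub>M UNIV M) =
          (\<integral>x. (\<Sum>y\<in>R. \<Sum>y'\<in>R. of_real (\<nu> y * \<nu> y') * zero_ext (pair_term b \<omega> y y') x) \<partial>Pi\<^sub>M UNIV M)"
        unfolding integral_complex_of_real[symmetric] eq ..
      moreover have "\<dots> = (\<Sum>y\<in>R. \<Sum>y'\<in>R. of_real (\<nu> y * \<nu> y') * ?I y y')"
        using int1 by (simp add: Bochner_Integration.integral_sum Bochner_Integration.integrable_sum del: of_real_mult)
      ultimately have "(\<integral>x. (norm (zero_ext (osc b \<omega> R \<nu>) x))\<^sup>2 \<partial>Pi\<^sub>M UNIV M) \<le>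
          norm (\<Sum>y\<in>R. \<Sum>y'\<in>R. of_real (\<nu> y * \<nu> y') * ?I y y')" by (simp only:)
      also have "\<dots> \<le> (\<Sum>y\<in>R. \<Sum>y'\<in>R. norm (of_real (\<nu> y * \<nu> y') * ?I y y'))"
        by (rule order_trans[OF norm_sum sum_mono[OF norm_sum]])
      also have "\<dots> \<le> (\<Sum>y\<in>R. \<Sum>y'\<in>R. \<nu> y * \<nu> y' * (D * K ^ N / (\<omega> * max (dist y y') (1 / \<omega>)) ^ N))"
      proof (intro sum_mono)
        fix y y' assume y: "y \<in> R" "y' \<in> R"
        then have "0 \<le> \<nu> y * \<nu> y'" using nu by simp
        from mult_left_mono[OF pair[OF y] this]
        show "norm (of_real (\<nu> y * \<nu> y') * ?I y y') \<le> \<nu> y * \<nu> y' * (D * K ^ N / (\<omega> * max (dist y y') (1 / \<omega>)) ^ N)"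
          unfolding norm_mult[of "of_real (\<nu> y * \<nu> y')"] norm_of_real abs_of_nonneg[OF \<open>0 \<le> \<nu> y * \<nu> y'\<close>] .
      qed
      also have "\<dots> = D * K ^ N * near_sum \<omega> R \<nu>"
        unfolding near_sum_def sum_distrib_left by (intro sum.cong refl) (simp add: field_simps)
      finally show ?thesis .
    qed
    from ennreal_leI[OF this] show ?thesis unfolding nn .
  qed
  then show ?thesis using D(1) K by (intro exI[of _ "D * K ^ N"]) auto
qed

lemma freeze_UNIV [simp]: "freeze UNIV p x = x"
  by (simp add: freeze_def fun_eq_iff)

text \<open>Summing the Sobolev inequality over the point masses, the boxes overlap with total
  weight at most \<open>W\<close> at every x, so the sum is at most \<open>W\<close> times
  normalised L2 integrals. The amplitude needs \<open>CARD('m)\<close> derivatives for Sobolev and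
  \<open>N\<close> for integration by parts.\<close>

lemma weighted_osc_bound:
  assumes a: "symb (N + CARD('m)) P U a" and c0: "c0 > 0" and K: "K \<ge> 1"
  shows "\<exists>D>0. \<forall>\<omega> R \<nu> A \<mu> pt W. 1 \<le> \<omega> \<longrightarrow> 2 / \<rho> \<le> \<omega> \<longrightarrow> finite R \<longrightarrow> R \<subseteq> V \<longrightarrow> (\<forall>y\<in>R. 0 \<le> \<nu> y) \<longrightarrow>
     separated_phases c0 K \<omega> R \<longrightarrow> finite (A :: 'p set) \<longrightarrow> (\<forall>p\<in>A. 0 \<le> \<mu> p) \<longrightarrow>
     (\<forall>p\<in>A. \<forall>j. \<bar>pt p j - c j\<bar> \<le> \<rho>) \<longrightarrow>
     (\<forall>x. (\<Sum>p\<in>A. \<mu> p * (\<Prod>j\<in>UNIV. indicator {pt p j..pt p j + 1 / \<omega>} (x j))) \<le> W) \<longrightarrow>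
     (\<Sum>p\<in>A. \<mu> p * (norm (osc a \<omega> R \<nu> (pt p)))\<^sup>2) \<le> D * \<omega> ^ CARD('m) * W * near_sum \<omega> R \<nu>"
proof -
  obtain bs where bs: "\<forall>b\<in>set bs. symb N P U b" and
    sob: "\<And>\<omega> R \<nu> p. 1 \<le> \<omega> \<Longrightarrow> 2 / \<rho> \<le> \<omega> \<Longrightarrow> R \<subseteq> V \<Longrightarrow> (\<forall>j\<in>UNIV. \<bar>p j - c j\<bar> \<le> \<rho>) \<Longrightarrow> (\<forall>j. \<bar>p j - c j\<bar> \<le> 2 * \<rho>) \<Longrightarrow>
       ennreal ((norm (osc a \<omega> R \<nu> p))\<^sup>2) \<le> (\<Sum>b\<leftarrow>bs. \<integral>\<^sup>+x. tent b \<omega> R \<nu> UNIV p x \<partial>Pi\<^sub>M UNIV M)"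
    using sobolev_iterated[OF a] by blast
  obtain D where D: "\<And>b. b \<in> set bs \<Longrightarrow> D b > 0" "\<And>b \<omega> R \<nu>. b \<in> set bs \<Longrightarrow> 1 \<le> \<omega> \<Longrightarrow> finite R \<Longrightarrow> R \<subseteq> V \<Longrightarrow>
      (\<forall>y\<in>R. 0 \<le> \<nu> y) \<Longrightarrow> separated_phases c0 K \<omega> R \<Longrightarrow>
     (\<integral>\<^sup>+x. ennreal ((norm (zero_ext (osc b \<omega> R \<nu>) x))\<^sup>2) \<partial>Pi\<^sub>M UNIV M) \<le> ennreal (D b * near_sum \<omega> R \<nu>)"
    using osc_L2_bound[OF _ c0 K] bs by metis
  let ?\<kappa> = "((\<rho>\<^sup>2) ^ N) ^ CARD('m)"
  define D0 where "D0 = (\<Sum>b\<leftarrow>bs. D b) + 1"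
  have Dnn: "0 \<le> (\<Sum>b\<leftarrow>bs. D b)" using D(1) by (intro sum_list_nonneg) (auto intro: less_imp_le)
  have "(\<Sum>p\<in>A. \<mu> p * (norm (osc a \<omega> R \<nu> (pt p)))\<^sup>2) \<le> D0 / ?\<kappa> * \<omega> ^ CARD('m) * W * near_sum \<omega> R \<nu>"
    if w: "1 \<le> \<omega>" "2 / \<rho> \<le> \<omega>" and R: "finite R" "R \<subseteq> V" "\<forall>y\<in>R. 0 \<le> \<nu> y" and sep: "separated_phases c0 K \<omega> R"
      and A: "finite (A :: 'p set)" "\<forall>p\<in>A. 0 \<le> \<mu> p" "\<forall>p\<in>A. \<forall>j. \<bar>pt p j - c j\<bar> \<le> \<rho>"
      and W: "\<forall>x. (\<Sum>p\<in>A. \<mu> p * (\<Prod>j\<in>UNIV. indicator {pt p j..pt p j + 1 / \<omega>} (x j))) \<le> W" for \<omega> R \<nu> A \<mu> pt W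
  proof -
    let ?k = "(\<omega> / (\<rho>\<^sup>2) ^ N) ^ CARD('m)"
    let ?i = "\<lambda>p x. (\<Prod>j\<in>UNIV. indicator {pt p j..pt p j + 1 / \<omega>} (x j)) :: real"
    let ?n = "\<lambda>b x. (norm (zero_ext (osc b \<omega> R \<nu>) x))\<^sup>2"
    have W0: "0 \<le> W"
    proof (rule order_trans[OF _ W[rule_format, of "\<lambda>_. 0"]])
      show "0 \<le> (\<Sum>p\<in>A. \<mu> p * ?i p (\<lambda>_. 0))"
        using A(2) by (auto intro!: sum_nonneg mult_nonneg_nonneg prod_nonneg)
    qed
    have k0: "0 \<le> ?k" using w \<rho>_pos by simp
    have ns0: "0 \<le> near_sum \<omega> R \<nu>"
      unfolding near_sum_def using R w by (intro sum_nonneg divide_nonneg_nonneg mult_nonneg_nonneg zero_le_power) (auto simp: le_max_iff_disj)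
    have "ennreal (\<Sum>p\<in>A. \<mu> p * (norm (osc a \<omega> R \<nu> (pt p)))\<^sup>2) = (\<Sum>p\<in>A. ennreal (\<mu> p) * ennreal ((norm (osc a \<omega> R \<nu> (pt p)))\<^sup>2))"
      using A by (subst sum_ennreal[symmetric]) (auto intro!: sum.cong simp: ennreal_mult)
    also have "\<dots> \<le> (\<Sum>p\<in>A. ennreal (\<mu> p) * (\<Sum>b\<leftarrow>bs. \<integral>\<^sup>+x. tent b \<omega> R \<nu> UNIV (pt p) x \<partial>Pi\<^sub>M UNIV M))"
    proof (intro sum_mono mult_left_mono sob w R(2))
      show "\<forall>j. \<bar>pt p j - c j\<bar> \<le> 2 * \<rho>" if "p \<in> A" for p
      proof
        fix j
        have "\<bar>pt p j - c j\<bar> \<le> \<rho>" using A(3) that by auto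
        then show "\<bar>pt p j - c j\<bar> \<le> 2 * \<rho>" using \<rho>_pos by linarith
      qed
    qed (use A(3) in auto)
    also have "\<dots> = (\<Sum>b\<leftarrow>bs. \<Sum>p\<in>A. ennreal (\<mu> p) * (\<integral>\<^sup>+x. tent b \<omega> R \<nu> UNIV (pt p) x \<partial>Pi\<^sub>M UNIV M))"
      by (induction bs) (auto simp: sum.distrib distrib_left)
    also have "\<dots> \<le> (\<Sum>b\<leftarrow>bs. ennreal (?k * W) * ennreal (D b * near_sum \<omega> R \<nu>))"
    proof (rule sum_list_mono)
      fix b assume b: "b \<in> set bs"
      have tm: "tent b \<omega> R \<nu> UNIV (pt p) \<in> borel_measurable (Pi\<^sub>M UNIV M)" for p
        using tent_measurable[OF _ w(1) R(2)] bs b by blast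
      have nm: "(\<lambda>x. ennreal (?n b x)) \<in> borel_measurable (Pi\<^sub>M UNIV M)"
      proof -
        have "zero_ext (osc b \<omega> R \<nu>) \<in> borel_measurable (Pi\<^sub>M UNIV M)"
          using zero_ext_measurable[OF osc_continuous[OF _ w(1) R(2)]] bs b measurable_cong_sets[OF sets_PiM_M refl] by blast
        then show ?thesis by measurable
      qed
      have "(\<Sum>p\<in>A. ennreal (\<mu> p) * (\<integral>\<^sup>+x. tent b \<omega> R \<nu> UNIV (pt p) x \<partial>Pi\<^sub>M UNIV M)) =
          (\<integral>\<^sup>+x. (\<Sum>p\<in>A. ennreal (\<mu> p) * tent b \<omega> R \<nu> UNIV (pt p) x) \<partial>Pi\<^sub>M UNIV M)"
        using tm by (simp add: nn_integral_sum nn_integral_cmult)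
      also have "\<dots> \<le> (\<integral>\<^sup>+x. ennreal (?k * W) * ennreal (?n b x) \<partial>Pi\<^sub>M UNIV M)"
      proof (rule nn_integral_mono)
        fix x
        have "(\<Sum>p\<in>A. ennreal (\<mu> p) * tent b \<omega> R \<nu> UNIV (pt p) x) = (\<Sum>p\<in>A. ennreal (\<mu> p * (?k * ?i p x * ?n b x)))"
          unfolding tent_def using A by (intro sum.cong refl) (simp add: ennreal_mult')
        also have "\<dots> = ennreal (\<Sum>p\<in>A. \<mu> p * (?k * ?i p x * ?n b x))"
          using A k0 by (intro sum_ennreal) (auto intro!: mult_nonneg_nonneg prod_nonneg)
        finally have e: "(\<Sum>p\<in>A. ennreal (\<mu> p) * tent b \<omega> R \<nu> UNIV (pt p) x) = ennreal (\<Sum>p\<in>A. \<mu> p * (?k * ?i p x * ?n b x))" .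
        have "(\<Sum>p\<in>A. \<mu> p * (?k * ?i p x * ?n b x)) = ?k * (\<Sum>p\<in>A. \<mu> p * ?i p x) * ?n b x"
          by (simp add: sum_distrib_left sum_distrib_right mult_ac)
        also have "\<dots> \<le> ?k * W * ?n b x"
          using W k0 by (intro mult_right_mono mult_left_mono) auto
        finally have "ennreal (\<Sum>p\<in>A. \<mu> p * (?k * ?i p x * ?n b x)) \<le> ennreal (?k * W * ?n b x)"
          by (rule ennreal_leI)
        moreover have "ennreal (?k * W * ?n b x) = ennreal (?k * W) * ennreal (?n b x)"
          using k0 W0 by (intro ennreal_mult) auto
        ultimately show "(\<Sum>p\<in>A. ennreal (\<mu> p) * tent b \<omega> R \<nu> UNIV (pt p) x) \<le> ennreal (?k * W) * ennreal (?n b x)"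
          unfolding e by (simp only:)
      qed
      also have "\<dots> = ennreal (?k * W) * (\<integral>\<^sup>+x. ennreal (?n b x) \<partial>Pi\<^sub>M UNIV M)"
        by (rule nn_integral_cmult[OF nm])
      also have "\<dots> \<le> ennreal (?k * W) * ennreal (D b * near_sum \<omega> R \<nu>)"
        by (rule mult_left_mono[OF D(2)[OF b w(1) R sep]]) simp
      finally show "(\<Sum>p\<in>A. ennreal (\<mu> p) * (\<integral>\<^sup>+x. tent b \<omega> R \<nu> UNIV (pt p) x \<partial>Pi\<^sub>M UNIV M)) \<le> \<dots>" .
    qed
    also have "\<dots> = ennreal ((\<Sum>b\<leftarrow>bs. D b) * (?k * W * near_sum \<omega> R \<nu>))"
      using D(1)
    proof (induction bs)
      case (Cons b bs)
      have "0 \<le> (\<Sum>b\<leftarrow>bs. D b)" using Cons.prems by (intro sum_list_nonneg) (auto intro: less_imp_le)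
      moreover have "0 < D b" using Cons.prems by simp
      moreover have X: "0 \<le> ?k * W * near_sum \<omega> R \<nu>" using k0 W0 ns0 by simp
      moreover have "ennreal (?k * W) * ennreal (D b * near_sum \<omega> R \<nu>) = ennreal (D b * (?k * W * near_sum \<omega> R \<nu>))"
        using k0 W0 ns0 \<open>0 < D b\<close> by (subst ennreal_mult[symmetric]) (auto simp: mult_ac)
      moreover have "(\<Sum>b\<leftarrow>bs. ennreal (?k * W) * ennreal (D b * near_sum \<omega> R \<nu>)) =
          ennreal ((\<Sum>b\<leftarrow>bs. D b) * (?k * W * near_sum \<omega> R \<nu>))"
        using Cons by simp
      ultimately show ?case
        unfolding list.map sum_list.Cons distrib_right
        by (subst ennreal_plus) (auto simp del: times_divide_eq_left)
    qed simp
    also have "\<dots> \<le> ennreal (D0 * (?k * W * near_sum \<omega> R \<nu>))"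
      using k0 W0 ns0 by (intro ennreal_leI mult_right_mono) (auto simp: D0_def)
    finally have "ennreal (\<Sum>p\<in>A. \<mu> p * (norm (osc a \<omega> R \<nu> (pt p)))\<^sup>2) \<le> ennreal (D0 * (?k * W * near_sum \<omega> R \<nu>))" .
    moreover have "0 \<le> D0 * (?k * W * near_sum \<omega> R \<nu>)" using Dnn k0 W0 ns0 by (simp add: D0_def)
    ultimately have "(\<Sum>p\<in>A. \<mu> p * (norm (osc a \<omega> R \<nu> (pt p)))\<^sup>2) \<le> D0 * (?k * W * near_sum \<omega> R \<nu>)"
      by (simp add: ennreal_le_iff)
    also have "\<dots> = D0 / ?\<kappa> * \<omega> ^ CARD('m) * W * near_sum \<omega> R \<nu>" by (simp add: power_divide)
    finally show ?thesis .
  qed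
  moreover have "D0 / ?\<kappa> > 0" using Dnn \<rho>_pos by (simp add: D0_def)
  ultimately show ?thesis by blast
qed

end

section \<open>Dyadic summation\<close>

text \<open>Each q is charged to the first radius \<open>2 ^ j * \<delta>\<close> that reaches
  \<open>d q\<close>. That radius is at most twice \<open>max (d q) \<delta>\<close>, whence the
  factor \<open>2 powr a\<close>.\<close>

lemma dyadic_layer_sum:
  fixes d w :: "'q \<Rightarrow> real"
  assumes "finite R" "\<And>q. q \<in> R \<Longrightarrow> 0 \<le> w q" "0 < \<delta>" "0 \<le> a"
    and top: "\<And>q. q \<in> R \<Longrightarrow> d q \<le> 2 ^ J * \<delta>"
    and B: "\<And>j. j \<le> J \<Longrightarrow> sum w {q \<in> R. d q \<le> 2 ^ j * \<delta>} \<le> B j"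
  shows "(\<Sum>q\<in>R. w q * max (d q) \<delta> powr (- a)) \<le> (\<Sum>j\<le>J. 2 powr a * (2 ^ j * \<delta>) powr (- a) * B j)"
proof -
  let ?t = "\<lambda>j q. 2 powr a * (2 ^ j * \<delta>) powr (- a) * (if d q \<le> 2 ^ j * \<delta> then 1 else 0)"
  have pt: "max (d q) \<delta> powr (- a) \<le> (\<Sum>j\<le>J. ?t j q)" if q: "q \<in> R" for q
  proof -
    define j where "j = (LEAST j. d q \<le> 2 ^ j * \<delta>)"
    have dj: "d q \<le> 2 ^ j * \<delta>" unfolding j_def by (rule LeastI[of _ J]) (rule top[OF q])
    have jJ: "j \<le> J" unfolding j_def by (rule Least_le) (rule top[OF q])
    have low: "2 ^ j * \<delta> / 2 \<le> max (d q) \<delta>"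
    proof (cases j)
      case 0
      then show ?thesis using assms(3) by simp
    next
      case (Suc i)
      then have "\<not> d q \<le> 2 ^ i * \<delta>" unfolding j_def by (metis lessI not_less_Least)
      then show ?thesis using Suc by simp
    qed
    have "max (d q) \<delta> powr (- a) \<le> (2 ^ j * \<delta> / 2) powr (- a)"
      using low assms(3,4) by (intro powr_mono2') auto
    also have "\<dots> = ?t j q" using dj assms(3) by (simp add: powr_divide powr_minus field_simps)
    also have "\<dots> \<le> (\<Sum>j\<le>J. ?t j q)" using jJ by (intro member_le_sum) auto
    finally show ?thesis .
  qed
  have "(\<Sum>q\<in>R. w q * max (d q) \<delta> powr (- a)) \<le> (\<Sum>q\<in>R. w q * (\<Sum>j\<le>J. ?t j q))"
    using pt assms(2) by (intro sum_mono mult_left_mono) auto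
  also have "\<dots> = (\<Sum>j\<le>J. \<Sum>q\<in>R. w q * ?t j q)"
    unfolding sum_distrib_left by (rule sum.swap)
  also have "\<dots> = (\<Sum>j\<le>J. 2 powr a * (2 ^ j * \<delta>) powr (- a) * sum w {q \<in> R. d q \<le> 2 ^ j * \<delta>})"
  proof (rule sum.cong[OF refl])
    fix j
    have "(\<Sum>q\<in>R. w q * ?t j q) = 2 powr a * (2 ^ j * \<delta>) powr (- a) * (\<Sum>q\<in>R. if d q \<le> 2 ^ j * \<delta> then w q else 0)"
      unfolding sum_distrib_left by (intro sum.cong refl) simp
    also have "(\<Sum>q\<in>R. if d q \<le> 2 ^ j * \<delta> then w q else 0) = sum w {q \<in> R. d q \<le> 2 ^ j * \<delta>}"
      using assms(1) by (simp add: sum.inter_filter)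
    finally show "(\<Sum>q\<in>R. w q * ?t j q) = 2 powr a * (2 ^ j * \<delta>) powr (- a) * sum w {q \<in> R. d q \<le> 2 ^ j * \<delta>}" .
  qed
  also have "\<dots> \<le> (\<Sum>j\<le>J. 2 powr a * (2 ^ j * \<delta>) powr (- a) * B j)"
    using B by (intro sum_mono mult_left_mono) auto
  finally show ?thesis .
qed

lemma powr_pow2: "(2 ^ j * \<delta>) powr s = (2 powr s) ^ j * \<delta> powr s" if "0 < \<delta>" for \<delta> s :: real
  using that by (simp add: powr_mult powr_powr powr_realpow[symmetric] mult.commute)

text \<open>Since \<beta> < a, the dyadic layers form a geometric series of ratio
  \<open>2 powr (\<beta> - a)\<close> below 1, and the smallest radius \<delta> dominates.\<close>

lemma far_field_sum:
  fixes d w :: "'q \<Rightarrow> real"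
  assumes "finite R" "\<And>q. q \<in> R \<Longrightarrow> 0 \<le> w q" "0 < \<delta>" "0 \<le> \<beta>" "\<beta> < a" "0 \<le> C"
    and B: "\<And>t. \<delta> \<le> t \<Longrightarrow> sum w {q \<in> R. d q \<le> t} \<le> C * t powr \<beta>"
  shows "(\<Sum>q\<in>R. w q * max (d q) \<delta> powr (- a)) \<le> 2 powr a / (1 - 2 powr (\<beta> - a)) * C * \<delta> powr (\<beta> - a)"
proof -
  obtain J where J: "\<And>q. q \<in> R \<Longrightarrow> d q \<le> 2 ^ J * \<delta>"
  proof -
    define m where "m = Max (insert 0 (d ` R))"
    obtain J where J: "m / \<delta> < 2 ^ J" using real_arch_pow[of 2 "m / \<delta>"] by auto
    have "d q \<le> 2 ^ J * \<delta>" if "q \<in> R" for q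
    proof -
      have "d q \<le> m" unfolding m_def using that assms(1) by (intro Max_ge) auto
      also have "m \<le> 2 ^ J * \<delta>" using J assms(3) by (simp add: field_simps)
      finally show ?thesis .
    qed
    then show ?thesis using that by blast
  qed
  have q: "0 < 2 powr (\<beta> - a)" "2 powr (\<beta> - a) < 1" using assms(5) powr_less_mono[of "\<beta> - a" 0 2] by auto
  have "(\<Sum>q\<in>R. w q * max (d q) \<delta> powr (- a)) \<le> (\<Sum>j\<le>J. 2 powr a * (2 ^ j * \<delta>) powr (- a) * (C * (2 ^ j * \<delta>) powr \<beta>))"
    by (rule dyadic_layer_sum[OF assms(1-3) _ J]) (use assms B in auto)
  also have "\<dots> = 2 powr a * C * \<delta> powr (\<beta> - a) * (\<Sum>j\<le>J. (2 powr (\<beta> - a)) ^ j)"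
    unfolding sum_distrib_left
  proof (rule sum.cong[OF refl])
    fix j
    have "(2 ^ j * \<delta>) powr (- a) * (2 ^ j * \<delta>) powr \<beta> = (2 ^ j * \<delta>) powr (\<beta> - a)"
      by (simp add: powr_add[symmetric])
    then show "2 powr a * (2 ^ j * \<delta>) powr (- a) * (C * (2 ^ j * \<delta>) powr \<beta>) =
        2 powr a * C * \<delta> powr (\<beta> - a) * (2 powr (\<beta> - a)) ^ j"
      using powr_pow2[OF assms(3), of j "\<beta> - a"] by (simp add: algebra_simps)
  qed
  also have "\<dots> \<le> 2 powr a * C * \<delta> powr (\<beta> - a) * (1 / (1 - 2 powr (\<beta> - a)))"
  proof (rule mult_left_mono)
    have "(\<Sum>j\<le>J. (2 powr (\<beta> - a)) ^ j) = (1 - (2 powr (\<beta> - a)) ^ Suc J) / (1 - 2 powr (\<beta> - a))"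
      using q by (subst sum_gp0) auto
    also have "\<dots> \<le> 1 / (1 - 2 powr (\<beta> - a))"
      using q by (intro divide_right_mono) auto
    finally show "(\<Sum>j\<le>J. (2 powr (\<beta> - a)) ^ j) \<le> 1 / (1 - 2 powr (\<beta> - a))" .
  qed (use assms(6) in simp)
  also have "\<dots> = 2 powr a / (1 - 2 powr (\<beta> - a)) * C * \<delta> powr (\<beta> - a)" by simp
  finally show ?thesis .
qed

section \<open>Slabs transversal to the kernel\<close>

text \<open>\<open>E\<close> is an orthonormal basis of the kernel, obtained as the orthogonal
  complement of the row space. The map sending v to \<open>M *v v\<close> together with its
  projection to the kernel is linear and injective, hence bounded below.\<close>

lemma nullspace_transversal:
  fixes M :: "real^'n::finite^'m::finite"
  shows "\<exists>E \<kappa>. finite E \<and> card E + rank M = CARD('n) \<and> 0 < \<kappa> \<and>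
     (\<forall>v. \<kappa> * norm v \<le> norm (M *v v) + (\<Sum>u\<in>E. \<bar>u \<bullet> v\<bar>))"
proof -
  let ?S = "span (rows M)"
  define K where "K = {y \<in> (UNIV :: (real^'n) set). \<forall>x\<in>?S. orthogonal x y}"
  have dimK: "dim K + rank M = CARD('n)"
    using dim_subspace_orthogonal_to_vectors[of ?S UNIV] by (simp add: K_def row_rank_def)
  have subK: "subspace K"
    unfolding K_def by (auto simp: subspace_def orthogonal_clauses)
  obtain E where E: "E \<subseteq> K" "pairwise orthogonal E" "\<And>x. x \<in> E \<Longrightarrow> norm x = 1" "independent E" "card E = dim K" "span E = K"
    using orthonormal_basis_subspace[OF subK] by metis
  have fin: "finite E" using E(4) by (rule independent_imp_finite)
  let ?g = "\<lambda>v. (M *v v, \<Sum>u\<in>E. (u \<bullet> v) *\<^sub>R u)"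
  have lin: "linear ?g"
    by (intro linearI) (auto simp: matrix_vector_right_distrib inner_add_right scaleR_add_left sum.distrib
        vec.scale scaleR_sum_right matrix_vector_mult_scaleR)
  have "inj ?g"
  proof (subst linear_injective_0[OF lin], intro allI impI)
    fix v assume "?g v = 0"
    then have v: "M *v v = 0" "(\<Sum>u\<in>E. (u \<bullet> v) *\<^sub>R u) = 0" by (auto simp: zero_prod_def)
    have "0 = v \<bullet> (\<Sum>u\<in>E. (u \<bullet> v) *\<^sub>R u)" using v(2) by simp
    also have "\<dots> = (\<Sum>u\<in>E. (u \<bullet> v)\<^sup>2)"
      unfolding inner_sum_right by (intro sum.cong refl) (simp add: power2_eq_square inner_commute)
    finally have "(\<Sum>u\<in>E. (u \<bullet> v)\<^sup>2) = 0" by simp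
    then have z: "\<forall>u\<in>E. u \<bullet> v = 0" using fin by (subst (asm) sum_nonneg_eq_0_iff) auto
    have "v \<in> K" unfolding K_def using orthogonal_nullspace_rowspace[OF v(1)] by (auto simp: orthogonal_commute)
    then have "v \<in> span E" using E(6) by simp
    moreover have "orthogonal v u" if "u \<in> E" for u using z that by (simp add: orthogonal_def inner_commute)
    ultimately have "orthogonal v v" by (rule orthogonal_to_span)
    then show "v = 0" by (simp add: orthogonal_self)
  qed
  from linear_inj_bounded_below_pos[OF lin this] obtain \<kappa> where \<kappa>: "\<kappa> > 0" "\<And>x. \<kappa> * norm x \<le> norm (?g x)" by blast
  have "\<kappa> * norm v \<le> norm (M *v v) + (\<Sum>u\<in>E. \<bar>u \<bullet> v\<bar>)" for v
  proof -
    have "\<kappa> * norm v \<le> norm (M *v v) + norm (\<Sum>u\<in>E. (u \<bullet> v) *\<^sub>R u)"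
      using \<kappa>(2)[of v] norm_Pair_le order_trans by blast
    also have "norm (\<Sum>u\<in>E. (u \<bullet> v) *\<^sub>R u) \<le> (\<Sum>u\<in>E. \<bar>u \<bullet> v\<bar>)"
      by (rule order_trans[OF norm_sum]) (simp add: E(3))
    finally show ?thesis by simp
  qed
  then show ?thesis using fin E(5) dimK \<kappa>(1) by (intro exI[of _ E] exI[of _ \<kappa>]) auto
qed

lemma card_floor_interval:
  fixes a b :: real
  assumes "a \<le> b"
  shows "real (card {\<lfloor>a\<rfloor>..\<lfloor>b\<rfloor>}) \<le> b - a + 2"
proof -
  have "\<lfloor>a\<rfloor> \<le> \<lfloor>b\<rfloor>" using assms by (rule floor_mono)
  then have "real (card {\<lfloor>a\<rfloor>..\<lfloor>b\<rfloor>}) = of_int \<lfloor>b\<rfloor> - of_int \<lfloor>a\<rfloor> + 1" by simp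
  then show ?thesis using of_int_floor_le[of b] floor_correct[of a] by linarith
qed

text \<open>On the ball \<open>u \<bullet> q\<close> ranges over an interval of length at most
  \<open>2 * norm u * \<sigma>\<close>, so each u contributes O(\<omega>) values of the floor. The
  exponent is the number of directions in \<open>E\<close>, not the dimension of the space.\<close>

lemma card_cells:
  fixes E :: "'a::euclidean_space set"
  assumes "finite E" "0 \<le> \<sigma>"
  shows "\<exists>L>0. \<forall>\<omega>\<ge>1. \<forall>R. R \<subseteq> cball y0 \<sigma> \<longrightarrow>
    finite ((\<lambda>q. \<lambda>u\<in>E. \<lfloor>\<omega> * (u \<bullet> q)\<rfloor>) ` R) \<and>
    real (card ((\<lambda>q. \<lambda>u\<in>E. \<lfloor>\<omega> * (u \<bullet> q)\<rfloor>) ` R)) \<le> L * \<omega> ^ card E"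
proof -
  let ?L = "\<Prod>u\<in>E. 2 * norm u * \<sigma> + 2"
  have "finite ((\<lambda>q. \<lambda>u\<in>E. \<lfloor>\<omega> * (u \<bullet> q)\<rfloor>) ` R) \<and>
    real (card ((\<lambda>q. \<lambda>u\<in>E. \<lfloor>\<omega> * (u \<bullet> q)\<rfloor>) ` R)) \<le> ?L * \<omega> ^ card E"
    if w: "1 \<le> \<omega>" and R: "R \<subseteq> cball y0 \<sigma>" for \<omega> R
  proof -
    let ?lo = "\<lambda>u. \<omega> * (u \<bullet> y0) - \<omega> * (norm u * \<sigma>)" and ?hi = "\<lambda>u. \<omega> * (u \<bullet> y0) + \<omega> * (norm u * \<sigma>)"
    let ?T = "PiE E (\<lambda>u. {\<lfloor>?lo u\<rfloor>..\<lfloor>?hi u\<rfloor>})"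
    have finT: "finite ?T" using assms(1) by (intro finite_PiE) auto
    have sub: "(\<lambda>q. \<lambda>u\<in>E. \<lfloor>\<omega> * (u \<bullet> q)\<rfloor>) ` R \<subseteq> ?T"
    proof (intro image_subsetI PiE_I)
      fix q u assume q: "q \<in> R"
      have "\<bar>u \<bullet> (q - y0)\<bar> \<le> norm u * norm (q - y0)" by (rule Cauchy_Schwarz_ineq2)
      also have "\<dots> \<le> norm u * \<sigma>" using q R by (intro mult_left_mono) (auto simp: dist_norm norm_minus_commute)
      finally have *: "\<bar>u \<bullet> (q - y0)\<bar> \<le> norm u * \<sigma>" .
      have "\<omega> * \<bar>u \<bullet> (q - y0)\<bar> \<le> \<omega> * (norm u * \<sigma>)" using * w by (intro mult_left_mono) auto
      then have "\<bar>\<omega> * (u \<bullet> q) - \<omega> * (u \<bullet> y0)\<bar> \<le> \<omega> * (norm u * \<sigma>)"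
        using w by (simp add: inner_diff_right right_diff_distrib[symmetric] abs_mult)
      then have "?lo u \<le> \<omega> * (u \<bullet> q)" "\<omega> * (u \<bullet> q) \<le> ?hi u" unfolding abs_le_iff by linarith+
      then show "u \<in> E \<Longrightarrow> (\<lambda>u\<in>E. \<lfloor>\<omega> * (u \<bullet> q)\<rfloor>) u \<in> {\<lfloor>?lo u\<rfloor>..\<lfloor>?hi u\<rfloor>}"
        by (simp add: floor_mono)
    qed auto
    have "real (card ((\<lambda>q. \<lambda>u\<in>E. \<lfloor>\<omega> * (u \<bullet> q)\<rfloor>) ` R)) \<le> real (card ?T)"
      using card_mono[OF finT sub] by simp
    also have "\<dots> = (\<Prod>u\<in>E. real (card {\<lfloor>?lo u\<rfloor>..\<lfloor>?hi u\<rfloor>}))"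
      using assms(1) by (simp add: card_PiE)
    also have "\<dots> \<le> (\<Prod>u\<in>E. (2 * norm u * \<sigma> + 2) * \<omega>)"
    proof (intro prod_mono conjI)
      fix u
      have "real (card {\<lfloor>?lo u\<rfloor>..\<lfloor>?hi u\<rfloor>}) \<le> ?hi u - ?lo u + 2"
        using w assms(2) by (intro card_floor_interval) auto
      also have "\<dots> \<le> (2 * norm u * \<sigma> + 2) * \<omega>" using w by (simp add: algebra_simps)
      finally show "real (card {\<lfloor>?lo u\<rfloor>..\<lfloor>?hi u\<rfloor>}) \<le> (2 * norm u * \<sigma> + 2) * \<omega>" .
    qed simp
    also have "\<dots> = ?L * \<omega> ^ card E" by (simp add: prod.distrib)
    finally show ?thesis using finite_subset[OF sub finT] by simp
  qed
  moreover have "?L > 0" using assms(2) by (intro prod_pos) (auto intro: add_nonneg_pos)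
  ultimately show ?thesis by blast
qed

lemma Cauchy_Schwarz_sum:
  fixes a :: "'a \<Rightarrow> real"
  assumes "\<And>i. i \<in> I \<Longrightarrow> 0 \<le> a i"
  shows "(norm (\<Sum>i\<in>I. of_real (a i) * z i :: complex))\<^sup>2 \<le> sum a I * (\<Sum>i\<in>I. a i * (norm (z i))\<^sup>2)"
proof -
  have "norm (\<Sum>i\<in>I. of_real (a i) * z i :: complex) \<le> (\<Sum>i\<in>I. sqrt (a i) * (sqrt (a i) * norm (z i)))"
    by (rule order_trans[OF norm_sum sum_mono]) (use assms in \<open>simp add: norm_mult mult.assoc[symmetric]\<close>)
  then have "(norm (\<Sum>i\<in>I. of_real (a i) * z i :: complex))\<^sup>2 \<le> (\<Sum>i\<in>I. sqrt (a i) * (sqrt (a i) * norm (z i)))\<^sup>2"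
    by (rule power_mono) simp
  also have "\<dots> \<le> (\<Sum>i\<in>I. (sqrt (a i))\<^sup>2) * (\<Sum>i\<in>I. (sqrt (a i) * norm (z i))\<^sup>2)"
    by (rule Cauchy_Schwarz_ineq_sum)
  also have "\<dots> = sum a I * (\<Sum>i\<in>I. a i * (norm (z i))\<^sup>2)"
    using assms by (simp add: power_mult_distrib cong: sum.cong)
  finally show ?thesis .
qed

section \<open>Decay of oscillatory sums\<close>

text \<open>For v the difference of two points of one slab, the kernel part is at most
  \<open>card E / \<omega>\<close>, which is below half of \<open>\<kappa> * norm v\<close> once v
  is long enough. The other half must come from \<open>M *v v\<close>, and one of its
  \<open>CARD('m)\<close> coordinates carries at least an average share.\<close>

lemma transversal_direction:
  fixes M :: "real^'n::finite^'m::finite"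
  assumes low: "\<And>v. \<kappa> * norm v \<le> norm (M *v v) + (\<Sum>u\<in>E. \<bar>u \<bullet> v\<bar>)"
    and E: "\<And>u. u \<in> E \<Longrightarrow> \<bar>u \<bullet> v\<bar> \<le> 1 / \<omega>"
    and far: "2 * real (card E) / \<kappa> \<le> \<omega> * norm v" and pos: "0 < \<kappa>" "0 < \<omega>"
  shows "\<exists>i. \<kappa> / (2 * real CARD('m)) * norm v \<le> \<bar>(M *v v) $ i\<bar>"
proof (rule ccontr)
  assume neg: "\<not> ?thesis"
  have "(\<Sum>u\<in>E. \<bar>u \<bullet> v\<bar>) \<le> real (card E) * (1 / \<omega>)"
    using sum_bounded_above[of E "\<lambda>u. \<bar>u \<bullet> v\<bar>" "1 / \<omega>"] E by simp
  also have "\<dots> \<le> \<kappa> / 2 * norm v" using far pos by (simp add: field_simps)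
  finally have s: "(\<Sum>u\<in>E. \<bar>u \<bullet> v\<bar>) \<le> \<kappa> / 2 * norm v" .
  have "norm (M *v v) \<le> (\<Sum>i\<in>UNIV. \<bar>(M *v v) $ i\<bar>)" by (rule norm_le_l1_cart)
  also have "\<dots> < (\<Sum>i\<in>(UNIV::'m set). \<kappa> / (2 * real CARD('m)) * norm v)"
    using neg by (intro sum_strict_mono) (auto simp: not_le)
  also have "\<dots> = \<kappa> / 2 * norm v" by simp
  finally show False using low[of v] s by linarith
qed

text \<open>If the box with corner p contains x, every coordinate differs by at most
  \<open>1 / \<omega>\<close>, so p lies in the Euclidean ball of radius
  \<open>CARD('m) / \<omega>\<close> by comparison with the l1 norm.\<close>

lemma box_overlap_le:
  fixes \<mu> :: "real^'m::finite \<Rightarrow> real"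
  assumes "finite A" "\<And>p. p \<in> A \<Longrightarrow> 0 \<le> \<mu> p" "0 < \<omega>"
  shows "(\<Sum>p\<in>A. \<mu> p * (\<Prod>j\<in>UNIV. indicator {p $ j..p $ j + 1 / \<omega>} (x j)))
     \<le> sum \<mu> (A \<inter> cball (\<chi> j. x j) (real CARD('m) / \<omega>))"
proof -
  have "(\<Sum>p\<in>A. \<mu> p * (\<Prod>j\<in>UNIV. indicator {p $ j..p $ j + 1 / \<omega>} (x j)))
     \<le> (\<Sum>p\<in>A. if p \<in> cball (\<chi> j. x j) (real CARD('m) / \<omega>) then \<mu> p else 0)"
  proof (rule sum_mono)
    fix p assume p: "p \<in> A"
    show "\<mu> p * (\<Prod>j\<in>UNIV. indicator {p $ j..p $ j + 1 / \<omega>} (x j)) \<le>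
        (if p \<in> cball (\<chi> j. x j) (real CARD('m) / \<omega>) then \<mu> p else 0)"
    proof (cases "\<forall>j. x j \<in> {p $ j..p $ j + 1 / \<omega>}")
      case True
      have "norm ((\<chi> j. x j) - p) \<le> (\<Sum>j\<in>UNIV. \<bar>((\<chi> j. x j) - p) $ j\<bar>)" by (rule norm_le_l1_cart)
      also have "\<dots> \<le> (\<Sum>j\<in>(UNIV::'m set). 1 / \<omega>)"
      proof (rule sum_mono)
        fix j
        have "x j \<in> {p $ j..p $ j + 1 / \<omega>}" using True by blast
        then show "\<bar>((\<chi> j. x j) - p) $ j\<bar> \<le> 1 / \<omega>" by (auto simp: abs_le_iff)
      qed
      finally have "p \<in> cball (\<chi> j. x j) (real CARD('m) / \<omega>)" by (simp add: dist_norm)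
      then show ?thesis using True by simp
    next
      case False
      then obtain j where "x j \<notin> {p $ j..p $ j + 1 / \<omega>}" by blast
      then have z: "(\<Prod>j\<in>UNIV. indicator {p $ j..p $ j + 1 / \<omega>} (x j)) = (0::real)"
        by (intro prod_zero) (auto simp: indicator_def)
      show ?thesis unfolding z using assms(2)[OF p] by simp
    qed
  qed
  also have "\<dots> = sum \<mu> (A \<inter> cball (\<chi> j. x j) (real CARD('m) / \<omega>))"
    using assms(1) by (simp add: sum.inter_restrict)
  finally show ?thesis .
qed

text \<open>Finitely many point masses behave like an s-dimensional measure only down to a scale;
  hence the ball condition is imposed for radii \<open>t \<ge> \<delta>\<close> only.\<close>

definition frostman :: "real \<Rightarrow> real \<Rightarrow> real \<Rightarrow> 'a::metric_space set \<Rightarrow> ('a \<Rightarrow> real) \<Rightarrow> bool" where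
  "frostman C s \<delta> A \<mu> \<longleftrightarrow> finite A \<and> (\<forall>p\<in>A. 0 \<le> \<mu> p) \<and> sum \<mu> A = 1 \<and>
     (\<forall>x. \<forall>t\<ge>\<delta>. sum \<mu> (A \<inter> cball x t) \<le> C * t powr s)"

text \<open>The square of the sum is at most a constant times the product of four powers of
  \<omega>: \<open>CARD('n) - rank\<close> from the number of slabs, \<open>CARD('m)\<close> from
  Sobolev, -\<alpha> from the overlap of the boxes, -\<beta> from the near pairs. The neighbourhoods
  and \<open>\<omega>0\<close> are fixed before the Frostman constant \<open>C\<close>, which only
  enters \<open>D\<close>.\<close>

theorem oscillatory_sum_decay:
  fixes \<Phi> :: "(real^'m::finite) \<times> (real^'n::finite) \<Rightarrow> real"
  assumes sm: "smooth_on (X \<times> Y) \<Phi>" and "open X" "open Y" "x0 \<in> X" "y0 \<in> Y"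
    and r: "r \<le> rank (mixed_hessian \<Phi> x0 y0)" and \<alpha>: "0 \<le> \<alpha>" and \<beta>: "0 \<le> \<beta>"
  shows "\<exists>\<sigma>>0. \<exists>\<omega>0\<ge>1. \<forall>C\<ge>0. \<exists>D>0. \<forall>\<omega>\<ge>\<omega>0. \<forall>A \<mu> R \<nu>.
     A \<subseteq> cball x0 \<sigma> \<longrightarrow> R \<subseteq> cball y0 \<sigma> \<longrightarrow> frostman C \<alpha> (1 / \<omega>) A \<mu> \<longrightarrow> frostman C \<beta> (1 / \<omega>) R \<nu> \<longrightarrow>
     norm (\<Sum>p\<in>A. \<Sum>q\<in>R. of_real (\<mu> p * \<nu> q) * cis (\<omega> * \<Phi> (p, q)))
       \<le> D * \<omega> powr (- ((\<alpha> + \<beta> - real CARD('m) - real CARD('n) + real r) / 2))"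
proof -
  let ?m = "real CARD('m)"
  define H where "H = mixed_hessian \<Phi> x0 y0"
  obtain E \<kappa> where E: "finite E" "card E + rank H = CARD('n)" "0 < \<kappa>"
     "\<And>v. \<kappa> * norm v \<le> norm (H *v v) + (\<Sum>u\<in>E. \<bar>u \<bullet> v\<bar>)"
    using nullspace_transversal[of H] by blast
  \<comment> \<open>Half of the constant \<open>\<kappa> / (2 * CARD('m))\<close> of
    \<open>transversal_direction\<close>; the other half pays for the variation of the mixed Hessian
    over the neighbourhood.\<close>
  define c0 where "c0 = \<kappa> / (4 * ?m)"
  have c0: "c0 > 0" using E(3) by (simp add: c0_def)
  obtain \<rho>1 where \<rho>1: "\<rho>1 > 0" "ball x0 \<rho>1 \<subseteq> X" "ball y0 \<rho>1 \<subseteq> Y"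
    and grad: "\<And>i x y y'. x \<in> ball x0 \<rho>1 \<Longrightarrow> y \<in> ball y0 \<rho>1 \<Longrightarrow> y' \<in> ball y0 \<rho>1 \<Longrightarrow>
     \<bar>ddir \<Phi> (axis i 1, 0) (x, y) - ddir \<Phi> (axis i 1, 0) (x, y') - (H *v (y - y')) $ i\<bar> \<le> c0 * norm (y - y')"
    using gradient_difference_estimate[OF sm assms(2-5) c0] unfolding H_def by blast
  \<comment> \<open>The box of half-width \<open>3 * \<rho>\<close> lies in a Euclidean ball of
    radius \<open>3 * \<rho> * ?m\<close>, which has to be smaller than
    \<open>\<rho>1\<close>.\<close>
  define \<rho> where "\<rho> = \<rho>1 / (4 * ?m)"
  have \<rho>: "\<rho> > 0" "3 * \<rho> * ?m < \<rho>1" using \<rho>1(1) by (auto simp: \<rho>_def)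
  define V where "V = cball y0 (\<rho>1 / 2)"
  define K1 where "K1 = cball x0 (3 * \<rho> * ?m)"
  \<comment> \<open>More than \<beta> integrations by parts, so that the kernel of
    \<open>near_sum\<close> is summable against a measure of dimension \<beta>.\<close>
  define N where "N = nat \<lceil>\<beta>\<rceil> + 1"
  have N: "\<beta> < real N" unfolding N_def by linarith
  define \<phi> where "\<phi> y x = \<Phi> ((\<chi> i. x i), y)" for y x
  define d\<phi> where "d\<phi> j y x = ddir \<Phi> (axis j 1, 0) ((\<chi> i. x i), y)" for j :: 'm and y and x :: "'m \<Rightarrow> real"
  interpret weighted_box "\<lambda>j. x0 $ j" \<rho> N by unfold_locales (rule \<rho>(1))
  have UK: "(\<chi> i. x i) \<in> K1" if "x \<in> U" for x
  proof -
    have "norm ((\<chi> j. x j) - x0) \<le> (\<Sum>j\<in>UNIV. \<bar>((\<chi> j. x j) - x0) $ j\<bar>)" by (rule norm_le_l1_cart)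
    also have "\<dots> \<le> (\<Sum>j\<in>(UNIV::'m set). 3 * \<rho>)"
      using that by (intro sum_mono) (auto simp: U_def less_imp_le)
    finally show ?thesis by (simp add: K1_def dist_norm norm_minus_commute mult_ac)
  qed
  have K1s: "K1 \<subseteq> ball x0 \<rho>1" using \<rho>(2) by (auto simp: K1_def)
  have Vs: "V \<subseteq> ball y0 \<rho>1" using \<rho>1(1) by (auto simp: V_def)
  have comp: "compact K1" "compact V" "convex V" by (auto simp: K1_def V_def)
  have KV: "K1 \<times> V \<subseteq> X \<times> Y" using K1s Vs \<rho>1 by blast
  interpret phase_box "\<lambda>j. x0 $ j" \<rho> N \<phi> V d\<phi>
  proof unfold_locales
    show "continuous_on U (\<phi> y)" if "y \<in> V" for y
      unfolding \<phi>_def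
      by (intro continuous_on_compose2[OF smooth_on_continuous[OF sm]] continuous_intros continuous_on_vec_fun)
         (use UK KV that in auto)
    show "((\<lambda>t. \<phi> y (x(j := t))) has_real_derivative d\<phi> j y x) (at (x j))" if "y \<in> V" "x \<in> U" for j y x
      unfolding \<phi>_def d\<phi>_def by (rule has_real_derivative_fst_upd[OF sm]) (use UK KV that in auto)
    show "symb k V U (\<lambda>y x. complex_of_real (d\<phi> j y x))" for k j
      unfolding d\<phi>_def by (rule symb_smooth[OF comp(1,2) KV UK smooth_on_ddir[OF sm]])
    show "symb k {z \<in> V \<times> V. fst z \<noteq> snd z} U
          (\<lambda>z x. complex_of_real ((d\<phi> j (fst z) x - d\<phi> j (snd z) x) / dist (fst z) (snd z)))" for k j
      unfolding d\<phi>_def dist_norm by (rule symb_diff_quotient[OF comp KV UK smooth_on_ddir[OF sm]])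
  qed
  \<comment> \<open>The distance, in units of \<open>1 / \<omega>\<close>, from which on two points
    of one slab have a transversal difference.\<close>
  define K where "K = max 1 (2 * real (card E) / \<kappa>)"
  have "K \<ge> 1" by (simp add: K_def)
  have one: "symb (N + CARD('m)) P U (\<lambda>i x. 1)" by (rule symb_const[of _ _ 1]) auto
  obtain D where D: "D > 0" "\<forall>\<omega> R \<nu> (A :: (real^'m) set) \<mu> pt W. 1 \<le> \<omega> \<longrightarrow> 2 / \<rho> \<le> \<omega> \<longrightarrow> finite R \<longrightarrow> R \<subseteq> V \<longrightarrow>
     (\<forall>y\<in>R. 0 \<le> \<nu> y) \<longrightarrow> separated_phases c0 K \<omega> R \<longrightarrow> finite A \<longrightarrow> (\<forall>p\<in>A. 0 \<le> \<mu> p) \<longrightarrow>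
     (\<forall>p\<in>A. \<forall>j. \<bar>pt p j - x0 $ j\<bar> \<le> \<rho>) \<longrightarrow>
     (\<forall>x. (\<Sum>p\<in>A. \<mu> p * (\<Prod>j\<in>UNIV. indicator {pt p j..pt p j + 1 / \<omega>} (x j))) \<le> W) \<longrightarrow>
     (\<Sum>p\<in>A. \<mu> p * (norm (osc (\<lambda>i x. 1) \<omega> R \<nu> (pt p)))\<^sup>2) \<le> D * \<omega> ^ CARD('m) * W * near_sum \<omega> R \<nu>"
    using weighted_osc_bound[OF one c0 \<open>K \<ge> 1\<close>, where 'p = "real^'m"] by (elim exE conjE) (rule that)
  define \<sigma> where "\<sigma> = min \<rho> (\<rho>1 / 2)"
  have \<sigma>: "\<sigma> > 0" "\<sigma> \<le> \<rho>" "cball y0 \<sigma> \<subseteq> V" using \<rho> \<rho>1(1) by (auto simp: \<sigma>_def V_def)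
  obtain L where L: "L > 0" "\<And>\<omega> R. 1 \<le> \<omega> \<Longrightarrow> R \<subseteq> cball y0 \<sigma> \<Longrightarrow>
    finite ((\<lambda>q. \<lambda>u\<in>E. \<lfloor>\<omega> * (u \<bullet> q)\<rfloor>) ` R) \<and>
    real (card ((\<lambda>q. \<lambda>u\<in>E. \<lfloor>\<omega> * (u \<bullet> q)\<rfloor>) ` R)) \<le> L * \<omega> ^ card E"
    using card_cells[OF E(1) less_imp_le[OF \<sigma>(1)]] by metis
  define G where "G = 2 powr real N / (1 - 2 powr (\<beta> - real N))"
  have G: "0 < G" unfolding G_def using N powr_less_mono[of "\<beta> - real N" 0 2] by simp
  have main: "norm (\<Sum>p\<in>A. \<Sum>q\<in>R. of_real (\<mu> p * \<nu> q) * cis (\<omega> * \<Phi> (p, q)))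
       \<le> sqrt (L * D * (C * ?m powr \<alpha>) * (G * C) + 1) * \<omega> powr (- ((\<alpha> + \<beta> - ?m - real CARD('n) + real r) / 2))"
    if C: "0 \<le> C" and w: "max 1 (2 / \<rho>) \<le> \<omega>" and A: "A \<subseteq> cball x0 \<sigma>" and R: "R \<subseteq> cball y0 \<sigma>"
      and \<mu>: "frostman C \<alpha> (1 / \<omega>) A \<mu>" and \<nu>: "frostman C \<beta> (1 / \<omega>) R \<nu>" for C \<omega> A \<mu> R \<nu>
  proof -
    have w1: "1 \<le> \<omega>" "2 / \<rho> \<le> \<omega>" using w by auto
    have finA: "finite A" and \<mu>0: "\<And>p. p \<in> A \<Longrightarrow> 0 \<le> \<mu> p" and \<mu>1: "sum \<mu> A = 1"
      and \<mu>t: "\<And>x t. 1 / \<omega> \<le> t \<Longrightarrow> sum \<mu> (A \<inter> cball x t) \<le> C * t powr \<alpha>"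
      using \<mu> by (auto simp: frostman_def)
    have finR: "finite R" and \<nu>0: "\<And>p. p \<in> R \<Longrightarrow> 0 \<le> \<nu> p" and \<nu>1: "sum \<nu> R = 1"
      and \<nu>t: "\<And>x t. 1 / \<omega> \<le> t \<Longrightarrow> sum \<nu> (R \<inter> cball x t) \<le> C * t powr \<beta>"
      using \<nu> by (auto simp: frostman_def)
    \<comment> \<open>The slab of q: the functionals in \<open>E\<close> are resolved to precision
      \<open>1 / \<omega>\<close>.\<close>
    define cell where "cell q = (\<lambda>u\<in>E. \<lfloor>\<omega> * (u \<bullet> q)\<rfloor>)" for q :: "real^'n"
    define Q where "Q c = {q \<in> R. cell q = c}" for c
    let ?cells = "cell ` R"
    have fc: "finite ?cells" using finR by simp
    have nc: "real (card ?cells) \<le> L * \<omega> ^ card E"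
      using L(2)[OF w1(1) R] by (simp add: cell_def)
    have QR: "Q c \<subseteq> R" for c by (auto simp: Q_def)
    let ?pt = "\<lambda>p :: real^'m. \<lambda>j. p $ j"
    let ?F = "\<lambda>S p. osc (\<lambda>i x. 1) \<omega> S \<nu> (?pt p)"
    have F: "?F S p = (\<Sum>q\<in>S. of_real (\<nu> q) * cis (\<omega> * \<Phi> (p, q)))" for S p
      by (simp add: osc_def \<phi>_def)
    have split: "?F R p = (\<Sum>c\<in>?cells. ?F (Q c) p)" for p
      unfolding F Q_def using sum.image_gen[OF finR, of _ cell] by simp
    \<comment> \<open>The Frostman bound at radius \<open>?m / \<omega>\<close>, which is admissible
      because it is at least \<open>1 / \<omega>\<close>.\<close>
    define W where "W = C * (?m / \<omega>) powr \<alpha>"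
    have W: "(\<Sum>p\<in>A. \<mu> p * (\<Prod>j\<in>UNIV. indicator {p $ j..p $ j + 1 / \<omega>} (x j))) \<le> W" for x
      using box_overlap_le[where \<mu> = \<mu> and \<omega> = \<omega> and x = x, OF finA \<mu>0] \<mu>t[of "?m / \<omega>" "\<chi> j. x j"] w1
      by (force simp: W_def divide_right_mono)
    have W0: "0 \<le> W" using C by (simp add: W_def)
    have sep: "separated_phases c0 K \<omega> (Q c)" for c
      unfolding separated_phases_def
    proof (intro ballI impI)
      fix y y' assume y: "y \<in> Q c" "y' \<in> Q c" and far: "K \<le> \<omega> * dist y y'"
      have "\<bar>u \<bullet> (y - y')\<bar> \<le> 1 / \<omega>" if "u \<in> E" for u
      proof -
        have "cell y u = cell y' u" using y by (simp add: Q_def)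
        then have "\<lfloor>\<omega> * (u \<bullet> y)\<rfloor> = \<lfloor>\<omega> * (u \<bullet> y')\<rfloor>" using that by (simp add: cell_def)
        then have "\<bar>\<omega> * (u \<bullet> y) - \<omega> * (u \<bullet> y')\<bar> \<le> 1"
          using floor_correct[of "\<omega> * (u \<bullet> y)"] floor_correct[of "\<omega> * (u \<bullet> y')"] by linarith
        then have "\<omega> * \<bar>u \<bullet> (y - y')\<bar> \<le> 1"
          using w1(1) by (simp add: inner_diff_right right_diff_distrib[symmetric] abs_mult)
        then show ?thesis using w1(1) by (simp add: field_simps)
      qed
      moreover have "2 * real (card E) / \<kappa> \<le> \<omega> * norm (y - y')"
        using far by (simp add: K_def dist_norm)
      ultimately obtain i where i: "\<kappa> / (2 * ?m) * norm (y - y') \<le> \<bar>(H *v (y - y')) $ i\<bar>"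
        using transversal_direction[OF E(4), where v = "y - y'" and \<omega> = \<omega>] E(3) w1(1) by auto
      have "c0 * dist y y' \<le> \<bar>d\<phi> i y x - d\<phi> i y' x\<bar>" if x: "x \<in> U" for x
      proof -
        have yy: "y \<in> ball y0 \<rho>1" "y' \<in> ball y0 \<rho>1" using y QR R \<sigma>(3) Vs by blast+
        have "(\<chi> i. x i) \<in> ball x0 \<rho>1" using UK[OF x] K1s by blast
        from grad[OF this yy, of i]
        have "\<bar>d\<phi> i y x - d\<phi> i y' x - (H *v (y - y')) $ i\<bar> \<le> c0 * norm (y - y')" by (simp add: d\<phi>_def)
        moreover have "\<kappa> / (2 * ?m) * norm (y - y') = 2 * (c0 * norm (y - y'))" by (simp add: c0_def)
        ultimately show ?thesis using i unfolding dist_norm by linarith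
      qed
      then show "\<exists>j. \<forall>x\<in>U. c0 * dist y y' \<le> \<bar>d\<phi> j y x - d\<phi> j y' x\<bar>" by blast
    qed
    have pieces: "(\<Sum>p\<in>A. \<mu> p * (norm (?F (Q c) p))\<^sup>2) \<le> D * \<omega> ^ CARD('m) * W * near_sum \<omega> (Q c) \<nu>" for c
    proof (rule D(2)[rule_format, OF w1 _ _ _ sep finA])
      show "finite (Q c)" using finite_subset[OF QR finR] .
      show "Q c \<subseteq> V" using QR R \<sigma>(3) by blast
      show "0 \<le> \<nu> y" if "y \<in> Q c" for y using that QR \<nu>0 by blast
      show "\<bar>p $ j - x0 $ j\<bar> \<le> \<rho>" if "p \<in> A" for p j
      proof -
        have "norm (p - x0) \<le> \<rho>" using that A \<sigma>(2) by (force simp: dist_norm norm_minus_commute)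
        then show "\<bar>p $ j - x0 $ j\<bar> \<le> \<rho>" using component_le_norm_cart[of "p - x0" j] by simp
      qed
    qed (use \<mu>0 W in auto)
    have near: "(\<Sum>c\<in>?cells. near_sum \<omega> (Q c) \<nu>) \<le> G * C * \<omega> powr (- \<beta>)"
    proof -
      have inner: "(\<Sum>y'\<in>R. \<nu> y' / (\<omega> * max (dist y y') (1 / \<omega>)) ^ N) \<le> G * C * \<omega> powr (- \<beta>)" for y
      proof -
        have "(\<Sum>y'\<in>R. \<nu> y' / (\<omega> * max (dist y y') (1 / \<omega>)) ^ N) =
            \<omega> powr (- real N) * (\<Sum>y'\<in>R. \<nu> y' * max (dist y y') (1 / \<omega>) powr (- real N))"
          unfolding sum_distrib_left
        proof (rule sum.cong[OF refl])
          fix y'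
          have pos: "0 < max (dist y y') (1 / \<omega>)" using w1(1) by (auto simp: less_max_iff_disj)
          then show "\<nu> y' / (\<omega> * max (dist y y') (1 / \<omega>)) ^ N = \<omega> powr (- real N) * (\<nu> y' * max (dist y y') (1 / \<omega>) powr (- real N))"
            using w1(1) by (simp add: powr_minus powr_realpow power_mult_distrib field_simps)
        qed
        also have "\<dots> \<le> \<omega> powr (- real N) * (G * C * (1 / \<omega>) powr (\<beta> - real N))"
          unfolding G_def
        proof (intro mult_left_mono far_field_sum[OF finR \<nu>0])
          fix t assume "1 / \<omega> \<le> t"
          moreover have "{q \<in> R. dist y q \<le> t} = R \<inter> cball y t" by auto
          ultimately show "sum \<nu> {q \<in> R. dist y q \<le> t} \<le> C * t powr \<beta>" using \<nu>t by simp
        qed (use w1(1) \<beta> N C in auto)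
        also have "\<dots> = G * C * \<omega> powr (- \<beta>)"
        proof -
          have "(1 / \<omega>) powr (\<beta> - real N) = \<omega> powr (real N - \<beta>)"
            using w1(1) by (simp add: powr_divide powr_minus_divide[symmetric] powr_one_eq_one)
          then have "\<omega> powr (- real N) * (1 / \<omega>) powr (\<beta> - real N) = \<omega> powr (- \<beta>)"
            by (simp add: powr_add[symmetric])
          then show ?thesis by (simp add: mult_ac)
        qed
        finally show ?thesis .
      qed
      \<comment> \<open>The inner sum is enlarged from the slab to all of \<open>R\<close>, where
        \<open>inner\<close> bounds it; the outer sums over the slabs then recombine to the total
        mass 1. So the slabs cost nothing here.\<close>
      have "(\<Sum>c\<in>?cells. near_sum \<omega> (Q c) \<nu>) \<le> (\<Sum>c\<in>?cells. \<Sum>y\<in>Q c. \<nu> y * (G * C * \<omega> powr (- \<beta>)))"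
      proof (rule sum_mono, unfold near_sum_def, rule sum_mono)
        fix c y assume y: "y \<in> Q c"
        have "(\<Sum>y'\<in>Q c. \<nu> y * \<nu> y' / (\<omega> * max (dist y y') (1 / \<omega>)) ^ N) =
           \<nu> y * (\<Sum>y'\<in>Q c. \<nu> y' / (\<omega> * max (dist y y') (1 / \<omega>)) ^ N)"
          by (simp add: sum_distrib_left)
        also have "\<dots> \<le> \<nu> y * (\<Sum>y'\<in>R. \<nu> y' / (\<omega> * max (dist y y') (1 / \<omega>)) ^ N)"
          using y QR \<nu>0 w1(1)
          by (intro mult_left_mono sum_mono2 finR divide_nonneg_nonneg zero_le_power mult_nonneg_nonneg)
             (auto simp: le_max_iff_disj)
        also have "\<dots> \<le> \<nu> y * (G * C * \<omega> powr (- \<beta>))"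
          using y QR \<nu>0 by (intro mult_left_mono inner) auto
        finally show "(\<Sum>y'\<in>Q c. \<nu> y * \<nu> y' / (\<omega> * max (dist y y') (1 / \<omega>)) ^ N) \<le> \<nu> y * (G * C * \<omega> powr (- \<beta>))" .
      qed
      also have "\<dots> = (\<Sum>y\<in>R. \<nu> y * (G * C * \<omega> powr (- \<beta>)))"
        unfolding Q_def by (rule sum.image_gen[OF finR, symmetric])
      also have "\<dots> = G * C * \<omega> powr (- \<beta>)" by (simp add: sum_distrib_right[symmetric] \<nu>1)
      finally show ?thesis .
    qed
    have "(norm (\<Sum>p\<in>A. of_real (\<mu> p) * ?F R p))\<^sup>2 \<le> sum \<mu> A * (\<Sum>p\<in>A. \<mu> p * (norm (?F R p))\<^sup>2)"
      by (rule Cauchy_Schwarz_sum[OF \<mu>0])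
    also have "\<dots> \<le> (\<Sum>p\<in>A. \<mu> p * (real (card ?cells) * (\<Sum>c\<in>?cells. (norm (?F (Q c) p))\<^sup>2)))"
    proof -
      have "(norm (?F R p))\<^sup>2 \<le> real (card ?cells) * (\<Sum>c\<in>?cells. (norm (?F (Q c) p))\<^sup>2)" for p
        using Cauchy_Schwarz_sum[of ?cells "\<lambda>_. 1" "\<lambda>c. ?F (Q c) p"] unfolding split by simp
      then show ?thesis unfolding \<mu>1 using \<mu>0 by (simp add: sum_mono mult_left_mono)
    qed
    also have "\<dots> = real (card ?cells) * (\<Sum>c\<in>?cells. \<Sum>p\<in>A. \<mu> p * (norm (?F (Q c) p))\<^sup>2)"
      by (subst sum.swap) (simp add: sum_distrib_left mult_ac)
    also have "\<dots> \<le> real (card ?cells) * (\<Sum>c\<in>?cells. D * \<omega> ^ CARD('m) * W * near_sum \<omega> (Q c) \<nu>)"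
      by (intro mult_left_mono sum_mono pieces) auto
    also have "\<dots> = real (card ?cells) * (D * \<omega> ^ CARD('m) * W * (\<Sum>c\<in>?cells. near_sum \<omega> (Q c) \<nu>))"
      by (simp add: sum_distrib_left)
    also have "\<dots> \<le> (L * \<omega> ^ card E) * (D * \<omega> ^ CARD('m) * W * (G * C * \<omega> powr (- \<beta>)))"
      using nc near D(1) W0 w1(1) C G L(1)
      by (intro mult_mono mult_left_mono mult_nonneg_nonneg sum_nonneg)
         (auto simp: near_sum_def le_max_iff_disj intro!: sum_nonneg divide_nonneg_nonneg mult_nonneg_nonneg zero_le_power \<nu>0 subsetD[OF QR])
    also have "\<dots> = L * D * (C * ?m powr \<alpha>) * (G * C) * \<omega> powr (real (card E) + ?m - \<alpha> - \<beta>)"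
    proof -
      have "\<omega> powr (real (card E) + ?m - \<alpha> - \<beta>) = \<omega> ^ card E * \<omega> ^ CARD('m) * \<omega> powr (- \<alpha>) * \<omega> powr (- \<beta>)"
        using w1(1) by (simp add: powr_add[symmetric] powr_realpow[symmetric])
      moreover have "(?m / \<omega>) powr \<alpha> = ?m powr \<alpha> * \<omega> powr (- \<alpha>)"
        using w1(1) by (simp add: powr_divide powr_minus_divide)
      ultimately show ?thesis by (simp add: W_def mult_ac)
    qed
    \<comment> \<open>The rank at the base point may exceed r, which only helps since \<omega> is at
      least 1. The summand 1 keeps the constant positive even for \<open>C = 0\<close>.\<close>
    also have "\<dots> \<le> (L * D * (C * ?m powr \<alpha>) * (G * C) + 1) * \<omega> powr (- (\<alpha> + \<beta> - ?m - real CARD('n) + real r))"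
    proof (rule mult_mono)
      have "card E + r \<le> CARD('n)" using E(2) r[folded H_def] by linarith
      then have "real (card E + r) \<le> real CARD('n)" by (simp only: of_nat_le_iff)
      then have "real (card E) \<le> real CARD('n) - real r" by simp
      then show "\<omega> powr (real (card E) + ?m - \<alpha> - \<beta>) \<le> \<omega> powr (- (\<alpha> + \<beta> - ?m - real CARD('n) + real r))"
        using w1(1) by (intro powr_mono) auto
    qed (use L(1) D(1) C G in auto)
    also have "\<dots> = (sqrt (L * D * (C * ?m powr \<alpha>) * (G * C) + 1) * \<omega> powr (- ((\<alpha> + \<beta> - ?m - real CARD('n) + real r) / 2)))\<^sup>2"
    proof -
      have "0 \<le> L * D * (C * ?m powr \<alpha>) * (G * C) + 1" using L(1) D(1) C G by simp
      moreover have "\<omega> powr (- (\<alpha> + \<beta> - ?m - real CARD('n) + real r)) =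
          (\<omega> powr (- ((\<alpha> + \<beta> - ?m - real CARD('n) + real r) / 2)))\<^sup>2"
        by (simp add: power2_eq_square powr_add[symmetric])
      ultimately show ?thesis by (simp add: power_mult_distrib)
    qed
    finally have "norm (\<Sum>p\<in>A. of_real (\<mu> p) * ?F R p) \<le>
        sqrt (L * D * (C * ?m powr \<alpha>) * (G * C) + 1) * \<omega> powr (- ((\<alpha> + \<beta> - ?m - real CARD('n) + real r) / 2))"
      by (rule power2_le_imp_le) (use L(1) D(1) C G in simp)
    moreover have "(\<Sum>p\<in>A. of_real (\<mu> p) * ?F R p) = (\<Sum>p\<in>A. \<Sum>q\<in>R. of_real (\<mu> p * \<nu> q) * cis (\<omega> * \<Phi> (p, q)))"
      unfolding F by (simp add: sum_distrib_left mult.assoc)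
    ultimately show ?thesis by simp
  qed
  have Dpos: "0 < sqrt (L * D * (C * ?m powr \<alpha>) * (G * C) + 1)" if "0 \<le> C" for C
    using that L(1) D(1) G by (simp add: add_nonneg_pos)
  have "\<forall>C\<ge>0. \<exists>D>0. \<forall>\<omega>\<ge>max 1 (2 / \<rho>). \<forall>A \<mu> R \<nu>. A \<subseteq> cball x0 \<sigma> \<longrightarrow> R \<subseteq> cball y0 \<sigma> \<longrightarrow>
       frostman C \<alpha> (1 / \<omega>) A \<mu> \<longrightarrow> frostman C \<beta> (1 / \<omega>) R \<nu> \<longrightarrow>
       norm (\<Sum>p\<in>A. \<Sum>q\<in>R. of_real (\<mu> p * \<nu> q) * cis (\<omega> * \<Phi> (p, q)))
       \<le> D * \<omega> powr (- ((\<alpha> + \<beta> - ?m - real CARD('n) + real r) / 2))"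
  proof (intro allI impI)
    fix C :: real assume C: "0 \<le> C"
    show "\<exists>D>0. \<forall>\<omega>\<ge>max 1 (2 / \<rho>). \<forall>A \<mu> R \<nu>. A \<subseteq> cball x0 \<sigma> \<longrightarrow> R \<subseteq> cball y0 \<sigma> \<longrightarrow>
       frostman C \<alpha> (1 / \<omega>) A \<mu> \<longrightarrow> frostman C \<beta> (1 / \<omega>) R \<nu> \<longrightarrow>
       norm (\<Sum>p\<in>A. \<Sum>q\<in>R. of_real (\<mu> p * \<nu> q) * cis (\<omega> * \<Phi> (p, q)))
       \<le> D * \<omega> powr (- ((\<alpha> + \<beta> - ?m - real CARD('n) + real r) / 2))"
      by (intro exI[of _ "sqrt (L * D * (C * ?m powr \<alpha>) * (G * C) + 1)"] conjI Dpos[OF C] allI impI)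
         (rule main[OF C])
  qed
  moreover have "1 \<le> max 1 (2 / \<rho>)" by simp
  ultimately show ?thesis using \<sigma>(1) by blast
qed

section \<open>A discrete Frostman lemma\<close>

text \<open>Positive s-dimensional Hausdorff content, tested on finite covers only: the saturated
  cells of the Frostman construction form such a cover.\<close>

definition pos_content :: "real \<Rightarrow> 'a::metric_space set \<Rightarrow> bool" where
  "pos_content s A \<longleftrightarrow> (\<exists>c>0. \<forall>\<U>. finite \<U> \<longrightarrow> A \<subseteq> \<Union>\<U> \<longrightarrow> (\<forall>U\<in>\<U>. bounded U) \<longrightarrow>
     c \<le> (\<Sum>U\<in>\<U>. diameter U powr s))"

lemma diam_power_pos: "0 < s \<Longrightarrow> diam_power s U = ennreal (diameter U powr s)"
  by (simp add: diam_power_def diameter_def)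

text \<open>Some premeasure at a scale \<delta> is positive. A finite cover by sets of diameter at
  most \<delta> competes in it; any other finite cover already has a member contributing at least
  \<open>\<delta> powr s\<close>.\<close>

lemma pos_content_of_hausdorff_measure:
  assumes "0 < s" "hausdorff_measure s A \<noteq> 0"
  shows "pos_content s A"
proof -
  obtain \<delta> where \<delta>: "\<delta> > 0" "hausdorff_premeasure s \<delta> A \<noteq> 0"
  proof -
    have "\<exists>\<delta>>0. hausdorff_premeasure s \<delta> A \<noteq> 0"
    proof (rule ccontr)
      assume "\<not> ?thesis"
      then have "hausdorff_measure s A = (SUP \<delta>\<in>{0::real<..}. 0)"
        unfolding hausdorff_measure_def by (intro SUP_cong) auto
      then show False using assms(2) by simp
    qed
    then show ?thesis using that by blast
  qed
  then have "0 < hausdorff_premeasure s \<delta> A" by (simp add: zero_less_iff_neq_zero)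
  then obtain c0 where c0: "0 < c0" "ennreal c0 \<le> hausdorff_premeasure s \<delta> A"
  proof (cases "hausdorff_premeasure s \<delta> A")
    case (real r)
    then show ?thesis using that[of r] \<open>0 < hausdorff_premeasure s \<delta> A\<close> by simp
  next
    case top
    then show ?thesis using that[of 1] by simp
  qed
  define c where "c = min c0 (\<delta> powr s)"
  have "c > 0" using c0 \<delta> by (simp add: c_def)
  moreover have "c \<le> (\<Sum>U\<in>\<U>. diameter U powr s)"
    if fin: "finite \<U>" and cov: "A \<subseteq> \<Union>\<U>" and bd: "\<forall>U\<in>\<U>. bounded U" for \<U>
  proof (cases "\<forall>U\<in>\<U>. diameter U \<le> \<delta>")
    case False
    then obtain U where U: "U \<in> \<U>" "\<delta> < diameter U" by auto
    have "c \<le> \<delta> powr s" by (simp add: c_def)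
    also have "\<dots> \<le> diameter U powr s" using U \<delta> assms(1) by (intro powr_mono2) auto
    also have "\<dots> \<le> (\<Sum>U\<in>\<U>. diameter U powr s)" using U fin by (intro member_le_sum) auto
    finally show ?thesis .
  next
    case True
    obtain h where h: "bij_betw h {0..<card \<U>} \<U>" using ex_bij_betw_nat_finite[OF fin] by auto
    define V where "V i = (if i < card \<U> then h i else {})" for i
    have hU: "h i \<in> \<U>" if "i < card \<U>" for i using h that by (auto simp: bij_betw_def)
    have cov': "A \<subseteq> (\<Union>i. V i)"
    proof
      fix x assume "x \<in> A"
      then obtain U where "U \<in> \<U>" "x \<in> U" using cov by auto
      then obtain i where "i < card \<U>" "h i = U" using h unfolding bij_betw_def by (metis atLeastLessThan_iff imageE)
      then show "x \<in> (\<Union>i. V i)" using \<open>x \<in> U\<close> by (auto simp: V_def intro!: exI[of _ i])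
    qed
    have "V \<in> {U. A \<subseteq> (\<Union>i. U i) \<and> (\<forall>i. bounded (U i) \<and> diameter (U i) \<le> \<delta>)}"
      using cov' hU bd True \<delta>(1) by (auto simp: V_def)
    then have "hausdorff_premeasure s \<delta> A \<le> (\<Sum>i. diam_power s (V i))"
      unfolding hausdorff_premeasure_def by (rule INF_lower)
    also have "\<dots> = (\<Sum>i\<in>{0..<card \<U>}. diam_power s (V i))"
      by (rule suminf_finite) (auto simp: V_def diam_power_def)
    also have "\<dots> = (\<Sum>i\<in>{0..<card \<U>}. ennreal (diameter (h i) powr s))"
      by (intro sum.cong refl) (simp add: V_def diam_power_pos[OF assms(1)])
    also have "\<dots> = ennreal (\<Sum>i\<in>{0..<card \<U>}. diameter (h i) powr s)" by (rule sum_ennreal) simp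
    also have "(\<Sum>i\<in>{0..<card \<U>}. diameter (h i) powr s) = (\<Sum>U\<in>\<U>. diameter U powr s)"
      by (rule sum.reindex_bij_betw[OF h])
    finally have "ennreal c0 \<le> ennreal (\<Sum>U\<in>\<U>. diameter U powr s)" using c0(2) by simp
    then have "c0 \<le> (\<Sum>U\<in>\<U>. diameter U powr s)" by (simp add: ennreal_le_iff sum_nonneg)
    then show ?thesis by (simp add: c_def)
  qed
  ultimately show ?thesis unfolding pos_content_def by blast
qed

lemma pos_content_below_dim:
  assumes "0 < s" "ereal s < hausdorff_dim A"
  shows "pos_content s A"
proof (rule pos_content_of_hausdorff_measure[OF assms(1)])
  show "hausdorff_measure s A \<noteq> 0"
  proof
    assume "hausdorff_measure s A = 0"
    then have "hausdorff_dim A \<le> ereal s"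
      unfolding hausdorff_dim_def using assms(1) by (intro INF_lower) auto
    then show False using assms(2) by simp
  qed
qed

lemma not_pos_contentD:
  assumes "\<not> pos_content s A" "0 < c"
  obtains \<U> where "finite \<U>" "A \<subseteq> \<Union>\<U>" "\<forall>U\<in>\<U>. bounded U" "(\<Sum>U\<in>\<U>. diameter U powr s) < c"
  using assms unfolding pos_content_def by (meson not_le)

lemma pos_content_mono: "pos_content s A \<Longrightarrow> A \<subseteq> B \<Longrightarrow> pos_content s B"
  unfolding pos_content_def by (meson order_trans)

lemma not_pos_content_Un:
  assumes "\<not> pos_content s A" "\<not> pos_content s B"
  shows "\<not> pos_content s (A \<union> B)"
proof
  assume "pos_content s (A \<union> B)"
  then obtain c where c: "c > 0" "\<And>\<U>. finite \<U> \<Longrightarrow> A \<union> B \<subseteq> \<Union>\<U> \<Longrightarrow> (\<forall>U\<in>\<U>. bounded U) \<Longrightarrow>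
     c \<le> (\<Sum>U\<in>\<U>. diameter U powr s)" unfolding pos_content_def by blast
  obtain \<U> where U: "finite \<U>" "A \<subseteq> \<Union>\<U>" "\<forall>U\<in>\<U>. bounded U" "(\<Sum>U\<in>\<U>. diameter U powr s) < c / 2"
    using not_pos_contentD[OF assms(1), of "c / 2"] c(1) by auto
  obtain \<V> where V: "finite \<V>" "B \<subseteq> \<Union>\<V>" "\<forall>U\<in>\<V>. bounded U" "(\<Sum>U\<in>\<V>. diameter U powr s) < c / 2"
    using not_pos_contentD[OF assms(2), of "c / 2"] c(1) by auto
  have "c \<le> (\<Sum>U\<in>\<U> \<union> \<V>. diameter U powr s)" using U V by (intro c(2)) auto
  also have "\<dots> \<le> (\<Sum>U\<in>\<U>. diameter U powr s) + (\<Sum>U\<in>\<V>. diameter U powr s)"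
    using sum.union_inter[OF U(1) V(1), of "\<lambda>U. diameter U powr s"]
      sum_nonneg[of "\<U> \<inter> \<V>" "\<lambda>U. diameter U powr s"] by simp
  finally show False using U(4) V(4) by simp
qed

lemma not_pos_content_UN:
  "finite I \<Longrightarrow> (\<And>i. i \<in> I \<Longrightarrow> \<not> pos_content s (A i)) \<Longrightarrow> \<not> pos_content s (\<Union>i\<in>I. A i)"
proof (induction I rule: finite_induct)
  case empty
  show ?case unfolding pos_content_def by (force intro: exI[of _ "{}"])
next
  case (insert i I)
  then show ?case using not_pos_content_Un[of s "A i" "\<Union>i\<in>I. A i"] by simp
qed

text \<open>Failure of positive content is stable under finite unions, so by compactness it cannot
  hold locally everywhere. The point found serves as the centre for the local decay
  estimate.\<close>

lemma pos_content_localize: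
  fixes A :: "'a::metric_space set"
  assumes "compact A" "pos_content s A"
  shows "\<exists>x\<in>A. \<forall>\<rho>>0. pos_content s (A \<inter> cball x \<rho>)"
proof (rule ccontr)
  assume "\<not> ?thesis"
  then obtain \<rho> where \<rho>: "\<And>x. x \<in> A \<Longrightarrow> \<rho> x > 0 \<and> \<not> pos_content s (A \<inter> cball x (\<rho> x))" by metis
  have "A \<subseteq> (\<Union>x\<in>A. ball x (\<rho> x))" using \<rho> by auto
  then obtain I where I: "I \<subseteq> A" "finite I" "A \<subseteq> (\<Union>x\<in>I. ball x (\<rho> x))"
    using compactE_image[OF assms(1), of A "\<lambda>x. ball x (\<rho> x)"] by auto
  have "\<not> pos_content s (\<Union>x\<in>I. A \<inter> cball x (\<rho> x))"
    using \<rho> I by (intro not_pos_content_UN) auto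
  moreover have "A \<subseteq> (\<Union>x\<in>I. A \<inter> cball x (\<rho> x))"
  proof
    fix a assume "a \<in> A"
    then obtain x where "x \<in> I" "a \<in> ball x (\<rho> x)" using I(3) by blast
    then show "a \<in> (\<Union>x\<in>I. A \<inter> cball x (\<rho> x))" using \<open>a \<in> A\<close> by (intro UN_I[of x]) auto
  qed
  ultimately show False using pos_content_mono assms(2) by blast
qed

text \<open>Points are added one at a time, each with the largest admissible mass; a saturated cell stays
  saturated.\<close>

lemma greedy_saturation:
  fixes cell :: "nat \<Rightarrow> 'a \<Rightarrow> 'c" and b :: "nat \<Rightarrow> real"
  assumes b: "\<And>j. 0 \<le> b j" and "finite S"
  shows "\<exists>w. (\<forall>p. 0 \<le> w p) \<and> (\<forall>j\<le>k. \<forall>c. sum w {p \<in> S. cell j p = c} \<le> b j) \<and>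
     (\<forall>p\<in>S. \<exists>j\<le>k. sum w {q \<in> S. cell j q = cell j p} = b j)"
  using assms(2)
proof (induction S rule: finite_induct)
  case empty
  then show ?case using b by (intro exI[of _ "\<lambda>_. 0"]) simp
next
  case (insert p S)
  then obtain w where w: "\<And>p. 0 \<le> w p" "\<And>j c. j \<le> k \<Longrightarrow> sum w {p \<in> S. cell j p = c} \<le> b j"
     "\<And>p. p \<in> S \<Longrightarrow> \<exists>j\<le>k. sum w {q \<in> S. cell j q = cell j p} = b j" by blast
  define g where "g j = b j - sum w {q \<in> S. cell j q = cell j p}" for j
  define v where "v = Min (g ` {..k})"
  define w' where "w' = w(p := v)"
  have gv: "v \<le> g j" if "j \<le> k" for j unfolding v_def using that by (intro Min_le) auto
  obtain j0 where j0: "j0 \<le> k" "v = g j0"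
  proof -
    have "v \<in> g ` {..k}" unfolding v_def by (intro Min_in) auto
    then show ?thesis using that by auto
  qed
  have v0: "0 \<le> v" using j0 w(2) by (simp add: g_def)
  have same: "sum w' T = sum w T" if "T \<subseteq> S" for T
    unfolding w'_def using that insert.hyps(2) by (intro sum.cong) auto
  have sums: "sum w' {q \<in> insert p S. cell j q = c} =
      (if c = cell j p then v else 0) + sum w {q \<in> S. cell j q = c}" for j c
  proof (cases "c = cell j p")
    case True
    then have "{q \<in> insert p S. cell j q = c} = insert p {q \<in> S. cell j q = c}" by auto
    moreover have "p \<notin> {q \<in> S. cell j q = c}" using insert.hyps(2) by simp
    ultimately show ?thesis using insert.hyps(1) True same[of "{q \<in> S. cell j q = c}"] by (simp add: w'_def)
  next
    case False
    then have "{q \<in> insert p S. cell j q = c} = {q \<in> S. cell j q = c}" by auto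
    then show ?thesis using False same[of "{q \<in> S. cell j q = c}"] by simp
  qed
  have ub: "sum w' {q \<in> insert p S. cell j q = c} \<le> b j" if "j \<le> k" for j c
    using gv[OF that] w(2)[OF that, of c] unfolding sums by (auto simp: g_def)
  have sat: "\<exists>j\<le>k. sum w' {q \<in> insert p S. cell j q = cell j p'} = b j" if p': "p' \<in> insert p S" for p'
  proof (cases "p' = p")
    case True
    then show ?thesis using j0 unfolding sums by (auto simp: g_def)
  next
    case False
    then obtain j where j: "j \<le> k" "sum w {q \<in> S. cell j q = cell j p'} = b j" using w(3) p' by auto
    have "b j \<le> sum w' {q \<in> insert p S. cell j q = cell j p'}" unfolding sums using j v0 by simp
    then show ?thesis using ub[OF j(1), of "cell j p'"] j(1) by (intro exI[of _ j]) auto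
  qed
  have "\<forall>p. 0 \<le> w' p" using w(1) v0 by (simp add: w'_def)
  then show ?case using ub sat by blast
qed

section \<open>Dyadic cells\<close>

text \<open>The integer label of the half-open dyadic cube of side \<open>(1 / 2) ^ k\<close>
  containing x. Restricting to \<open>Basis\<close> makes equality of labels the same as lying in
  one cube, and lets \<open>PiE\<close> enumerate them.\<close>

definition cell :: "nat \<Rightarrow> 'a::euclidean_space \<Rightarrow> 'a \<Rightarrow> int" where
  "cell k x = (\<lambda>u\<in>Basis. \<lfloor>2 ^ k * (u \<bullet> x)\<rfloor>)"

lemma cell_coarser: "cell (Suc k) x = cell (Suc k) y \<Longrightarrow> cell k x = cell k y"
proof -
  assume eq: "cell (Suc k) x = cell (Suc k) y"
  have half: "\<lfloor>2 ^ k * a\<rfloor> = \<lfloor>2 ^ Suc k * a\<rfloor> div 2" for a :: real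
    using floor_divide_real_eq_div[of 2 "2 ^ Suc k * a"] by simp
  show ?thesis unfolding cell_def
  proof (rule restrict_ext)
    fix u :: 'a assume "u \<in> Basis"
    then have "\<lfloor>2 ^ Suc k * (u \<bullet> x)\<rfloor> = \<lfloor>2 ^ Suc k * (u \<bullet> y)\<rfloor>"
      using fun_cong[OF eq, of u] by (simp add: cell_def)
    then show "\<lfloor>2 ^ k * (u \<bullet> x)\<rfloor> = \<lfloor>2 ^ k * (u \<bullet> y)\<rfloor>" unfolding half by simp
  qed
qed

lemma cell_mono: "j \<le> k \<Longrightarrow> cell k x = cell k y \<Longrightarrow> cell j x = cell j y"
  by (induction k) (auto simp: le_Suc_eq dest: cell_coarser)

lemma cell_diameter:
  fixes A :: "'a::euclidean_space set"
  shows "bounded (A \<inter> {x. cell k x = c})" "diameter (A \<inter> {x. cell k x = c}) \<le> real DIM('a) / 2 ^ k"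
proof -
  have d: "dist x y \<le> real DIM('a) / 2 ^ k" if "cell k x = c" "cell k y = c" for x y :: 'a
  proof -
    have "norm (x - y) \<le> (\<Sum>b\<in>Basis. \<bar>(x - y) \<bullet> b\<bar>)" by (rule norm_le_l1)
    also have "\<dots> \<le> (\<Sum>b\<in>(Basis::'a set). 1 / 2 ^ k)"
    proof (rule sum_mono)
      fix b :: 'a assume b: "b \<in> Basis"
      have "cell k x b = cell k y b" using that by simp
      with b have "\<lfloor>2 ^ k * (b \<bullet> x)\<rfloor> = \<lfloor>2 ^ k * (b \<bullet> y)\<rfloor>"
        by (simp add: cell_def)
      then have "\<bar>2 ^ k * (b \<bullet> x) - 2 ^ k * (b \<bullet> y)\<bar> \<le> 1"
        using floor_correct[of "2 ^ k * (b \<bullet> x)"] floor_correct[of "2 ^ k * (b \<bullet> y)"] by linarith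
      then have "2 ^ k * \<bar>(x - y) \<bullet> b\<bar> \<le> 1"
        by (simp add: inner_diff_right right_diff_distrib[symmetric] abs_mult inner_commute)
      then show "\<bar>(x - y) \<bullet> b\<bar> \<le> 1 / 2 ^ k" by (simp add: field_simps)
    qed
    finally show ?thesis by (simp add: dist_norm)
  qed
  show "bounded (A \<inter> {x. cell k x = c})"
  proof (cases "A \<inter> {x. cell k x = c} = {}")
    case False
    then obtain a where "cell k a = c" by auto
    then show ?thesis unfolding bounded_def using d by (intro exI[of _ a] exI) auto
  qed simp
  show "diameter (A \<inter> {x. cell k x = c}) \<le> real DIM('a) / 2 ^ k"
    by (rule diameter_le) (use d in \<open>auto simp: dist_norm\<close>)
qed

lemma finite_cells:
  fixes A :: "'a::euclidean_space set"
  assumes "bounded A"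
  shows "\<exists>L>0. \<forall>k. finite (cell k ` A) \<and> real (card (cell k ` A)) \<le> L * (2 ^ k) ^ DIM('a)"
proof -
  obtain a e where "A \<subseteq> cball a e" using assms unfolding bounded_def subset_iff mem_cball by blast
  then have sub: "A \<subseteq> cball a (max e 0)" by auto
  obtain L where "L > 0" "\<forall>\<omega>\<ge>1. \<forall>R. R \<subseteq> cball a (max e 0) \<longrightarrow>
    finite ((\<lambda>q. \<lambda>u\<in>(Basis::'a set). \<lfloor>\<omega> * (u \<bullet> q)\<rfloor>) ` R) \<and>
    real (card ((\<lambda>q. \<lambda>u\<in>(Basis::'a set). \<lfloor>\<omega> * (u \<bullet> q)\<rfloor>) ` R)) \<le> L * \<omega> ^ DIM('a)"
    using card_cells[OF finite_Basis, of "max e 0" a] by auto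
  then show ?thesis using sub by (intro exI[of _ L]) (auto simp: cell_def)
qed

text \<open>At level k there are O(2^(kn)) cells of diameter O(2^(-k)), n being the dimension of the
  space. For s > n their sum tends to 0, which contradicts positive content.\<close>

lemma hausdorff_dim_le_DIM:
  fixes A :: "'a::euclidean_space set"
  assumes "bounded A"
  shows "hausdorff_dim A \<le> ereal (real DIM('a))"
proof (rule ccontr)
  assume "\<not> ?thesis"
  then obtain s where s: "ereal (real DIM('a)) < ereal s" "ereal s < hausdorff_dim A"
    by (metis ereal_dense2 not_le)
  then have sn: "real DIM('a) < s" by simp
  have s0: "0 < s" using sn by (meson less_trans of_nat_0_less_iff DIM_positive)
  obtain c where c: "c > 0" "\<And>\<U>. finite \<U> \<Longrightarrow> A \<subseteq> \<Union>\<U> \<Longrightarrow> (\<forall>U\<in>\<U>. bounded U) \<Longrightarrow>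
     c \<le> (\<Sum>U\<in>\<U>. diameter U powr s)"
    using pos_content_below_dim[OF s0 s(2)] unfolding pos_content_def by blast
  obtain L where L: "L > 0" "\<And>k. finite (cell k ` A)" "\<And>k. real (card (cell k ` A)) \<le> L * (2 ^ k) ^ DIM('a)"
    using finite_cells[OF assms] by blast
  let ?n = "real DIM('a)"
  have "c \<le> L * ?n powr s * (2 powr (?n - s)) ^ k" for k
  proof -
    let ?\<U> = "(\<lambda>c. A \<inter> {x. cell k x = c}) ` (cell k ` A)"
    have "c \<le> (\<Sum>U\<in>?\<U>. diameter U powr s)" using L(2)[of k] cell_diameter(1) by (intro c(2)) auto
    also have "\<dots> \<le> (\<Sum>U\<in>?\<U>. (?n / 2 ^ k) powr s)"
      using cell_diameter(2) cell_diameter(1) s0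
      by (intro sum_mono powr_mono2) (auto intro!: diameter_ge_0)
    also have "\<dots> = real (card ?\<U>) * (?n / 2 ^ k) powr s" by simp
    also have "\<dots> \<le> L * (2 ^ k) ^ DIM('a) * (?n / 2 ^ k) powr s"
    proof (rule mult_right_mono)
      have "card ?\<U> \<le> card (cell k ` A)" by (rule card_image_le[OF L(2)])
      then show "real (card ?\<U>) \<le> L * (2 ^ k) ^ DIM('a)" using L(3)[of k] by linarith
    qed simp
    also have "\<dots> = L * ?n powr s * (2 powr (?n - s)) ^ k"
    proof -
      have "(2 powr (?n - s)) ^ k = 2 powr (real k * ?n) * 2 powr (- (real k * s))"
        by (simp add: powr_realpow[symmetric] powr_powr powr_add[symmetric] algebra_simps)
      moreover have "(2 ^ k) ^ DIM('a) = (2::real) powr (real k * ?n)"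
        by (simp add: powr_realpow[symmetric] powr_powr)
      moreover have "(?n / 2 ^ k) powr s = ?n powr s * 2 powr (- (real k * s))"
        by (simp add: powr_divide powr_realpow[symmetric] powr_powr powr_minus_divide)
      ultimately show ?thesis by simp
    qed
    finally show ?thesis .
  qed
  moreover have "(\<lambda>k. L * ?n powr s * (2 powr (?n - s)) ^ k) \<longlonglongrightarrow> L * ?n powr s * 0"
    using sn powr_less_mono[of "?n - s" 0 2] by (intro tendsto_intros LIMSEQ_realpow_zero) auto
  ultimately have "c \<le> L * ?n powr s * 0" by (intro LIMSEQ_le_const) auto
  then show False using c(1) by simp
qed

text \<open>One representative per cell of side below \<delta> receives a greedy mass under the
  constraints \<open>(1 / 2) ^ j powr s\<close> on cells of level j. Every representative lies in a
  saturated cell; the coarsest such cells are disjoint and cover \<open>A\<close>, so positive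
  content bounds the total mass from below and normalisation costs only a constant.\<close>

lemma frostman_lemma:
  fixes A :: "'a::euclidean_space set"
  assumes "bounded A" "pos_content s A" "0 < s"
  shows "\<exists>C\<ge>0. \<forall>\<delta>. 0 < \<delta> \<longrightarrow> (\<exists>S \<mu>. S \<subseteq> A \<and> frostman C s \<delta> S \<mu>)"
proof -
  obtain c where c: "c > 0" "\<And>\<U>. finite \<U> \<Longrightarrow> A \<subseteq> \<Union>\<U> \<Longrightarrow> (\<forall>U\<in>\<U>. bounded U) \<Longrightarrow>
     c \<le> (\<Sum>U\<in>\<U>. diameter U powr s)"
    using assms(2) unfolding pos_content_def by blast
  let ?n = "real DIM('a)"
  \<comment> \<open>A cell of level j has diameter at most \<open>?n / 2 ^ j\<close>, so the cover
    sum exceeds the mass of the cells by at most the factor \<open>?n powr s\<close>.\<close>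
  define c1 where "c1 = c / ?n powr s"
  have c1: "c1 > 0" using c by (simp add: c1_def)
  \<comment> \<open>The 1 is for radii \<open>t \<ge> 1\<close>, where the ball condition follows
    from total mass 1; the power of 5 counts the cells that can meet a smaller ball.\<close>
  define C where "C = max 1 (5 ^ DIM('a) / c1)"
  have "\<exists>S \<mu>. S \<subseteq> A \<and> frostman C s \<delta> S \<mu>" if \<delta>: "0 < \<delta>" for \<delta>
  proof -
    obtain k where k: "(1 / 2) ^ k < \<delta>" using real_arch_pow_inv[OF \<delta>, of "1 / 2"] by auto
    have fin: "finite (cell k ` A)" using finite_cells[OF assms(1)] by blast
    define rep where "rep v = (SOME a. a \<in> A \<and> cell k a = v)" for v
    define S where "S = rep ` (cell k ` A)"
    have rep: "rep v \<in> A \<and> cell k (rep v) = v" if "v \<in> cell k ` A" for v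
      unfolding rep_def by (rule someI_ex) (use that in auto)
    have finS: "finite S" using fin by (simp add: S_def)
    have SA: "S \<subseteq> A" using rep by (auto simp: S_def)
    have SR: "\<exists>p\<in>S. cell k p = cell k a" if "a \<in> A" for a
      using rep[of "cell k a"] that by (auto simp: S_def)
    define b where "b j = ((1 / 2) ^ j) powr s" for j :: nat
    have b0: "0 < b j" for j by (simp add: b_def)
    obtain w where w': "\<forall>p. 0 \<le> w p" "\<forall>j\<le>k. \<forall>v. sum w {p \<in> S. cell j p = v} \<le> b j"
      "\<forall>p\<in>S. \<exists>j\<le>k. sum w {q \<in> S. cell j q = cell j p} = b j"
      using greedy_saturation[where b = b and k = k and cell = cell, OF less_imp_le[OF b0] finS] by (elim exE conjE) (rule that)
    note w = w'[rule_format]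
    \<comment> \<open>The coarsest saturated level at p.\<close>
    define J where "J p = (LEAST j. j \<le> k \<and> sum w {q \<in> S. cell j q = cell j p} = b j)" for p
    have J: "J p \<le> k" "sum w {q \<in> S. cell (J p) q = cell (J p) p} = b (J p)" if "p \<in> S" for p
      using LeastI_ex[OF w(3)[OF that]] unfolding J_def by auto
    have Jle: "J p \<le> j" if "j \<le> k" "sum w {q \<in> S. cell j q = cell j p} = b j" for p j
      unfolding J_def using that by (intro Least_le) auto
    define T where "T = (\<lambda>p. (J p, cell (J p) p)) ` S"
    have finT: "finite T" using finS by (simp add: T_def)
    \<comment> \<open>Two selected cells with a common point are nested. The coarser one is
      saturated and contains the representative of the finer one, so minimality of \<open>J\<close>
      makes the levels, hence the cells, equal.\<close>
    have disj: "t = t'" if t: "t \<in> T" "t' \<in> T" and q: "cell (fst t) q = snd t" "cell (fst t') q = snd t'" for t t' and q :: 'a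
    proof -
      have "t = t'" if t: "t \<in> T" "t' \<in> T" and q: "cell (fst t) q = snd t" "cell (fst t') q = snd t'"
        and le: "fst t \<le> fst t'" for t t'
      proof -
        obtain p where p: "p \<in> S" "t = (J p, cell (J p) p)" using t(1) by (auto simp: T_def)
        obtain p' where p': "p' \<in> S" "t' = (J p', cell (J p') p')" using t(2) by (auto simp: T_def)
        have "cell (J p) q = cell (J p) p'"
          using cell_mono[of "J p" "J p'" q p'] le q(2) p p' by simp
        then have e: "cell (J p) p' = cell (J p) p" using q(1) p by simp
        have "J p' \<le> J p" by (rule Jle) (use J[OF p(1)] e in auto)
        then have "J p' = J p" using le p p' by simp
        then show ?thesis using p p' e by simp
      qed
      then show ?thesis using t q by (metis nle_le)
    qed
    let ?cov = "\<lambda>t. A \<inter> {x. cell (fst t) x = snd t}"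
    have "c \<le> (\<Sum>U\<in>?cov ` T. diameter U powr s)"
    proof (rule c(2))
      show "A \<subseteq> \<Union> (?cov ` T)"
      proof
        fix a assume a: "a \<in> A"
        then obtain p where p: "p \<in> S" "cell k p = cell k a" using SR by blast
        have "cell (J p) a = cell (J p) p" using cell_mono[OF J(1)[OF p(1)]] p(2) by metis
        then show "a \<in> \<Union> (?cov ` T)" using a p(1) by (force simp: T_def)
      qed
    qed (use finT cell_diameter(1) in auto)
    also have "\<dots> \<le> (\<Sum>t\<in>T. diameter (?cov t) powr s)"
      by (rule sum_image_le[OF finT, of "\<lambda>U. diameter U powr s" ?cov, unfolded o_def]) simp
    also have "\<dots> \<le> (\<Sum>t\<in>T. ?n powr s * b (fst t))"
    proof (rule sum_mono)
      fix t
      have "diameter (?cov t) powr s \<le> (?n / 2 ^ fst t) powr s"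
        using cell_diameter assms(3) by (intro powr_mono2 diameter_ge_0) auto
      also have "\<dots> = ?n powr s * b (fst t)"
      proof -
        have "?n / 2 ^ fst t = ?n * (1 / 2) ^ fst t" by (simp add: power_one_over)
        then show ?thesis by (simp only: b_def) (simp add: powr_mult)
      qed
      finally show "diameter (?cov t) powr s \<le> ?n powr s * b (fst t)" .
    qed
    also have "\<dots> = (\<Sum>t\<in>T. ?n powr s * sum w {q \<in> S. cell (fst t) q = snd t})"
      by (rule sum.cong[OF refl]) (use J in \<open>auto simp: T_def\<close>)
    also have "\<dots> = ?n powr s * (\<Sum>t\<in>T. sum w {q \<in> S. cell (fst t) q = snd t})"
      by (rule sum_distrib_left[symmetric])
    also have "(\<Sum>t\<in>T. sum w {q \<in> S. cell (fst t) q = snd t}) = sum w (\<Union>t\<in>T. {q \<in> S. cell (fst t) q = snd t})"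
      by (rule sum.UNION_disjoint[symmetric]) (use finT finS disj in auto)
    also have "?n powr s * \<dots> \<le> ?n powr s * sum w S"
      by (intro mult_left_mono sum_mono2 finS) (use w(1) in auto)
    finally have tot: "c1 \<le> sum w S" by (simp add: c1_def field_simps)
    then have pos: "0 < sum w S" using c1 by simp
    define \<mu> where "\<mu> p = w p / sum w S" for p
    have \<mu>sum: "sum \<mu> X = sum w X / sum w S" for X by (simp add: \<mu>_def sum_divide_distrib)
    have ball: "sum \<mu> (S \<inter> cball x t) \<le> C * t powr s" if t: "\<delta> \<le> t" for x t
    proof (cases "1 \<le> t")
      case True
      have "sum w (S \<inter> cball x t) \<le> sum w S" using w(1) finS by (intro sum_mono2) auto
      then have "sum \<mu> (S \<inter> cball x t) \<le> 1" unfolding \<mu>sum using pos by simp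
      also have "1 \<le> C * t powr s"
        using mult_mono[of 1 C 1 "t powr s"] True assms(3) by (simp add: C_def ge_one_powr_ge_zero)
      finally show ?thesis .
    next
      case False
      define j where "j = (LEAST j. (1 / 2 :: real) ^ j \<le> t)"
      have jt: "(1 / 2) ^ j \<le> t" unfolding j_def by (rule LeastI[of _ k]) (use k t in simp)
      have jk: "j \<le> k" unfolding j_def by (rule Least_le) (use k t in simp)
      have "j \<noteq> 0" using jt False by (intro notI) simp
      then obtain i where i: "j = Suc i" by (cases j) auto
      have "\<not> (1 / 2 :: real) ^ i \<le> t" using i unfolding j_def by (metis lessI not_less_Least)
      then have tj: "t < 2 * (1 / 2) ^ j" by (simp add: i)
      \<comment> \<open>The radius is below two side lengths of level j, so each integer coordinate
        of the label changes by at most 2: five possibilities.\<close>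
      let ?X = "PiE Basis (\<lambda>u. {cell j x u - 2..cell j x u + 2})"
      have finX: "finite ?X" by (intro finite_PiE) auto
      have sub: "S \<inter> cball x t \<subseteq> (\<Union>v\<in>?X. {p \<in> S. cell j p = v})"
      proof
        fix p assume p: "p \<in> S \<inter> cball x t"
        have "cell j p u \<in> {cell j x u - 2..cell j x u + 2}" if u: "u \<in> Basis" for u
        proof -
          have "\<bar>u \<bullet> (p - x)\<bar> \<le> norm (p - x)" using Basis_le_norm[OF u, of "p - x"] by (simp add: inner_commute)
          also have "\<dots> \<le> t" using p by (simp add: dist_norm norm_minus_commute)
          also note tj
          finally have "2 ^ j * \<bar>u \<bullet> (p - x)\<bar> < 2" by (simp add: field_simps power_one_over)
          then have "\<bar>2 ^ j * (u \<bullet> p) - 2 ^ j * (u \<bullet> x)\<bar> < 2"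
            by (simp add: inner_diff_right right_diff_distrib[symmetric] abs_mult)
          then show ?thesis unfolding cell_def using u
            floor_correct[of "2 ^ j * (u \<bullet> p)"] floor_correct[of "2 ^ j * (u \<bullet> x)"] by simp linarith
        qed
        moreover have "cell j p \<in> extensional Basis" by (simp add: cell_def)
        ultimately have "cell j p \<in> ?X" by (simp add: PiE_iff)
        then show "p \<in> (\<Union>v\<in>?X. {p \<in> S. cell j p = v})" using p by auto
      qed
      have "sum w (S \<inter> cball x t) \<le> sum w (\<Union>v\<in>?X. {p \<in> S. cell j p = v})"
        using finX finS w(1) by (intro sum_mono2[OF _ sub]) auto
      also have "\<dots> = (\<Sum>v\<in>?X. sum w {p \<in> S. cell j p = v})"
        by (rule sum.UNION_disjoint) (use finX finS in auto)
      also have "\<dots> \<le> (\<Sum>v\<in>?X. b j)" using w(2)[OF jk] by (intro sum_mono)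
      also have "\<dots> = 5 ^ DIM('a) * b j" by (simp add: card_PiE)
      also have "\<dots> \<le> 5 ^ DIM('a) * t powr s"
        unfolding b_def using jt assms(3) by (intro mult_left_mono powr_mono2) auto
      finally have "sum \<mu> (S \<inter> cball x t) \<le> 5 ^ DIM('a) * t powr s / sum w S"
        unfolding \<mu>sum using pos by (intro divide_right_mono) auto
      also have "\<dots> \<le> 5 ^ DIM('a) * t powr s / c1" using tot c1 by (intro divide_left_mono) auto
      also have "\<dots> \<le> C * t powr s" using mult_right_mono[of "5 ^ DIM('a) / c1" C "t powr s"] by (simp add: C_def)
      finally show ?thesis .
    qed
    have "frostman C s \<delta> S \<mu>"
      unfolding frostman_def using finS w(1) pos ball \<mu>sum[of S] by (auto simp: \<mu>_def)
    then show ?thesis using SA by blast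
  qed
  moreover have "0 \<le> C" by (simp add: C_def)
  ultimately show ?thesis by blast
qed

section \<open>Consequences of Fourier decay\<close>

text \<open>The Fejer kernel (sin(x/2) / (x/2))^2, written through its transform. It is nonnegative,
  and only frequencies up to 1 enter, so after rescaling only the frequencies for which decay is
  known are used.\<close>

definition fejer :: "real \<Rightarrow> real" where
  "fejer x = integral {0..1} (\<lambda>\<xi>. 2 * (1 - \<xi>) * cos (x * \<xi>))"

lemma fejer_integrable: "(\<lambda>\<xi>. 2 * (1 - \<xi>) * cos (x * \<xi>)) integrable_on {0..1::real}"
  by (intro integrable_continuous_real continuous_intros)

lemma fejer_eq: "x \<noteq> 0 \<Longrightarrow> fejer x = 2 * (1 - cos x) / x\<^sup>2"
proof -
  assume x: "x \<noteq> 0"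
  let ?F = "\<lambda>\<xi>. 2 * (1 - \<xi>) * sin (x * \<xi>) / x - 2 * cos (x * \<xi>) / x\<^sup>2"
  have "((\<lambda>\<xi>. 2 * (1 - \<xi>) * cos (x * \<xi>)) has_integral (?F 1 - ?F 0)) {0..1}"
  proof (rule fundamental_theorem_of_calculus)
    fix \<xi> :: real
    have "(?F has_real_derivative 2 * (1 - \<xi>) * cos (x * \<xi>)) (at \<xi>)"
      by (rule derivative_eq_intros refl | use x in \<open>simp add: field_simps power2_eq_square\<close>)+
    then show "(?F has_vector_derivative 2 * (1 - \<xi>) * cos (x * \<xi>)) (at \<xi> within {0..1})"
      unfolding has_real_derivative_iff_has_vector_derivative by (rule has_vector_derivative_at_within)
  qed simp
  then have "fejer x = ?F 1 - ?F 0" unfolding fejer_def by (rule integral_unique)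
  then show ?thesis by (simp add: diff_divide_distrib right_diff_distrib)
qed

text \<open>For |x| at most 1 < pi / 3 the cosine stays above 1/2, so the integrand dominates
  \<open>1 - \<xi>\<close>, whose integral is 1/2.\<close>

lemma fejer_near: "\<bar>x\<bar> \<le> 1 \<Longrightarrow> 1 / 2 \<le> fejer x"
proof -
  assume x: "\<bar>x\<bar> \<le> 1"
  have i: "((\<lambda>\<xi>. 1 - \<xi>) has_integral 1 / 2) {0..1::real}"
  proof -
    have "((\<lambda>\<xi>. 1 - \<xi>) has_integral ((1 - 1\<^sup>2 / 2) - (0 - 0\<^sup>2 / 2))) {0..1::real}"
      by (rule fundamental_theorem_of_calculus)
         (auto intro!: derivative_eq_intros simp: has_real_derivative_iff_has_vector_derivative[symmetric])
    then show ?thesis by simp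
  qed
  show ?thesis unfolding fejer_def
  proof (rule has_integral_le[OF i integrable_integral[OF fejer_integrable]])
    fix \<xi> :: real assume \<xi>: "\<xi> \<in> {0..1}"
    have "\<bar>x * \<xi>\<bar> \<le> 1 * 1" unfolding abs_mult using x \<xi> by (intro mult_mono) auto
    then have b: "\<bar>x * \<xi>\<bar> \<le> pi / 3" using pi_gt3 by simp
    have "1 / 2 = cos (pi / 3)" by (simp add: cos_60)
    also have "\<dots> \<le> cos \<bar>x * \<xi>\<bar>" using b pi_gt_zero by (intro cos_monotone_0_pi_le) auto
    finally have "1 / 2 \<le> cos (x * \<xi>)" by simp
    then have c: "1 \<le> 2 * cos (x * \<xi>)" by simp
    have "1 - \<xi> = (1 - \<xi>) * 1" by simp
    also have "\<dots> \<le> (1 - \<xi>) * (2 * cos (x * \<xi>))" using \<xi> by (intro mult_left_mono c) auto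
    also have "\<dots> = 2 * (1 - \<xi>) * cos (x * \<xi>)" by (simp only: mult_ac)
    finally show "1 - \<xi> \<le> 2 * (1 - \<xi>) * cos (x * \<xi>)" .
  qed
qed

lemma fejer_nonneg: "0 \<le> fejer x"
  by (cases "x = 0") (use fejer_near[of 0] in \<open>auto simp: fejer_eq\<close>)

lemma fejer_le: "x \<noteq> 0 \<Longrightarrow> fejer x \<le> 4 / x\<^sup>2"
proof -
  assume "x \<noteq> 0"
  moreover have "2 * (1 - y) \<le> 4" if "- 1 \<le> y" for y :: real using that by simp
  note this[OF cos_ge_minus_one[of x]]
  ultimately show ?thesis by (simp add: fejer_eq divide_right_mono)
qed

text \<open>A trivial bound below the cut c and a power bound above it. It is applied with
  \<open>e = 2 * b\<close> to squared transforms and with \<open>e = b\<close> to the transforms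
  themselves; excluding \<open>e = 1\<close> avoids a logarithm.\<close>

lemma integral_split_power_bound:
  fixes g :: "real \<Rightarrow> real"
  assumes "continuous_on {0..1} g" "0 < c" "c \<le> 1" "e \<noteq> 1"
    and low: "\<And>\<xi>. 0 \<le> \<xi> \<Longrightarrow> \<xi> \<le> c \<Longrightarrow> g \<xi> \<le> A"
    and high: "\<And>\<xi>. c \<le> \<xi> \<Longrightarrow> \<xi> \<le> 1 \<Longrightarrow> g \<xi> \<le> B * \<xi> powr (- e)"
  shows "integral {0..1} g \<le> A * c + B * ((1 - c powr (1 - e)) / (1 - e))"
proof -
  have int: "g integrable_on {0..1}" using assms(1) by (rule integrable_continuous_real)
  have "integral {0..c} g \<le> A * c"
  proof -
    have "integral {0..c} g \<le> integral {0..c} (\<lambda>_. A)"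
      using assms(3) low by (intro integral_le integrable_subinterval_real[OF int]) auto
    then show ?thesis using assms(2) by (simp add: mult.commute)
  qed
  moreover have "integral {c..1} g \<le> B * ((1 - c powr (1 - e)) / (1 - e))"
  proof -
    have "((\<lambda>\<xi>. B * \<xi> powr (- e)) has_integral (B * (1 powr (1 - e) / (1 - e)) - B * (c powr (1 - e) / (1 - e)))) {c..1}"
    proof (rule fundamental_theorem_of_calculus[OF assms(3)])
      fix \<xi> assume "\<xi> \<in> {c..1}"
      then have "\<xi> > 0" using assms(2) by auto
      then have "((\<lambda>\<xi>. B * (\<xi> powr (1 - e) / (1 - e))) has_real_derivative B * \<xi> powr (- e)) (at \<xi>)"
        using assms(4) by (auto intro!: derivative_eq_intros)
      then show "((\<lambda>\<xi>. B * (\<xi> powr (1 - e) / (1 - e))) has_vector_derivative B * \<xi> powr (- e)) (at \<xi> within {c..1})"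
        unfolding has_real_derivative_iff_has_vector_derivative by (rule has_vector_derivative_at_within)
    qed
    then have "integral {c..1} g \<le> B * (1 powr (1 - e) / (1 - e)) - B * (c powr (1 - e) / (1 - e))"
      using assms(2) high by (intro has_integral_le[OF integrable_integral[OF integrable_subinterval_real[OF int]]]) auto
    then show ?thesis by (simp add: diff_divide_distrib right_diff_distrib)
  qed
  moreover have "integral {0..1} g = integral {0..c} g + integral {c..1} g"
    using assms(2,3) int by (intro Henstock_Kurzweil_Integration.integral_combine[symmetric]) auto
  ultimately show ?thesis by simp
qed

section \<open>Fourier transforms and correlation sums of point masses\<close>

definition ft :: "real set \<Rightarrow> (real \<Rightarrow> real) \<Rightarrow> real \<Rightarrow> complex" where
  "ft Z \<tau> \<omega> = (\<Sum>t\<in>Z. of_real (\<tau> t) * cis (\<omega> * t))"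

definition prob_on :: "real set \<Rightarrow> (real \<Rightarrow> real) \<Rightarrow> bool" where
  "prob_on Z \<tau> \<longleftrightarrow> finite Z \<and> (\<forall>t\<in>Z. 0 \<le> \<tau> t) \<and> sum \<tau> Z = 1"

lemma ft_le_1: "prob_on Z \<tau> \<Longrightarrow> norm (ft Z \<tau> \<omega>) \<le> 1"
proof -
  assume p: "prob_on Z \<tau>"
  have "norm (ft Z \<tau> \<omega>) \<le> (\<Sum>t\<in>Z. norm (of_real (\<tau> t) * cis (\<omega> * t)))" unfolding ft_def by (rule norm_sum)
  also have "\<dots> = sum \<tau> Z" using p by (intro sum.cong) (auto simp: norm_mult prob_on_def)
  finally show ?thesis using p by (simp add: prob_on_def)
qed

lemma continuous_on_ft: "continuous_on S (\<lambda>\<xi>. ft Z \<tau> (k * \<xi>))"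
  unfolding ft_def cis_conv_exp by (intro continuous_intros)

lemma ft_norm_square: "(norm (ft Z \<tau> \<omega>))\<^sup>2 = (\<Sum>t\<in>Z. \<Sum>t'\<in>Z. \<tau> t * \<tau> t' * cos (\<omega> * (t - t')))"
proof -
  have "complex_of_real ((norm (ft Z \<tau> \<omega>))\<^sup>2) = ft Z \<tau> \<omega> * cnj (ft Z \<tau> \<omega>)" by (rule complex_norm_square)
  also have "\<dots> = (\<Sum>t\<in>Z. \<Sum>t'\<in>Z. of_real (\<tau> t * \<tau> t') * cis (\<omega> * (t - t')))"
    unfolding ft_def cnj_sum sum_product
  proof (intro sum.cong refl)
    fix t t'
    have "cis (\<omega> * (t - t')) = cis (\<omega> * t) * cnj (cis (\<omega> * t'))"
      by (simp add: cis_cnj cis_mult algebra_simps)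
    then show "of_real (\<tau> t) * cis (\<omega> * t) * cnj (of_real (\<tau> t') * cis (\<omega> * t')) =
        of_real (\<tau> t * \<tau> t') * cis (\<omega> * (t - t'))" by (simp add: mult_ac)
  qed
  finally have "Re (complex_of_real ((norm (ft Z \<tau> \<omega>))\<^sup>2)) = Re (\<Sum>t\<in>Z. \<Sum>t'\<in>Z. of_real (\<tau> t * \<tau> t') * cis (\<omega> * (t - t')))"
    by (rule arg_cong)
  then show ?thesis by (simp del: of_real_mult)
qed

text \<open>The correlation sum, a discrete stand-in both for the L2 norm of a density (when it is
  O(r)) and for the distribution function of the energy integral.\<close>

definition pairs :: "real set \<Rightarrow> (real \<Rightarrow> real) \<Rightarrow> real \<Rightarrow> real" where
  "pairs Z \<tau> r = (\<Sum>t\<in>Z. \<Sum>t'\<in>Z. if \<bar>t - t'\<bar> \<le> r then \<tau> t * \<tau> t' else 0)"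

lemma pairs_le_1: "prob_on Z \<tau> \<Longrightarrow> pairs Z \<tau> r \<le> 1"
proof -
  assume p: "prob_on Z \<tau>"
  have "pairs Z \<tau> r \<le> (\<Sum>t\<in>Z. \<Sum>t'\<in>Z. \<tau> t * \<tau> t')"
    unfolding pairs_def using p by (intro sum_mono) (auto simp: prob_on_def)
  also have "\<dots> = sum \<tau> Z * sum \<tau> Z" by (simp add: sum_product)
  finally show ?thesis using p by (simp add: prob_on_def)
qed

text \<open>The indicator of \<open>\<bar>t - t'\<bar> \<le> r\<close> is at most twice the Fejer
  kernel at scale r. Inserting its integral formula produces |ft|^2; the constant 4 is this 2 times
  the 2 in \<open>fejer\<close>.\<close>

lemma pairs_le_ft:
  assumes p: "prob_on Z \<tau>" and r: "0 < r"
  shows "pairs Z \<tau> r \<le> 4 * integral {0..1} (\<lambda>\<xi>. (norm (ft Z \<tau> (\<xi> / r)))\<^sup>2)"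
proof -
  have fin: "finite Z" and nn: "\<And>t t'. t \<in> Z \<Longrightarrow> t' \<in> Z \<Longrightarrow> 0 \<le> \<tau> t * \<tau> t'" using p by (auto simp: prob_on_def)
  have cont: "continuous_on {0..1} (\<lambda>\<xi>. (norm (ft Z \<tau> (\<xi> / r)))\<^sup>2)"
    using continuous_on_ft[of "{0..1}" Z \<tau> "1 / r"] by (auto intro!: continuous_intros)
  have "pairs Z \<tau> r \<le> (\<Sum>t\<in>Z. \<Sum>t'\<in>Z. 2 * (\<tau> t * \<tau> t' * fejer ((t - t') / r)))"
    unfolding pairs_def
  proof (intro sum_mono)
    fix t t' assume t: "t \<in> Z" "t' \<in> Z"
    show "(if \<bar>t - t'\<bar> \<le> r then \<tau> t * \<tau> t' else 0) \<le> 2 * (\<tau> t * \<tau> t' * fejer ((t - t') / r))"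
    proof (cases "\<bar>t - t'\<bar> \<le> r")
      case True
      then have "1 / 2 \<le> fejer ((t - t') / r)" using r by (intro fejer_near) simp
      from mult_left_mono[OF this nn[OF t]] show ?thesis using True by simp
    next
      case False
      then show ?thesis using nn[OF t] fejer_nonneg by simp
    qed
  qed
  also have "\<dots> = integral {0..1} (\<lambda>\<xi>. 4 * (1 - \<xi>) * (norm (ft Z \<tau> (\<xi> / r)))\<^sup>2)"
  proof -
    have "((\<lambda>\<xi>. \<Sum>t\<in>Z. \<Sum>t'\<in>Z. 2 * (\<tau> t * \<tau> t' * (2 * (1 - \<xi>) * cos ((t - t') / r * \<xi>)))) has_integral
       (\<Sum>t\<in>Z. \<Sum>t'\<in>Z. 2 * (\<tau> t * \<tau> t' * fejer ((t - t') / r)))) {0..1}"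
      unfolding fejer_def
      by (intro has_integral_sum fin has_integral_mult_right integrable_integral fejer_integrable)
    moreover have "(\<Sum>t\<in>Z. \<Sum>t'\<in>Z. 2 * (\<tau> t * \<tau> t' * (2 * (1 - \<xi>) * cos ((t - t') / r * \<xi>)))) =
        4 * (1 - \<xi>) * (norm (ft Z \<tau> (\<xi> / r)))\<^sup>2" for \<xi>
      unfolding ft_norm_square sum_distrib_left by (intro sum.cong refl) (simp add: mult_ac)
    ultimately show ?thesis by (simp add: integral_unique)
  qed
  also have "\<dots> \<le> integral {0..1} (\<lambda>\<xi>. 4 * (norm (ft Z \<tau> (\<xi> / r)))\<^sup>2)"
    by (intro integral_le integrable_continuous_real continuous_on_mult continuous_on_diff
        continuous_on_const continuous_on_id cont)
      (auto intro!: mult_right_mono)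
  also have "\<dots> = 4 * integral {0..1} (\<lambda>\<xi>. (norm (ft Z \<tau> (\<xi> / r)))\<^sup>2)" by simp
  finally show ?thesis .
qed

text \<open>The measure may change with the scale \<delta>, but \<open>D\<close> and
  \<open>b\<close> may not. This takes the place of one limiting measure on \<open>S\<close> with a
  decaying transform.\<close>

definition fourier_decay :: "real \<Rightarrow> real \<Rightarrow> real set \<Rightarrow> bool" where
  "fourier_decay D b S \<longleftrightarrow> (\<forall>\<delta>>0. \<exists>Z \<tau>. prob_on Z \<tau> \<and> Z \<subseteq> S \<and>
     (\<forall>\<omega>>0. \<omega> \<le> 1 / \<delta> \<longrightarrow> norm (ft Z \<tau> \<omega>) \<le> D * \<omega> powr (- b)))"

text \<open>In \<open>pairs_le_ft\<close> the transform is evaluated at \<open>\<xi> / r\<close>.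
  The cut at \<open>\<xi> = r\<close> is frequency 1: below it |ft| is at most 1, above it the decay
  applies, since \<open>\<xi> / r\<close> stays below \<open>1 / \<delta>\<close>. Whether the decay
  is square integrable decides the exponent.\<close>

lemma pairs_decay:
  assumes p: "prob_on Z \<tau>" and \<delta>: "0 < \<delta>" and D: "0 \<le> D" and b: "0 < b" "2 * b \<noteq> 1"
    and dec: "\<And>\<omega>. 0 < \<omega> \<Longrightarrow> \<omega> \<le> 1 / \<delta> \<Longrightarrow> norm (ft Z \<tau> \<omega>) \<le> D * \<omega> powr (- b)"
    and r: "\<delta> \<le> r"
  shows "pairs Z \<tau> r \<le> (4 + 4 * D\<^sup>2 / \<bar>1 - 2 * b\<bar>) * r powr (min 1 (2 * b))"
proof -
  let ?C = "4 + 4 * D\<^sup>2 / \<bar>1 - 2 * b\<bar>"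
  have r0: "0 < r" using \<delta> r by simp
  show ?thesis
  proof (cases "1 \<le> r")
    case True
    have "1 * 1 \<le> ?C * r powr (min 1 (2 * b))"
      using True b by (intro mult_mono ge_one_powr_ge_zero) auto
    then show ?thesis using pairs_le_1[OF p, of r] by simp
  next
    case False
    let ?g = "\<lambda>\<xi>. (norm (ft Z \<tau> (\<xi> / r)))\<^sup>2"
    have "integral {0..1} ?g \<le> 1 * r + (D\<^sup>2 * r powr (2 * b)) * ((1 - r powr (1 - 2 * b)) / (1 - 2 * b))"
    proof (rule integral_split_power_bound)
      show "continuous_on {0..1} ?g"
        using continuous_on_ft[of "{0..1}" Z \<tau> "1 / r"] by (auto intro!: continuous_intros)
      show "?g \<xi> \<le> 1" for \<xi> using ft_le_1[OF p, of "\<xi> / r"] by (simp add: power_le_one)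
      show "?g \<xi> \<le> D\<^sup>2 * r powr (2 * b) * \<xi> powr (- (2 * b))" if "r \<le> \<xi>" "\<xi> \<le> 1" for \<xi>
      proof -
        have x0: "0 < \<xi>" using that r0 by simp
        have "\<xi> / r \<le> 1 / \<delta>" using that r \<delta> r0 by (intro frac_le) auto
        then have "norm (ft Z \<tau> (\<xi> / r)) \<le> D * (\<xi> / r) powr (- b)" using x0 r0 by (intro dec) auto
        then have "?g \<xi> \<le> (D * (\<xi> / r) powr (- b))\<^sup>2" by (intro power_mono) auto
        also have "\<dots> = D\<^sup>2 * r powr (2 * b) * \<xi> powr (- (2 * b))"
        proof -
          have "((\<xi> / r) powr (- b))\<^sup>2 = (\<xi> / r) powr (- (2 * b))"
            by (simp add: power2_eq_square powr_add[symmetric])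
          also have "\<dots> = \<xi> powr (- (2 * b)) * r powr (2 * b)"
            using x0 r0 by (simp add: powr_divide powr_minus_divide)
          finally show ?thesis by (simp add: power_mult_distrib)
        qed
        finally show ?thesis .
      qed
    qed (use r0 False b in auto)
    also have "\<dots> \<le> (1 + D\<^sup>2 / \<bar>1 - 2 * b\<bar>) * r powr (min 1 (2 * b))"
    proof (cases "2 * b < 1")
      case True
      have "r \<le> r powr (2 * b)" using powr_mono'[of "2 * b" 1 r] True r0 False by simp
      moreover have "(D\<^sup>2 * r powr (2 * b)) * ((1 - r powr (1 - 2 * b)) / (1 - 2 * b)) \<le>
          (D\<^sup>2 * r powr (2 * b)) * (1 / (1 - 2 * b))"
        using True by (intro mult_left_mono divide_right_mono) auto
      ultimately show ?thesis using True by (simp add: algebra_simps)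
    next
      case F: False
      then have gt: "1 < 2 * b" using b by simp
      have "(D\<^sup>2 * r powr (2 * b)) * ((1 - r powr (1 - 2 * b)) / (1 - 2 * b)) =
          D\<^sup>2 / (2 * b - 1) * (r powr (2 * b) * r powr (1 - 2 * b) - r powr (2 * b))"
        using gt by (simp add: field_simps)
      also have "r powr (2 * b) * r powr (1 - 2 * b) = r" using r0 by (simp add: powr_add[symmetric])
      also have "D\<^sup>2 / (2 * b - 1) * (r - r powr (2 * b)) \<le> D\<^sup>2 / (2 * b - 1) * r"
        using gt by (intro mult_left_mono) auto
      finally show ?thesis using gt r0 by (simp add: algebra_simps)
    qed
    finally have "4 * integral {0..1} ?g \<le> ?C * r powr (min 1 (2 * b))" by (simp add: algebra_simps)
    then show ?thesis using pairs_le_ft[OF p r0] by simp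
  qed
qed

text \<open>Cauchy-Schwarz for the masses of the grid intervals: their sum is 1, and the sum of
  their squares is at most \<open>pairs\<close>, because two points of one interval are at distance
  at most r.\<close>

lemma card_grid_ge:
  assumes p: "prob_on Z \<tau>" and r: "0 < r"
  shows "1 \<le> real (card ((\<lambda>t. \<lfloor>t / r\<rfloor>) ` Z)) * pairs Z \<tau> r"
proof -
  let ?c = "\<lambda>t. \<lfloor>t / r\<rfloor>"
  have fin: "finite Z" and nn: "\<And>t. t \<in> Z \<Longrightarrow> 0 \<le> \<tau> t" and s1: "sum \<tau> Z = 1" using p by (auto simp: prob_on_def)
  let ?m = "\<lambda>k. sum \<tau> {t \<in> Z. ?c t = k}"
  have "1 = (\<Sum>k\<in>?c ` Z. ?m k)\<^sup>2"
    using sum.image_gen[OF fin, of \<tau> ?c] s1 by simp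
  also have "\<dots> \<le> real (card (?c ` Z)) * (\<Sum>k\<in>?c ` Z. (?m k)\<^sup>2)"
    using Cauchy_Schwarz_ineq_sum[of "\<lambda>_. 1" ?m "?c ` Z"] by simp
  also have "(\<Sum>k\<in>?c ` Z. (?m k)\<^sup>2) \<le> pairs Z \<tau> r"
  proof -
    have "(\<Sum>k\<in>?c ` Z. (?m k)\<^sup>2) = (\<Sum>k\<in>?c ` Z. \<Sum>t\<in>{t \<in> Z. ?c t = k}. \<tau> t * ?m (?c t))"
      by (intro sum.cong refl) (simp add: power2_eq_square sum_distrib_right)
    also have "\<dots> = (\<Sum>t\<in>Z. \<tau> t * ?m (?c t))" by (rule sum.image_gen[OF fin, symmetric])
    also have "\<dots> \<le> pairs Z \<tau> r"
      unfolding pairs_def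
    proof (rule sum_mono)
      fix t assume t: "t \<in> Z"
      have "\<tau> t * ?m (?c t) = (\<Sum>t'\<in>Z. if ?c t' = ?c t then \<tau> t * \<tau> t' else 0)"
        using fin by (simp add: sum_distrib_left sum.inter_filter if_distrib[of "(*) (\<tau> t)"] cong: if_cong)
      also have "\<dots> \<le> (\<Sum>t'\<in>Z. if \<bar>t - t'\<bar> \<le> r then \<tau> t * \<tau> t' else 0)"
      proof (rule sum_mono)
        fix t' assume t': "t' \<in> Z"
        have "\<bar>t - t'\<bar> \<le> r" if "?c t' = ?c t"
        proof -
          have "\<bar>t / r - t' / r\<bar> \<le> 1"
            using that floor_correct[of "t / r"] floor_correct[of "t' / r"] by linarith
          then show ?thesis using r by (simp add: diff_divide_distrib[symmetric])
        qed
        then show "(if ?c t' = ?c t then \<tau> t * \<tau> t' else 0) \<le> (if \<bar>t - t'\<bar> \<le> r then \<tau> t * \<tau> t' else 0)"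
          using nn[OF t] nn[OF t'] by auto
      qed
      finally show "\<tau> t * ?m (?c t) \<le> (\<Sum>t'\<in>Z. if \<bar>t - t'\<bar> \<le> r then \<tau> t * \<tau> t' else 0)" .
    qed
    finally show ?thesis .
  qed
  finally show ?thesis by (simp add: mult_left_mono)
qed

section \<open>Positive measure\<close>

text \<open>If \<open>S\<close> were null, it would have an open neighbourhood of measure below
  \<open>1 / C\<close>, containing all e-balls about \<open>S\<close>. At scale e the correlation
  sum is at most \<open>C * e\<close>, so at least \<open>1 / (C * e)\<close> grid intervals meet
  the masses; they lie in the neighbourhood and have total length at least
  \<open>1 / C\<close>.\<close>

lemma fourier_decay_measure_pos:
  assumes dec: "fourier_decay D b S" and "compact S" "0 \<le> D" "1 < 2 * b"
  shows "0 < emeasure lborel S"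
proof (rule ccontr)
  assume "\<not> ?thesis"
  then have null: "emeasure lborel S = 0" by (simp add: not_gr_zero)
  define C where "C = 4 + 4 * D\<^sup>2 / \<bar>1 - 2 * b\<bar>"
  have C: "C > 0" using assms by (simp add: C_def add_pos_nonneg)
  have borel: "S \<in> sets borel" using assms(2) by (simp add: borel_compact)
  obtain U where U: "open U" "S \<subseteq> U" "emeasure lborel (U - S) < ennreal (1 / C)"
    using outer_regular_lborel[OF borel, of "1 / C"] C by auto
  have eU: "emeasure lborel U < ennreal (1 / C)"
  proof -
    have "emeasure lborel U \<le> emeasure lborel (U - S) + emeasure lborel S"
      using emeasure_subadditive[of "U - S" lborel S] U borel by (simp add: Un_absorb2)
    then show ?thesis using U(3) null by simp
  qed
  obtain e where e: "e > 0" "(\<Union>x\<in>S. cball x e) \<subseteq> U"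
    using compact_subset_open_imp_cball_epsilon_subset[OF assms(2) U(1,2)] by blast
  obtain Z \<tau> where Z: "prob_on Z \<tau>" "Z \<subseteq> S"
    "\<And>\<omega>. 0 < \<omega> \<Longrightarrow> \<omega> \<le> 1 / e \<Longrightarrow> norm (ft Z \<tau> \<omega>) \<le> D * \<omega> powr (- b)"
    using dec e(1) unfolding fourier_decay_def by blast
  have "pairs Z \<tau> e \<le> C * e powr (min 1 (2 * b))"
    unfolding C_def by (rule pairs_decay[OF Z(1) e(1) assms(3) _ _ Z(3)]) (use assms in auto)
  also have "\<dots> = C * e" using assms(4) e(1) by simp
  finally have pr: "pairs Z \<tau> e \<le> C * e" .
  let ?c = "\<lambda>t. \<lfloor>t / e\<rfloor>" and ?I = "\<lambda>k::int. {of_int k * e..<of_int (k + 1) * e}"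
  have fin: "finite (?c ` Z)" using Z(1) by (simp add: prob_on_def)
  have "1 \<le> real (card (?c ` Z)) * (C * e)"
    using card_grid_ge[OF Z(1) e(1)] mult_left_mono[OF pr, of "real (card (?c ` Z))"] by linarith
  then have ge: "1 / C \<le> real (card (?c ` Z)) * e" using C by (simp add: field_simps)
  have "ennreal (real (card (?c ` Z)) * e) = (\<Sum>k\<in>?c ` Z. emeasure lborel (?I k))"
  proof -
    have "emeasure lborel (?I k) = ennreal e" for k using e(1) by (simp add: algebra_simps)
    then show ?thesis using e(1) by (simp add: ennreal_mult' ennreal_of_nat_eq_real_of_nat)
  qed
  also have "\<dots> = emeasure lborel (\<Union>k\<in>?c ` Z. ?I k)"
  proof (rule sum_emeasure[OF _ _ fin])
    show "disjoint_family_on ?I (?c ` Z)"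
    proof (unfold disjoint_family_on_def, intro ballI impI)
      fix k l :: int assume "k \<noteq> l"
      have "\<lfloor>x / e\<rfloor> = k" if "x \<in> ?I k" for x k
        using that e(1) by (intro floor_unique) (auto simp: field_simps)
      then show "?I k \<inter> ?I l = {}" using \<open>k \<noteq> l\<close> by blast
    qed
  qed auto
  also have "\<dots> \<le> emeasure lborel U"
  proof (rule emeasure_mono)
    show "(\<Union>k\<in>?c ` Z. ?I k) \<subseteq> U"
    proof
      fix x assume "x \<in> (\<Union>k\<in>?c ` Z. ?I k)"
      then obtain t where t: "t \<in> Z" "x \<in> ?I (?c t)" by auto
      have f: "of_int \<lfloor>t / e\<rfloor> * e \<le> t" "t < of_int (\<lfloor>t / e\<rfloor> + 1) * e"
        using floor_correct[of "t / e", unfolded pos_le_divide_eq[OF e(1)] pos_divide_less_eq[OF e(1)]] by blast+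
      have "of_int (\<lfloor>t / e\<rfloor> + 1) * e = of_int \<lfloor>t / e\<rfloor> * e + e" by (simp add: algebra_simps)
      then have "\<bar>t - x\<bar> \<le> e" using f t(2) unfolding atLeastLessThan_iff by linarith
      then have "x \<in> cball t e" by (simp add: dist_real_def)
      then show "x \<in> U" using t(1) Z(2) e(2) by blast
    qed
  qed (use U(1) in simp)
  finally have "ennreal (1 / C) \<le> emeasure lborel U" using ge ennreal_leI order_trans by blast
  then show False using eU by simp
qed

section \<open>Hausdorff dimension\<close>

text \<open>The counterpart of \<open>far_field_sum\<close> for a < \<beta>: the layers now decrease
  from the largest radius down, so the bound depends on \<open>T\<close> and not on
  \<delta>.\<close>

lemma near_field_sum:
  fixes d w :: "'q \<Rightarrow> real"
  assumes "finite R" "\<And>q. q \<in> R \<Longrightarrow> 0 \<le> w q" "0 < \<delta>" "\<delta> \<le> T" "0 \<le> a" "a < \<beta>" "0 \<le> C"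
    and T: "\<And>q. q \<in> R \<Longrightarrow> d q \<le> T"
    and B: "\<And>t. \<delta> \<le> t \<Longrightarrow> sum w {q \<in> R. d q \<le> t} \<le> C * t powr \<beta>"
  shows "(\<Sum>q\<in>R. w q * max (d q) \<delta> powr (- a)) \<le> 2 powr a * C * (2 * T) powr (\<beta> - a) / (1 - 2 powr (a - \<beta>))"
proof -
  define h where "h = \<beta> - a"
  have h: "h > 0" using assms by (simp add: h_def)
  define q where "q = 2 powr (- h)"
  have q: "0 < q" "q < 1" using h powr_less_mono[of "- h" 0 2] by (auto simp: q_def)
  define J where "J = (LEAST J. T \<le> 2 ^ J * \<delta>)"
  have ex: "\<exists>J. T \<le> 2 ^ J * \<delta>"
  proof -
    obtain J where "T / \<delta> < 2 ^ J" using real_arch_pow[of 2 "T / \<delta>"] by auto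
    then show ?thesis using assms(3) by (intro exI[of _ J]) (simp add: field_simps)
  qed
  have TJ: "T \<le> 2 ^ J * \<delta>" unfolding J_def by (rule LeastI_ex[OF ex])
  have JT: "2 ^ J * \<delta> \<le> 2 * T"
  proof (cases J)
    case 0
    then show ?thesis using assms(3,4) by simp
  next
    case (Suc i)
    then have "\<not> T \<le> 2 ^ i * \<delta>" unfolding J_def by (metis lessI not_less_Least)
    then show ?thesis using Suc by simp
  qed
  have "(\<Sum>q\<in>R. w q * max (d q) \<delta> powr (- a)) \<le> (\<Sum>j\<le>J. 2 powr a * (2 ^ j * \<delta>) powr (- a) * (C * (2 ^ j * \<delta>) powr \<beta>))"
  proof (rule dyadic_layer_sum[OF assms(1-3,5)])
    show "d q \<le> 2 ^ J * \<delta>" if "q \<in> R" for q using T[OF that] TJ by simp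
    show "sum w {q \<in> R. d q \<le> 2 ^ j * \<delta>} \<le> C * (2 ^ j * \<delta>) powr \<beta>" for j
      using assms(3) by (intro B) simp
  qed
  also have "\<dots> = 2 powr a * C * (2 ^ J * \<delta>) powr h * (\<Sum>j\<le>J. q ^ (J - j))"
    unfolding sum_distrib_left
  proof (rule sum.cong[OF refl])
    fix j assume j: "j \<in> {..J}"
    have "(2 ^ j * \<delta>) powr (- a) * (2 ^ j * \<delta>) powr \<beta> = (2 ^ j * \<delta>) powr h"
      by (simp add: powr_add[symmetric] h_def)
    also have "\<dots> = (2 ^ J * \<delta>) powr h * q ^ (J - j)"
    proof -
      have "(2 ^ J * \<delta>) powr h = (2 powr h) ^ j * (2 powr h) ^ (J - j) * \<delta> powr h"
        using powr_pow2[OF assms(3), of J h] j by (simp add: power_add[symmetric])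
      moreover have "(2 powr h) ^ (J - j) * q ^ (J - j) = 1"
        unfolding q_def power_mult_distrib[symmetric] by (simp add: powr_add[symmetric])
      ultimately show ?thesis using powr_pow2[OF assms(3), of j h] by (simp add: mult_ac)
    qed
    finally show "2 powr a * (2 ^ j * \<delta>) powr (- a) * (C * (2 ^ j * \<delta>) powr \<beta>) =
        2 powr a * C * (2 ^ J * \<delta>) powr h * q ^ (J - j)" by (simp add: mult_ac)
  qed
  also have "(\<Sum>j\<le>J. q ^ (J - j)) = (\<Sum>j\<le>J. q ^ j)"
    by (rule sum.reindex_bij_witness[of _ "\<lambda>j. J - j" "\<lambda>j. J - j"]) auto
  also have "2 powr a * C * (2 ^ J * \<delta>) powr h * (\<Sum>j\<le>J. q ^ j) \<le> 2 powr a * C * (2 * T) powr h * (1 / (1 - q))"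
  proof (intro mult_mono mult_left_mono)
    show "(2 ^ J * \<delta>) powr h \<le> (2 * T) powr h" using JT assms(3) h by (intro powr_mono2) auto
    have "(\<Sum>j\<le>J. q ^ j) = (1 - q ^ Suc J) / (1 - q)" using q by (subst sum_gp0) auto
    also have "\<dots> \<le> 1 / (1 - q)" using q by (intro divide_right_mono) auto
    finally show "(\<Sum>j\<le>J. q ^ j) \<le> 1 / (1 - q)" .
  qed (use assms q in \<open>auto intro!: sum_nonneg\<close>)
  finally show ?thesis by (simp add: h_def q_def)
qed

text \<open>The s-energy, truncated at \<delta>, is bounded independently of \<delta>. The mass m of
  a covering ball of radius r satisfies m^2 <= (2 r)^s times the energy inside the ball, and
  Cauchy-Schwarz over the balls turns total mass 1 into a lower bound for the cover sum.\<close>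

lemma energy_cover_bound:
  assumes dec: "fourier_decay D b S" and D: "0 \<le> D" and b: "0 < s" "s < 2 * b" "2 * b < 1"
    and T: "\<And>x y. x \<in> S \<Longrightarrow> y \<in> S \<Longrightarrow> \<bar>x - y\<bar> \<le> T" "1 \<le> T"
  shows "\<exists>c>0. \<forall>I x r. finite (I :: 'i set) \<longrightarrow> (\<forall>i\<in>I. 0 < r i) \<longrightarrow> S \<subseteq> (\<Union>i\<in>I. ball (x i) (r i)) \<longrightarrow>
     c \<le> (\<Sum>i\<in>I. (2 * r i) powr s)"
proof -
  define C where "C = 4 + 4 * D\<^sup>2 / \<bar>1 - 2 * b\<bar>"
  have C: "C > 0" by (simp add: C_def add_pos_nonneg)
  define E where "E = 2 powr s * C * (2 * T) powr (2 * b - s) / (1 - 2 powr (s - 2 * b))"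
  have E: "E > 0" unfolding E_def using C T(2) b powr_less_mono[of "s - 2 * b" 0 2] by simp
  have "1 / E \<le> (\<Sum>i\<in>I. (2 * r i) powr s)"
    if fin: "finite I" and r: "\<forall>i\<in>I. 0 < r i" and cov: "S \<subseteq> (\<Union>i\<in>I. ball (x i) (r i))" for I :: "'i set" and x r
  proof -
    \<comment> \<open>Below all radii, so that the truncated distance of two points of one ball is
      at most its diameter bound; below 1 as well, so that it does not exceed
      \<open>T\<close>.\<close>
    define \<delta> where "\<delta> = Min (insert 1 (r ` I))"
    have \<delta>: "0 < \<delta>" "\<delta> \<le> 1" "\<And>i. i \<in> I \<Longrightarrow> \<delta> \<le> r i"
      unfolding \<delta>_def using fin r by auto
    obtain Z \<tau> where Z: "prob_on Z \<tau>" "Z \<subseteq> S"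
      "\<And>\<omega>. 0 < \<omega> \<Longrightarrow> \<omega> \<le> 1 / \<delta> \<Longrightarrow> norm (ft Z \<tau> \<omega>) \<le> D * \<omega> powr (- b)"
      using dec \<delta>(1) unfolding fourier_decay_def by blast
    have finZ: "finite Z" and nn: "\<And>t. t \<in> Z \<Longrightarrow> 0 \<le> \<tau> t" and s1: "sum \<tau> Z = 1" using Z(1) by (auto simp: prob_on_def)
    let ?k = "\<lambda>t t'. max \<bar>t - t'\<bar> \<delta> powr (- s)"
    have energy: "(\<Sum>t\<in>Z. \<Sum>t'\<in>Z. \<tau> t * \<tau> t' * ?k t t') \<le> E"
    proof -
      let ?w = "\<lambda>q. \<tau> (fst q) * \<tau> (snd q)" and ?d = "\<lambda>q. \<bar>fst q - snd q :: real\<bar>"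
      have "(\<Sum>q\<in>Z \<times> Z. ?w q * max (?d q) \<delta> powr (- s)) \<le> E"
        unfolding E_def
      proof (rule near_field_sum)
        show "sum ?w {q \<in> Z \<times> Z. ?d q \<le> t} \<le> C * t powr (2 * b)" if "\<delta> \<le> t" for t
        proof -
          have "sum ?w {q \<in> Z \<times> Z. ?d q \<le> t} = pairs Z \<tau> t"
            unfolding pairs_def sum.cartesian_product using finZ
            by (subst sum.inter_filter) (auto simp: case_prod_beta' intro!: sum.cong)
          also have "\<dots> \<le> C * t powr (min 1 (2 * b))"
            unfolding C_def by (rule pairs_decay[OF Z(1) \<delta>(1) D _ _ Z(3) that]) (use b in auto)
          finally show ?thesis using b by simp
        qed
        show "?d q \<le> T" if "q \<in> Z \<times> Z" for q using that Z(2) by (intro T(1)) auto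
        show "\<delta> \<le> T" using \<delta>(2) T(2) by simp
      qed (use finZ nn \<delta>(1) b C in auto)
      then show ?thesis unfolding sum.cartesian_product by (simp add: case_prod_beta')
    qed
    have "\<exists>i\<in>I. t \<in> ball (x i) (r i)" if "t \<in> Z" for t using that Z(2) cov by blast
    then obtain idx where idx: "\<And>t. t \<in> Z \<Longrightarrow> idx t \<in> I \<and> t \<in> ball (x (idx t)) (r (idx t))" by metis
    let ?f = "\<lambda>i. {t \<in> Z. idx t = i}"
    let ?a = "\<lambda>i. (2 * r i) powr s"
    \<comment> \<open>The inner range is written \<open>?f (idx t)\<close>, which equals
      \<open>?f i\<close> here, so that the summand does not mention i and the sum over i collapses
      to a sum over \<open>Z\<close>.\<close>
    let ?E = "\<lambda>i. \<Sum>t\<in>?f i. \<Sum>t'\<in>?f (idx t). \<tau> t * \<tau> t' * ?k t t'"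
    have E0: "0 \<le> ?E i" for i using nn by (intro sum_nonneg) auto
    have m: "sum \<tau> (?f i) \<le> sqrt (?a i) * sqrt (?E i)" for i
    proof -
      have "(sum \<tau> (?f i))\<^sup>2 = (\<Sum>t\<in>?f i. \<Sum>t'\<in>?f (idx t). \<tau> t * \<tau> t')"
        by (simp add: power2_eq_square sum_product)
      also have "\<dots> \<le> (\<Sum>t\<in>?f i. \<Sum>t'\<in>?f (idx t). \<tau> t * \<tau> t' * (?a i * ?k t t'))"
      proof (intro sum_mono)
        fix t t' assume t: "t \<in> ?f i" "t' \<in> ?f (idx t)"
        have "dist (x i) t < r i" "dist (x i) t' < r i" using idx[of t] idx[of t'] t by auto
        then have "\<bar>t - t'\<bar> \<le> 2 * r i" unfolding dist_real_def by linarith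
        moreover have "i \<in> I" using idx t by auto
        ultimately have le: "max \<bar>t - t'\<bar> \<delta> \<le> 2 * r i" "0 < r i" using \<delta>(3)[of i] r by auto
        have "1 = ?a i * (2 * r i) powr (- s)" using le(2) by (simp add: powr_add[symmetric])
        also have "\<dots> \<le> ?a i * ?k t t'"
          using le \<delta>(1) b(1) by (intro mult_left_mono powr_mono2') auto
        finally show "\<tau> t * \<tau> t' \<le> \<tau> t * \<tau> t' * (?a i * ?k t t')"
          using nn t mult_left_mono[of 1 "?a i * ?k t t'" "\<tau> t * \<tau> t'"] by simp
      qed
      also have "\<dots> = ?a i * ?E i"
        unfolding sum_distrib_left by (intro sum.cong refl) (simp add: mult_ac)
      also have "\<dots> = (sqrt (?a i) * sqrt (?E i))\<^sup>2" using E0 by (simp add: power_mult_distrib)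
      finally show ?thesis using E0 by (rule_tac power2_le_imp_le) auto
    qed
    have "1 = (\<Sum>i\<in>idx ` Z. sum \<tau> (?f i))" using sum.image_gen[OF finZ, of \<tau> idx] s1 by simp
    also have "\<dots> \<le> (\<Sum>i\<in>idx ` Z. sqrt (?a i) * sqrt (?E i))" using m by (rule sum_mono)
    finally have "1 \<le> (\<Sum>i\<in>idx ` Z. sqrt (?a i) * sqrt (?E i))\<^sup>2" by (simp add: power2_eq_square mult_ge1_I)
    also have "\<dots> \<le> (\<Sum>i\<in>idx ` Z. (sqrt (?a i))\<^sup>2) * (\<Sum>i\<in>idx ` Z. (sqrt (?E i))\<^sup>2)"
      by (rule Cauchy_Schwarz_ineq_sum)
    also have "\<dots> = (\<Sum>i\<in>idx ` Z. ?a i) * (\<Sum>i\<in>idx ` Z. ?E i)" using E0 by simp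
    also have "\<dots> \<le> (\<Sum>i\<in>I. ?a i) * E"
    proof (rule mult_mono)
      show "(\<Sum>i\<in>idx ` Z. ?a i) \<le> (\<Sum>i\<in>I. ?a i)" using idx by (intro sum_mono2 fin) auto
      have "(\<Sum>i\<in>idx ` Z. ?E i) = (\<Sum>t\<in>Z. \<Sum>t'\<in>?f (idx t). \<tau> t * \<tau> t' * ?k t t')"
        by (rule sum.image_gen[OF finZ, symmetric])
      also have "\<dots> \<le> (\<Sum>t\<in>Z. \<Sum>t'\<in>Z. \<tau> t * \<tau> t' * ?k t t')"
        using finZ nn by (intro sum_mono sum_mono2) auto
      finally show "(\<Sum>i\<in>idx ` Z. ?E i) \<le> E" using energy by linarith
      show "0 \<le> (\<Sum>i\<in>I. ?a i)" by (intro sum_nonneg) auto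
      show "0 \<le> (\<Sum>i\<in>idx ` Z. ?E i)" by (intro sum_nonneg E0)
    qed
    finally show ?thesis using E by (simp add: field_simps)
  qed
  then show ?thesis using E by (intro exI[of _ "1 / E"]) auto
qed

text \<open>Replaces the countable cover by arbitrary sets in the definition of Hausdorff measure by
  finitely many open balls. Diameters at most 1 allow passing from \<open>s0\<close> to the larger
  exponent s; positivity of s disposes of sets of diameter 0.\<close>

lemma hausdorff_null_cover:
  fixes S :: "real set"
  assumes "compact S" "0 \<le> s0" "hausdorff_measure s0 S = 0" "s0 \<le> s" "0 < s" "0 < \<epsilon>"
  shows "\<exists>(I :: nat set) x r. finite I \<and> (\<forall>i\<in>I. 0 < r i) \<and> S \<subseteq> (\<Union>i\<in>I. ball (x i) (r i)) \<and>
     (\<Sum>i\<in>I. r i powr s) \<le> 2 * \<epsilon>"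
proof -
  have "hausdorff_premeasure s0 1 S \<le> hausdorff_measure s0 S"
    unfolding hausdorff_measure_def by (rule SUP_upper) simp
  then have "hausdorff_premeasure s0 1 S < ennreal \<epsilon>" using assms(3,6) by simp
  then obtain V where V: "S \<subseteq> (\<Union>i. V i)" "\<And>i. bounded (V i)" "\<And>i. diameter (V i) \<le> 1"
      "(\<Sum>i. diam_power s0 (V i)) < ennreal \<epsilon>"
    unfolding hausdorff_premeasure_def INF_less_iff by auto
  define a where "a i = diameter (V i) powr s" for i
  have a0: "0 \<le> a i" for i by (simp add: a_def)
  have ap: "ennreal (a i) \<le> diam_power s0 (V i)" for i
  proof (cases "V i = {} \<or> diameter (V i) = 0")
    case True
    then have "a i = 0" by (auto simp: a_def)
    then show ?thesis by simp
  next
    case False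
    then have d: "0 < diameter (V i)" using diameter_ge_0[OF V(2), of i] by linarith
    show ?thesis
    proof (cases "s0 = 0")
      case True
      have "a i \<le> 1" unfolding a_def using d V(3)[of i] assms(5) by (intro powr_le1) auto
      then show ?thesis using False True by (simp add: diam_power_def)
    next
      case s0: False
      have "a i \<le> diameter (V i) powr s0" unfolding a_def using d V(3)[of i] assms(4) by (intro powr_mono') auto
      then show ?thesis using False s0 by (simp add: diam_power_def ennreal_leI)
    qed
  qed
  \<comment> \<open>Slightly more than the diameter, so that an open ball about a point of the set
    contains it. The excess in \<open>r powr s\<close> is summable to \<epsilon>, whence the total
    \<open>2 * \<epsilon>\<close>.\<close>
  define r where "r i = (a i + \<epsilon> * (1 / 2) ^ Suc i) powr (1 / s)" for i
  have base: "0 < a i + \<epsilon> * (1 / 2) ^ Suc i" for i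
    using a0[of i] assms(6) by (intro add_nonneg_pos mult_pos_pos) auto
  have r0: "0 < r i" for i unfolding r_def powr_gt_zero using base[of i] by linarith
  have rs: "r i powr s = a i + \<epsilon> * (1 / 2) ^ Suc i" for i
    unfolding r_def using base[of i] assms(5) by (simp add: powr_powr del: power_Suc)
  have dr: "diameter (V i) < r i" for i
  proof (rule ccontr)
    assume "\<not> ?thesis"
    then have "r i powr s \<le> diameter (V i) powr s" using r0[of i] assms(5) by (intro powr_mono2) auto
    moreover have "0 < \<epsilon> * (1 / 2) ^ Suc i" using assms(6) by (intro mult_pos_pos) auto
    ultimately show False unfolding rs a_def by linarith
  qed
  define x where "x i = (SOME y. y \<in> V i)" for i
  have x: "x i \<in> V i" if "V i \<noteq> {}" for i unfolding x_def using that by (simp add: some_in_eq)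
  have sub: "S \<subseteq> (\<Union>i\<in>{i. V i \<noteq> {}}. ball (x i) (r i))"
  proof
    fix y assume "y \<in> S"
    then obtain i where i: "y \<in> V i" using V(1) by blast
    then have "x i \<in> V i" using x by blast
    then have "dist (x i) y < r i" using diameter_bounded_bound[OF V(2) _ i, of "x i"] dr[of i] by simp
    then show "y \<in> (\<Union>i\<in>{i. V i \<noteq> {}}. ball (x i) (r i))" using i by auto
  qed
  obtain I where I: "I \<subseteq> {i. V i \<noteq> {}}" "finite I" "S \<subseteq> (\<Union>i\<in>I. ball (x i) (r i))"
    using compactE_image[OF assms(1) _ sub] by auto
  have "(\<Sum>i\<in>I. a i) \<le> \<epsilon>"
  proof -
    have "ennreal (\<Sum>i\<in>I. a i) = (\<Sum>i\<in>I. ennreal (a i))" using a0 by simp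
    also have "\<dots> \<le> (\<Sum>i\<in>I. diam_power s0 (V i))" by (intro sum_mono ap)
    also have "\<dots> \<le> (\<Sum>i. diam_power s0 (V i))" by (rule sum_le_suminf) (use I(2) in auto)
    finally have "ennreal (\<Sum>i\<in>I. a i) < ennreal \<epsilon>" using V(4) by simp
    then show ?thesis using assms(6) by (simp add: ennreal_less_iff sum_nonneg a0)
  qed
  moreover have "(\<Sum>i\<in>I. \<epsilon> * (1 / 2) ^ Suc i) \<le> \<epsilon>"
  proof -
    have "(\<Sum>i\<in>I. (1 / 2) ^ Suc i) \<le> (\<Sum>i. (1 / 2 :: real) ^ Suc i)"
      by (rule sum_le_suminf) (use I(2) power_half_series sums_summable in auto)
    also have "\<dots> = 1" using power_half_series by (rule sums_unique[symmetric])
    finally have "\<epsilon> * (\<Sum>i\<in>I. (1 / 2) ^ Suc i) \<le> \<epsilon> * 1" using assms(6) by (intro mult_left_mono) auto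
    then show ?thesis by (simp only: sum_distrib_left mult_1_right)
  qed
  ultimately have "(\<Sum>i\<in>I. r i powr s) \<le> 2 * \<epsilon>" unfolding rs by (simp add: sum.distrib)
  then show ?thesis using I r0 by blast
qed

text \<open>If some \<open>s0\<close> below \<open>2 * b\<close> had zero measure, then at an
  exponent s strictly between the two the covers of \<open>hausdorff_null_cover\<close> would
  violate the lower bound of \<open>energy_cover_bound\<close>.\<close>

lemma fourier_decay_hausdorff_dim:
  assumes dec: "fourier_decay D b S" and "compact S" "0 \<le> D" "0 < b" "2 * b < 1"
  shows "ereal (2 * b) \<le> hausdorff_dim S"
  unfolding hausdorff_dim_def
proof (rule INF_greatest)
  fix s0 assume "s0 \<in> {s. 0 \<le> s \<and> hausdorff_measure s S = 0}"
  then have s0: "0 \<le> s0" "hausdorff_measure s0 S = 0" by auto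
  show "ereal (2 * b) \<le> ereal s0"
  proof (rule ccontr)
    assume "\<not> ?thesis"
    then have lt: "s0 < 2 * b" by simp
    define s where "s = (s0 + 2 * b) / 2"
    have s: "s0 \<le> s" "0 < s" "s < 2 * b" using lt s0 assms(4) by (auto simp: s_def)
    obtain B where B: "\<And>x. x \<in> S \<Longrightarrow> \<bar>x\<bar> \<le> B" using compact_imp_bounded[OF assms(2)] by (auto simp: bounded_iff)
    have T: "\<bar>x - y\<bar> \<le> max 1 (2 * B)" if "x \<in> S" "y \<in> S" for x y using B[OF that(1)] B[OF that(2)] by linarith
    have T1: "1 \<le> max 1 (2 * B)" by simp
    have "\<exists>c>0. \<forall>(I :: nat set) x r. finite I \<longrightarrow> (\<forall>i\<in>I. 0 < r i) \<longrightarrow> S \<subseteq> (\<Union>i\<in>I. ball (x i) (r i)) \<longrightarrow>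
     c \<le> (\<Sum>i\<in>I. (2 * r i) powr s)"
      by (rule energy_cover_bound[OF dec assms(3) s(2,3) assms(5) T T1])
    then obtain c where c: "c > 0" "\<forall>(I :: nat set) x r. finite I \<longrightarrow> (\<forall>i\<in>I. 0 < r i) \<longrightarrow> S \<subseteq> (\<Union>i\<in>I. ball (x i) (r i)) \<longrightarrow>
     c \<le> (\<Sum>i\<in>I. (2 * r i) powr s)" by (elim exE conjE) (rule that)
    \<comment> \<open>Doubling the radii costs \<open>2 powr s\<close> and the cover costs
      \<open>2 * \<epsilon>\<close>, so the cover sum is at most \<open>c / 2\<close>.\<close>
    define \<epsilon> where "\<epsilon> = c / (4 * 2 powr s)"
    have e: "\<epsilon> > 0" using c(1) by (simp add: \<epsilon>_def)
    obtain I :: "nat set" and x r where I: "finite I" "\<forall>i\<in>I. 0 < r i" "S \<subseteq> (\<Union>i\<in>I. ball (x i) (r i))"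
       "(\<Sum>i\<in>I. r i powr s) \<le> 2 * \<epsilon>"
      using hausdorff_null_cover[OF assms(2) s0 s(1,2) e] by (elim exE conjE) (rule that)
    have "c \<le> (\<Sum>i\<in>I. (2 * r i) powr s)" using c(2) I(1-3) by blast
    also have "\<dots> = 2 powr s * (\<Sum>i\<in>I. r i powr s)"
      unfolding sum_distrib_left by (intro sum.cong refl powr_mult)
    also have "\<dots> \<le> 2 powr s * (2 * \<epsilon>)" using I(4) by (intro mult_left_mono) auto
    also have "\<dots> = c / 2" by (simp add: \<epsilon>_def)
    finally show False using c(1) by simp
  qed
qed

section \<open>Nonempty interior\<close>

lemma norm_cis_diff_le: "norm (cis a - cis b) \<le> \<bar>a - b\<bar>"
proof -
  have "(norm (cis a - cis b))\<^sup>2 = (cos a - cos b)\<^sup>2 + (sin a - sin b)\<^sup>2" by (simp add: cmod_power2)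
  also have "\<dots> = (sin a ^ 2 + cos a ^ 2) + (sin b ^ 2 + cos b ^ 2) - 2 * cos (a - b)"
    by (simp add: power2_diff cos_diff algebra_simps del: sin_cos_squared_add sin_cos_squared_add2)
  also have "\<dots> = 2 - 2 * cos (2 * ((a - b) / 2))"
  proof -
    have h: "2 * ((a - b) / 2) = a - b" by simp
    show ?thesis unfolding h by simp
  qed
  also have "\<dots> = 4 * (sin ((a - b) / 2))\<^sup>2" unfolding cos_double_sin by simp
  also have "\<dots> \<le> 4 * ((a - b) / 2)\<^sup>2"
    using abs_le_square_iff[of "sin ((a - b) / 2)" "(a - b) / 2"] abs_sin_x_le_abs_x[of "(a - b) / 2"] by simp
  also have "\<dots> = \<bar>a - b\<bar>\<^sup>2" by (simp add: power_divide)
  finally show ?thesis by (rule power2_le_imp_le) simp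
qed

text \<open>Up to a constant factor, the density of the measure smoothed at scale
  \<open>1 / K\<close> by the Fejer kernel.\<close>

definition fejer_mean :: "real set \<Rightarrow> (real \<Rightarrow> real) \<Rightarrow> real \<Rightarrow> real \<Rightarrow> real" where
  "fejer_mean Z \<tau> K t = (\<Sum>z\<in>Z. \<tau> z * (K * fejer (K * (t - z))))"

text \<open>Equicontinuity with constants independent of \<open>K\<close> and \<open>Z\<close>.
  Frequencies below \<Lambda> are handled by \<open>norm_cis_diff_le\<close> and the trivial bound
  on the transform; those above by the decay, whose tail converges because b > 1.\<close>

lemma fejer_mean_diff_le:
  assumes p: "prob_on Z \<tau>" and K: "0 < K" and D: "0 \<le> D" and b: "1 < b" and L: "0 < \<Lambda>"
    and dec: "\<And>\<omega>. 0 < \<omega> \<Longrightarrow> \<omega> \<le> K \<Longrightarrow> norm (ft Z \<tau> \<omega>) \<le> D * \<omega> powr (- b)"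
  shows "\<bar>fejer_mean Z \<tau> K t - fejer_mean Z \<tau> K t'\<bar> \<le> 2 * \<Lambda>\<^sup>2 * \<bar>t - t'\<bar> + 4 * D * \<Lambda> powr (1 - b) / (b - 1)"
proof -
  let ?d = "\<bar>t - t'\<bar>"
  have fin: "finite Z" using p by (simp add: prob_on_def)
  let ?r = "\<lambda>t \<xi>. Re (cis (K * \<xi> * t) * cnj (ft Z \<tau> (K * \<xi>)))"
  have rep: "((\<lambda>\<xi>. K * (2 * (1 - \<xi>) * ?r t \<xi>)) has_integral fejer_mean Z \<tau> K t) {0..1}" for t
  proof -
    have "((\<lambda>\<xi>. \<Sum>z\<in>Z. \<tau> z * (K * (2 * (1 - \<xi>) * cos (K * (t - z) * \<xi>)))) has_integral fejer_mean Z \<tau> K t) {0..1}"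
      unfolding fejer_mean_def fejer_def
      by (intro has_integral_sum fin has_integral_mult_right integrable_integral fejer_integrable)
    moreover have "(\<Sum>z\<in>Z. \<tau> z * (K * (2 * (1 - \<xi>) * cos (K * (t - z) * \<xi>)))) = K * (2 * (1 - \<xi>) * ?r t \<xi>)" for \<xi>
    proof -
      have "?r t \<xi> = (\<Sum>z\<in>Z. \<tau> z * cos (K * (t - z) * \<xi>))"
        unfolding ft_def cnj_sum sum_distrib_left Re_sum
      proof (rule sum.cong[OF refl])
        fix z
        have "cis (K * \<xi> * t) * cnj (cis (K * \<xi> * z)) = cis (K * (t - z) * \<xi>)"
          by (simp add: cis_cnj cis_mult algebra_simps)
        moreover have "cis (K * \<xi> * t) * cnj (of_real (\<tau> z) * cis (K * \<xi> * z)) =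
            of_real (\<tau> z) * (cis (K * \<xi> * t) * cnj (cis (K * \<xi> * z)))" by simp
        ultimately have e: "cis (K * \<xi> * t) * cnj (of_real (\<tau> z) * cis (K * \<xi> * z)) =
            of_real (\<tau> z) * cis (K * (t - z) * \<xi>)" by (simp only:)
        show "Re (cis (K * \<xi> * t) * cnj (of_real (\<tau> z) * cis (K * \<xi> * z))) = \<tau> z * cos (K * (t - z) * \<xi>)"
          unfolding e by simp
      qed
      then show ?thesis by (simp add: sum_distrib_left mult_ac)
    qed
    ultimately show ?thesis by simp
  qed
  let ?g = "\<lambda>\<xi>. 2 * (norm (cis (K * \<xi> * t) - cis (K * \<xi> * t')) * norm (ft Z \<tau> (K * \<xi>)))"
  have cg: "continuous_on {0..1} ?g"
    unfolding cis_conv_exp by (intro continuous_intros continuous_on_ft)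
  have "\<bar>fejer_mean Z \<tau> K t - fejer_mean Z \<tau> K t'\<bar> \<le> K * integral {0..1} ?g"
  proof -
    have I: "((\<lambda>\<xi>. K * (2 * (1 - \<xi>) * ?r t \<xi>) - K * (2 * (1 - \<xi>) * ?r t' \<xi>)) has_integral
        (fejer_mean Z \<tau> K t - fejer_mean Z \<tau> K t')) {0..1}" by (intro has_integral_diff rep)
    have gi: "(\<lambda>\<xi>. K * ?g \<xi>) integrable_on {0..1}"
      by (intro integrable_continuous_real continuous_on_mult continuous_on_const cg)
    have "norm (K * (2 * (1 - \<xi>) * ?r t \<xi>) - K * (2 * (1 - \<xi>) * ?r t' \<xi>)) \<le> K * ?g \<xi>"
      if \<xi>: "\<xi> \<in> {0..1}" for \<xi> :: real
    proof -
      have "\<bar>?r t \<xi> - ?r t' \<xi>\<bar> = \<bar>Re ((cis (K * \<xi> * t) - cis (K * \<xi> * t')) * cnj (ft Z \<tau> (K * \<xi>)))\<bar>"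
        by (simp add: left_diff_distrib)
      also have "\<dots> \<le> norm ((cis (K * \<xi> * t) - cis (K * \<xi> * t')) * cnj (ft Z \<tau> (K * \<xi>)))" by (rule abs_Re_le_cmod)
      also have "\<dots> = norm (cis (K * \<xi> * t) - cis (K * \<xi> * t')) * norm (ft Z \<tau> (K * \<xi>))" by (simp add: norm_mult)
      finally have le: "\<bar>?r t \<xi> - ?r t' \<xi>\<bar> \<le> norm (cis (K * \<xi> * t) - cis (K * \<xi> * t')) * norm (ft Z \<tau> (K * \<xi>))" .
      have "norm (K * (2 * (1 - \<xi>) * ?r t \<xi>) - K * (2 * (1 - \<xi>) * ?r t' \<xi>)) = K * (2 * (1 - \<xi>)) * \<bar>?r t \<xi> - ?r t' \<xi>\<bar>"
        using K \<xi> by (simp add: right_diff_distrib[symmetric] abs_mult mult.assoc del: Re_complex_of_real)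
      also have "\<dots> \<le> K * (2 * 1) * (norm (cis (K * \<xi> * t) - cis (K * \<xi> * t')) * norm (ft Z \<tau> (K * \<xi>)))"
        using K \<xi> le by (intro mult_mono) auto
      finally show ?thesis by (simp add: mult_ac)
    qed
    from Henstock_Kurzweil_Integration.integral_norm_bound_integral[OF has_integral_integrable[OF I] gi this]
    show ?thesis unfolding integral_unique[OF I] by simp
  qed
  also have "\<dots> \<le> 2 * \<Lambda>\<^sup>2 * ?d + 4 * D * \<Lambda> powr (1 - b) / (b - 1)"
  proof -
    have low: "?g \<xi> \<le> 2 * \<Lambda> * ?d" if "0 \<le> \<xi>" "K * \<xi> \<le> \<Lambda>" for \<xi>
    proof -
      have "norm (cis (K * \<xi> * t) - cis (K * \<xi> * t')) \<le> \<bar>K * \<xi> * t - K * \<xi> * t'\<bar>" by (rule norm_cis_diff_le)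
      also have "\<dots> = K * \<xi> * ?d" using K that by (simp add: right_diff_distrib[symmetric] abs_mult)
      also have "\<dots> \<le> \<Lambda> * ?d" using that by (intro mult_right_mono) auto
      finally have "norm (cis (K * \<xi> * t) - cis (K * \<xi> * t')) * norm (ft Z \<tau> (K * \<xi>)) \<le> (\<Lambda> * ?d) * 1"
        using ft_le_1[OF p] L by (intro mult_mono) auto
      then show ?thesis by simp
    qed
    have tail0: "0 \<le> 4 * D * \<Lambda> powr (1 - b) / (b - 1)" using D b by simp
    show ?thesis
    proof (cases "K \<le> \<Lambda>")
      case True
      have "integral {0..1} ?g \<le> integral {0..1} (\<lambda>\<xi>::real. 2 * \<Lambda> * ?d)"
      proof (intro integral_le integrable_continuous_real cg continuous_on_const)
        fix \<xi> :: real assume \<xi>: "\<xi> \<in> {0..1}"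
        have "K * \<xi> \<le> K * 1" using K \<xi> by (intro mult_left_mono) auto
        then show "?g \<xi> \<le> 2 * \<Lambda> * ?d" using True \<xi> by (intro low) auto
      qed
      then have "integral {0..1} ?g \<le> 2 * \<Lambda> * ?d" by simp
      then have "K * integral {0..1} ?g \<le> \<Lambda> * (2 * \<Lambda> * ?d)"
        using True K L
      proof (intro mult_mono)
        show "0 \<le> integral {0..1} ?g"
          by (rule integral_nonneg[OF integrable_continuous_real[OF cg]]) simp
      qed auto
      then show ?thesis using tail0 by (simp add: power2_eq_square mult_ac)
    next
      case False
      \<comment> \<open>The frequency is \<open>K * \<xi>\<close>, so the cut at frequency \<Lambda>
        sits at \<open>\<xi> = c\<close>.\<close>
      define c where "c = \<Lambda> / K"
      have c: "0 < c" "c \<le> 1" "K * c = \<Lambda>" using False L K by (auto simp: c_def)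
      have "integral {0..1} ?g \<le> 2 * \<Lambda> * ?d * c + (4 * D * K powr (- b)) * ((1 - c powr (1 - b)) / (1 - b))"
      proof (rule integral_split_power_bound[OF cg c(1,2)])
        show "?g \<xi> \<le> 2 * \<Lambda> * ?d" if "0 \<le> \<xi>" "\<xi> \<le> c" for \<xi>
          using that K c(3) by (intro low) (auto simp: c_def field_simps)
        show "?g \<xi> \<le> 4 * D * K powr (- b) * \<xi> powr (- b)" if "c \<le> \<xi>" "\<xi> \<le> 1" for \<xi>
        proof -
          have x0: "0 < \<xi>" using that c(1) by simp
          have "K * \<xi> \<le> K * 1" using K that by (intro mult_left_mono) auto
          then have f: "norm (ft Z \<tau> (K * \<xi>)) \<le> D * (K * \<xi>) powr (- b)" using K x0 by (intro dec) auto
          have "norm (cis (K * \<xi> * t) - cis (K * \<xi> * t')) \<le> 2"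
            using norm_triangle_ineq4[of "cis (K * \<xi> * t)" "cis (K * \<xi> * t')"] by simp
          then have "norm (cis (K * \<xi> * t) - cis (K * \<xi> * t')) * norm (ft Z \<tau> (K * \<xi>)) \<le> 2 * (D * (K * \<xi>) powr (- b))"
            using f D by (intro mult_mono) auto
          also have "(K * \<xi>) powr (- b) = K powr (- b) * \<xi> powr (- b)" by (rule powr_mult)
          finally show ?thesis by (simp add: mult_ac)
        qed
      qed (use b in auto)
      then have "K * integral {0..1} ?g \<le> K * (2 * \<Lambda> * ?d * c + (4 * D * K powr (- b)) * ((1 - c powr (1 - b)) / (1 - b)))"
        using K by (intro mult_left_mono) auto
      also have "\<dots> = 2 * \<Lambda> * ?d * (K * c) + 4 * D * (K * K powr (- b) * ((c powr (1 - b) - 1) / (b - 1)))"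
      proof -
        have "(1 - c powr (1 - b)) / (1 - b) = (c powr (1 - b) - 1) / (b - 1)"
          using minus_divide_divide[of "c powr (1 - b) - 1" "b - 1"] by simp
        then show ?thesis by (simp add: algebra_simps)
      qed
      also have "\<dots> \<le> 2 * \<Lambda> * ?d * \<Lambda> + 4 * D * (\<Lambda> powr (1 - b) / (b - 1))"
      proof -
        have "K * K powr (- b) = K powr (1 - b)" using K by (simp add: powr_diff powr_minus_divide)
        then have "K * K powr (- b) * ((c powr (1 - b) - 1) / (b - 1)) = (K powr (1 - b) * c powr (1 - b) - K powr (1 - b)) / (b - 1)"
          by (simp add: right_diff_distrib)
        also have "K powr (1 - b) * c powr (1 - b) = \<Lambda> powr (1 - b)" using c(3) by (simp add: powr_mult[symmetric])
        also have "(\<Lambda> powr (1 - b) - K powr (1 - b)) / (b - 1) \<le> \<Lambda> powr (1 - b) / (b - 1)"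
          using b by (intro divide_right_mono) auto
        finally have "K * K powr (- b) * ((c powr (1 - b) - 1) / (b - 1)) \<le> \<Lambda> powr (1 - b) / (b - 1)" .
        from mult_left_mono[OF this, of "4 * D"] show ?thesis unfolding c(3) using D by linarith
      qed
      finally show ?thesis by (simp add: power2_eq_square mult_ac)
    qed
  qed
  finally show ?thesis .
qed

text \<open>The masses meet at most \<open>(2 * T + 2) / \<delta>\<close> grid intervals, so
  \<open>card_grid_ge\<close> makes the correlation sum at least
  \<open>\<delta> / (2 * T + 2)\<close>. It is an average of the masses of \<delta>-neighbourhoods,
  so one of these is as large, and near its centre the rescaled kernel is at least
  \<open>1 / (2 * \<delta>)\<close>.\<close>

lemma fejer_mean_large_somewhere:
  assumes p: "prob_on Z \<tau>" and \<delta>: "0 < \<delta>" "\<delta> \<le> 1" and T: "\<And>z. z \<in> Z \<Longrightarrow> \<bar>z\<bar> \<le> T" "0 \<le> T"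
  shows "\<exists>t\<in>Z. 1 / (2 * (2 * T + 2)) \<le> fejer_mean Z \<tau> (1 / \<delta>) t"
proof -
  have fin: "finite Z" and nn: "\<And>t. t \<in> Z \<Longrightarrow> 0 \<le> \<tau> t" and s1: "sum \<tau> Z = 1" using p by (auto simp: prob_on_def)
  have "real (card ((\<lambda>t. \<lfloor>t / \<delta>\<rfloor>) ` Z)) \<le> (2 * T + 2) / \<delta>"
  proof -
    have "(\<lambda>t. \<lfloor>t / \<delta>\<rfloor>) ` Z \<subseteq> {\<lfloor>- T / \<delta>\<rfloor>..\<lfloor>T / \<delta>\<rfloor>}"
    proof (rule image_subsetI)
      fix t assume "t \<in> Z"
      then have "- T \<le> t" "t \<le> T" using T(1)[of t] by (auto simp: abs_le_iff)
      then have "- T / \<delta> \<le> t / \<delta>" "t / \<delta> \<le> T / \<delta>" using \<delta>(1) by (intro divide_right_mono; simp)+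
      then show "\<lfloor>t / \<delta>\<rfloor> \<in> {\<lfloor>- T / \<delta>\<rfloor>..\<lfloor>T / \<delta>\<rfloor>}" by (auto intro: floor_mono)
    qed
    then have "real (card ((\<lambda>t. \<lfloor>t / \<delta>\<rfloor>) ` Z)) \<le> real (card {\<lfloor>- T / \<delta>\<rfloor>..\<lfloor>T / \<delta>\<rfloor>})"
      by (intro of_nat_mono card_mono) auto
    also have "\<dots> \<le> T / \<delta> - (- T / \<delta>) + 2"
      using T(2) \<delta>(1) by (intro card_floor_interval divide_right_mono) auto
    also have "\<dots> \<le> (2 * T + 2) / \<delta>" using \<delta> by (simp add: field_simps)
    finally show ?thesis .
  qed
  moreover have pn: "0 \<le> pairs Z \<tau> \<delta>" unfolding pairs_def using nn by (intro sum_nonneg) auto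
  ultimately have "1 \<le> (2 * T + 2) / \<delta> * pairs Z \<tau> \<delta>"
    using card_grid_ge[OF p \<delta>(1)] mult_right_mono[of _ "(2 * T + 2) / \<delta>" "pairs Z \<tau> \<delta>"] by (meson order_trans)
  then have pg: "\<delta> / (2 * T + 2) \<le> pairs Z \<tau> \<delta>" using \<delta>(1) T(2) by (simp add: field_simps)
  let ?m = "\<lambda>t. \<Sum>t'\<in>Z. if \<bar>t - t'\<bar> \<le> \<delta> then \<tau> t' else 0"
  have "\<exists>t\<in>Z. \<delta> / (2 * T + 2) \<le> ?m t"
  proof (rule ccontr)
    assume "\<not> ?thesis"
    then have lt: "\<And>t. t \<in> Z \<Longrightarrow> ?m t < \<delta> / (2 * T + 2)" by (auto simp: not_le)
    have "pairs Z \<tau> \<delta> = (\<Sum>t\<in>Z. \<tau> t * ?m t)"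
      unfolding pairs_def sum_distrib_left by (intro sum.cong refl) auto
    also have "\<dots> < (\<Sum>t\<in>Z. \<tau> t * (\<delta> / (2 * T + 2)))"
    proof -
      obtain t where t: "t \<in> Z" "0 < \<tau> t"
        using s1 nn by (metis less_eq_real_def sum.neutral zero_neq_one)
      show ?thesis
      proof (rule sum_strict_mono_ex1[OF fin])
        show "\<forall>t\<in>Z. \<tau> t * ?m t \<le> \<tau> t * (\<delta> / (2 * T + 2))"
          using mult_left_mono[OF less_imp_le[OF lt] nn] by blast
        show "\<exists>t\<in>Z. \<tau> t * ?m t < \<tau> t * (\<delta> / (2 * T + 2))"
          using t lt by (intro bexI[of _ t] mult_strict_left_mono)
      qed
    qed
    also have "\<dots> = \<delta> / (2 * T + 2)" using s1 by (simp add: sum_distrib_right[symmetric] sum_divide_distrib[symmetric])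
    finally show False using pg by simp
  qed
  then obtain t where t: "t \<in> Z" "\<delta> / (2 * T + 2) \<le> ?m t" by blast
  have "1 / (2 * (2 * T + 2)) = (1 / (2 * \<delta>)) * (\<delta> / (2 * T + 2))" using \<delta>(1) by simp
  also have "\<dots> \<le> (1 / (2 * \<delta>)) * ?m t" using t(2) \<delta>(1) by (intro mult_left_mono) auto
  also have "\<dots> \<le> fejer_mean Z \<tau> (1 / \<delta>) t"
    unfolding fejer_mean_def sum_distrib_left
  proof (rule sum_mono)
    fix z assume z: "z \<in> Z"
    show "1 / (2 * \<delta>) * (if \<bar>t - z\<bar> \<le> \<delta> then \<tau> z else 0) \<le> \<tau> z * (1 / \<delta> * fejer (1 / \<delta> * (t - z)))"
    proof (cases "\<bar>t - z\<bar> \<le> \<delta>")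
      case True
      then have "1 / 2 \<le> fejer (1 / \<delta> * (t - z))" using \<delta>(1) by (intro fejer_near) (simp add: abs_mult)
      from mult_left_mono[OF this, of "\<tau> z * (1 / \<delta>)"] show ?thesis using True nn[OF z] \<delta>(1) by (simp add: mult_ac)
    next
      case False
      then show ?thesis using nn[OF z] \<delta>(1) fejer_nonneg by simp
    qed
  qed
  finally show ?thesis using t(1) by blast
qed

lemma fejer_mean_far_le:
  assumes p: "prob_on Z \<tau>" and K: "0 < K" and e: "0 < e" "\<And>z. z \<in> Z \<Longrightarrow> e \<le> \<bar>t - z\<bar>"
  shows "fejer_mean Z \<tau> K t \<le> 4 / (K * e\<^sup>2)"
proof -
  have nn: "\<And>t. t \<in> Z \<Longrightarrow> 0 \<le> \<tau> t" and s1: "sum \<tau> Z = 1" using p by (auto simp: prob_on_def)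
  have "fejer_mean Z \<tau> K t \<le> (\<Sum>z\<in>Z. \<tau> z * (4 / (K * e\<^sup>2)))"
    unfolding fejer_mean_def
  proof (intro sum_mono mult_left_mono nn)
    fix z assume z: "z \<in> Z"
    have ne: "K * (t - z) \<noteq> 0" using e(1) e(2)[OF z] K by auto
    have "K * fejer (K * (t - z)) \<le> K * (4 / (K * (t - z))\<^sup>2)" using K by (intro mult_left_mono fejer_le ne) auto
    also have "\<dots> = 4 / (K * \<bar>t - z\<bar>\<^sup>2)" using K by (simp add: power_mult_distrib power2_eq_square)
    also have "\<dots> \<le> 4 / (K * e\<^sup>2)"
      using e(1) e(2)[OF z] K by (intro divide_left_mono mult_left_mono power_mono) auto
    finally show "K * fejer (K * (t - z)) \<le> 4 / (K * e\<^sup>2)" .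
  qed
  also have "\<dots> = 4 / (K * e\<^sup>2)" using s1 by (simp add: sum_distrib_right[symmetric] sum_divide_distrib[symmetric])
  finally show ?thesis .
qed

text \<open>At every scale the smoothed density is at least l at some point of \<open>S\<close>,
  hence at least \<open>l / 2\<close> on a ball of fixed radius by equicontinuity. Let x be a limit
  of such centres. At a point outside \<open>S\<close> the smoothed densities tend to 0, so the ball
  about x contains no such point.\<close>

lemma fourier_decay_interior:
  assumes dec: "fourier_decay D b S" and "compact S" "0 \<le> D" "1 < b"
  shows "interior S \<noteq> {}"
proof -
  obtain B where B: "\<And>x. x \<in> S \<Longrightarrow> \<bar>x\<bar> \<le> B" using compact_imp_bounded[OF assms(2)] by (auto simp: bounded_iff)
  define T where "T = max 0 B"
  have T: "\<And>x. x \<in> S \<Longrightarrow> \<bar>x\<bar> \<le> T" "0 \<le> T" using B by (auto simp: T_def le_max_iff_disj)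
  define l where "l = 1 / (2 * (2 * T + 2))"
  have l: "l > 0" using T(2) by (simp add: l_def)
  \<comment> \<open>The drop from l to \<open>l / 2\<close> is shared: the high frequencies get one
    quarter of l through \<Lambda>, the low ones the other through \<open>d0\<close>.\<close>
  obtain \<Lambda> where L: "0 < \<Lambda>" "4 * D * \<Lambda> powr (1 - b) / (b - 1) \<le> l / 4"
  proof -
    have "((\<lambda>x. 4 * D * x powr (1 - b) / (b - 1)) \<longlongrightarrow> 4 * D * 0 / (b - 1)) at_top"
      using assms(4) by (intro tendsto_intros tendsto_neg_powr filterlim_ident) auto
    then have "\<forall>\<^sub>F x in at_top. 4 * D * x powr (1 - b) / (b - 1) < l / 4"
      using l by (intro order_tendstoD) auto
    then have "\<forall>\<^sub>F x in at_top. 0 < x \<and> 4 * D * x powr (1 - b) / (b - 1) < l / 4"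
      using eventually_gt_at_top[of "0::real"] by eventually_elim auto
    then obtain x where "0 < x" "4 * D * x powr (1 - b) / (b - 1) < l / 4"
      using eventually_happens'[OF trivial_limit_at_top_linorder] by blast
    then show ?thesis using that[of x] by simp
  qed
  define d0 where "d0 = l / (8 * \<Lambda>\<^sup>2)"
  have d0: "d0 > 0" "2 * \<Lambda>\<^sup>2 * d0 = l / 4" using l L(1) by (auto simp: d0_def)
  have "\<exists>Z \<tau> t. prob_on Z \<tau> \<and> Z \<subseteq> S \<and> t \<in> S \<and> (\<forall>t'. \<bar>t' - t\<bar> \<le> d0 \<longrightarrow> l / 2 \<le> fejer_mean Z \<tau> (real (Suc k)) t')" for k
  proof -
    let ?\<delta> = "1 / real (Suc k)"
    have \<delta>: "0 < ?\<delta>" "?\<delta> \<le> 1" "1 / ?\<delta> = real (Suc k)" by auto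
    obtain Z \<tau> where Z: "prob_on Z \<tau>" "Z \<subseteq> S"
      "\<And>\<omega>. 0 < \<omega> \<Longrightarrow> \<omega> \<le> real (Suc k) \<Longrightarrow> norm (ft Z \<tau> \<omega>) \<le> D * \<omega> powr (- b)"
      using dec \<delta>(1) \<delta>(3) unfolding fourier_decay_def by metis
    obtain t where t: "t \<in> Z" "l \<le> fejer_mean Z \<tau> (real (Suc k)) t"
      using fejer_mean_large_somewhere[OF Z(1) \<delta>(1,2), of T] T Z(2) unfolding \<delta>(3) l_def by blast
    have "l / 2 \<le> fejer_mean Z \<tau> (real (Suc k)) t'" if d: "\<bar>t' - t\<bar> \<le> d0" for t'
    proof -
      have "\<bar>fejer_mean Z \<tau> (real (Suc k)) t' - fejer_mean Z \<tau> (real (Suc k)) t\<bar> \<le>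
          2 * \<Lambda>\<^sup>2 * \<bar>t' - t\<bar> + 4 * D * \<Lambda> powr (1 - b) / (b - 1)"
        by (rule fejer_mean_diff_le[OF Z(1) _ assms(3,4) L(1) Z(3)]) auto
      also have "\<dots> \<le> 2 * \<Lambda>\<^sup>2 * d0 + l / 4" using d L by (intro add_mono mult_left_mono) auto
      finally show ?thesis using t(2) d0(2) by linarith
    qed
    then show ?thesis using Z t(1) by blast
  qed
  then obtain Z \<tau> c where Z: "\<And>k. prob_on (Z k) (\<tau> k)" "\<And>k. Z k \<subseteq> S" "\<And>k. c k \<in> S"
    and low: "\<And>k t'. \<bar>t' - c k\<bar> \<le> d0 \<Longrightarrow> l / 2 \<le> fejer_mean (Z k) (\<tau> k) (real (Suc k)) t'" by metis
  obtain x \<sigma> where x: "x \<in> S" "strict_mono \<sigma>" "(c \<circ> \<sigma>) \<longlonglongrightarrow> x"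
    using assms(2) Z(3) unfolding compact_def by blast
  have "ball x d0 \<subseteq> S"
  proof
    fix t assume t: "t \<in> ball x d0"
    show "t \<in> S"
    proof (rule ccontr)
      assume "t \<notin> S"
      then obtain e where e: "e > 0" "ball t e \<subseteq> - S"
        using compact_imp_closed[OF assms(2)] open_contains_ball[of "- S"] by (auto simp: open_Compl)
      have far: "e \<le> \<bar>t - z\<bar>" if "z \<in> S" for z
        using e(2) that by (force simp: dist_real_def not_less[symmetric])
      have "(\<lambda>k. \<bar>t - (c \<circ> \<sigma>) k\<bar>) \<longlonglongrightarrow> \<bar>t - x\<bar>" by (intro tendsto_intros x)
      then have ev1: "\<forall>\<^sub>F k in sequentially. \<bar>t - (c \<circ> \<sigma>) k\<bar> < d0"
        using t by (intro order_tendstoD) (auto simp: dist_real_def abs_minus_commute)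
      have "(\<lambda>k. 4 / (real (Suc k) * e\<^sup>2)) \<longlonglongrightarrow> 0"
      proof -
        have "(\<lambda>k. 4 / e\<^sup>2 * inverse (real (Suc k))) \<longlonglongrightarrow> 4 / e\<^sup>2 * 0"
          by (intro tendsto_intros LIMSEQ_inverse_real_of_nat)
        then show ?thesis by (simp add: field_simps)
      qed
      then have "\<forall>\<^sub>F k in sequentially. 4 / (real (Suc k) * e\<^sup>2) < l / 2" using l by (intro order_tendstoD) auto
      then have ev2: "\<forall>\<^sub>F k in sequentially. 4 / (real (Suc (\<sigma> k)) * e\<^sup>2) < l / 2"
        using eventually_subseq[OF x(2)] by blast
      obtain k where k: "\<bar>t - c (\<sigma> k)\<bar> < d0" "4 / (real (Suc (\<sigma> k)) * e\<^sup>2) < l / 2"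
        using eventually_happens'[OF sequentially_bot eventually_conj[OF ev1 ev2]] by auto
      have "l / 2 \<le> fejer_mean (Z (\<sigma> k)) (\<tau> (\<sigma> k)) (real (Suc (\<sigma> k))) t" using k(1) by (intro low) simp
      also have "\<dots> \<le> 4 / (real (Suc (\<sigma> k)) * e\<^sup>2)"
        by (rule fejer_mean_far_le[OF Z(1) _ e(1)]) (use far Z(2) in auto)
      finally show False using k(2) by simp
    qed
  qed
  then have "x \<in> interior S" using d0(1) by (meson centre_in_ball interiorI open_ball)
  then show ?thesis by blast
qed

section \<open>The theorem\<close>

lemma frostman_mono:
  assumes "frostman C s \<delta> A \<mu>" "C \<le> C'" "\<delta> \<le> \<delta>'"
  shows "frostman C' s \<delta>' A \<mu>"
proof -
  have "sum \<mu> (A \<inter> cball x t) \<le> C' * t powr s" if "\<delta>' \<le> t" for x t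
  proof -
    have "sum \<mu> (A \<inter> cball x t) \<le> C * t powr s" using assms(1,3) that by (simp add: frostman_def)
    also have "\<dots> \<le> C' * t powr s" using assms(2) by (intro mult_right_mono) auto
    finally show ?thesis .
  qed
  then show ?thesis using assms(1) by (simp add: frostman_def)
qed

lemma push_forward:
  fixes \<Phi> :: "'a \<times> 'b \<Rightarrow> real"
  assumes S: "finite S" "\<And>p. p \<in> S \<Longrightarrow> 0 \<le> \<mu> p" "sum \<mu> S = (1::real)"
    and R: "finite R" "\<And>q. q \<in> R \<Longrightarrow> 0 \<le> \<nu> q" "sum \<nu> R = (1::real)"
  obtains \<tau> where "prob_on (\<Phi> ` (S \<times> R)) \<tau>"
    "\<And>\<omega>. ft (\<Phi> ` (S \<times> R)) \<tau> \<omega> = (\<Sum>p\<in>S. \<Sum>q\<in>R. of_real (\<mu> p * \<nu> q) * cis (\<omega> * \<Phi> (p, q)))"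
proof
  let ?w = "\<lambda>z. \<mu> (fst z) * \<nu> (snd z)"
  let ?\<tau> = "\<lambda>t. sum ?w {z \<in> S \<times> R. \<Phi> z = t}"
  have fin: "finite (S \<times> R)" using S R by simp
  have "sum ?\<tau> (\<Phi> ` (S \<times> R)) = sum ?w (S \<times> R)" by (rule sum.image_gen[OF fin, symmetric])
  also have "\<dots> = sum \<mu> S * sum \<nu> R" by (simp add: sum_product sum.cartesian_product case_prod_beta')
  finally show "prob_on (\<Phi> ` (S \<times> R)) ?\<tau>"
    unfolding prob_on_def using S R fin by (auto intro!: sum_nonneg)
  fix \<omega>
  have "ft (\<Phi> ` (S \<times> R)) ?\<tau> \<omega> = (\<Sum>t\<in>\<Phi> ` (S \<times> R). \<Sum>z\<in>{z \<in> S \<times> R. \<Phi> z = t}. of_real (?w z) * cis (\<omega> * \<Phi> z))"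
    unfolding ft_def by (intro sum.cong refl) (simp add: sum_distrib_right)
  also have "\<dots> = (\<Sum>z\<in>S \<times> R. of_real (?w z) * cis (\<omega> * \<Phi> z))" by (rule sum.image_gen[OF fin, symmetric])
  finally show "ft (\<Phi> ` (S \<times> R)) ?\<tau> \<omega> = (\<Sum>p\<in>S. \<Sum>q\<in>R. of_real (\<mu> p * \<nu> q) * cis (\<omega> * \<Phi> (p, q)))"
    by (simp add: sum.cartesian_product case_prod_beta')
qed

lemma Delta_eq_image: "Delta \<Phi> A B = \<Phi> ` (A \<times> B)"
  by (auto simp: Delta_def)

text \<open>Local decay around points of positive content, applied to discrete Frostman measures
  there. Measures built at scale \<delta> serve all frequencies up to \<open>1 / \<delta>\<close>,
  because the ball condition weakens as the scale grows.\<close>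

lemma Delta_fourier_decay:
  fixes \<Phi> :: "(real^'m::finite) \<times> (real^'n::finite) \<Rightarrow> real"
  assumes sm: "smooth_on (X \<times> Y) \<Phi>" "open X" "open Y"
    and rk: "\<And>x y. x \<in> X \<Longrightarrow> y \<in> Y \<Longrightarrow> r \<le> rank (mixed_hessian \<Phi> x y)"
    and A: "compact A" "A \<subseteq> X" and B: "compact B" "B \<subseteq> Y"
    and \<alpha>: "0 < \<alpha>" "ereal \<alpha> < hausdorff_dim A" and \<beta>: "0 < \<beta>" "ereal \<beta> < hausdorff_dim B"
    and b: "0 < b" "b \<le> (\<alpha> + \<beta> - real CARD('m) - real CARD('n) + real r) / 2"
  shows "\<exists>D\<ge>0. fourier_decay D b (Delta \<Phi> A B)"
proof -
  obtain x0 where x0: "x0 \<in> A" "\<And>\<rho>. \<rho> > 0 \<Longrightarrow> pos_content \<alpha> (A \<inter> cball x0 \<rho>)"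
    using pos_content_localize[OF A(1) pos_content_below_dim[OF \<alpha>]] by blast
  obtain y0 where y0: "y0 \<in> B" "\<And>\<rho>. \<rho> > 0 \<Longrightarrow> pos_content \<beta> (B \<inter> cball y0 \<rho>)"
    using pos_content_localize[OF B(1) pos_content_below_dim[OF \<beta>]] by blast
  have xy: "x0 \<in> X" "y0 \<in> Y" using x0 y0 A B by auto
  let ?e = "(\<alpha> + \<beta> - real CARD('m) - real CARD('n) + real r) / 2"
  obtain \<sigma> \<omega>0 where so: "\<sigma> > 0" "1 \<le> \<omega>0" "\<forall>C\<ge>0. \<exists>D>0. \<forall>\<omega>\<ge>\<omega>0. \<forall>A \<mu> R \<nu>.
     A \<subseteq> cball x0 \<sigma> \<longrightarrow> R \<subseteq> cball y0 \<sigma> \<longrightarrow> frostman C \<alpha> (1 / \<omega>) A \<mu> \<longrightarrow> frostman C \<beta> (1 / \<omega>) R \<nu> \<longrightarrow>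
     norm (\<Sum>p\<in>A. \<Sum>q\<in>R. of_real (\<mu> p * \<nu> q) * cis (\<omega> * \<Phi> (p, q))) \<le> D * \<omega> powr (- ?e)"
    using oscillatory_sum_decay[OF sm xy rk[OF xy] less_imp_le[OF \<alpha>(1)] less_imp_le[OF \<beta>(1)]]
    by (elim exE conjE) (rule that)
  have bd: "bounded (A \<inter> cball x0 \<sigma>)" "bounded (B \<inter> cball y0 \<sigma>)" by (auto intro: bounded_Int)
  obtain C1 where C1: "0 \<le> C1" "\<And>\<delta>. 0 < \<delta> \<Longrightarrow> \<exists>S \<mu>. S \<subseteq> A \<inter> cball x0 \<sigma> \<and> frostman C1 \<alpha> \<delta> S \<mu>"
    using frostman_lemma[OF bd(1) x0(2)[OF so(1)] \<alpha>(1)] by blast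
  obtain C2 where C2: "0 \<le> C2" "\<And>\<delta>. 0 < \<delta> \<Longrightarrow> \<exists>S \<mu>. S \<subseteq> B \<inter> cball y0 \<sigma> \<and> frostman C2 \<beta> \<delta> S \<mu>"
    using frostman_lemma[OF bd(2) y0(2)[OF so(1)] \<beta>(1)] by blast
  define C where "C = max C1 C2"
  have C: "0 \<le> C" using C1(1) by (simp add: C_def)
  obtain D where D: "D > 0" "\<forall>\<omega>\<ge>\<omega>0. \<forall>A \<mu> R \<nu>.
     A \<subseteq> cball x0 \<sigma> \<longrightarrow> R \<subseteq> cball y0 \<sigma> \<longrightarrow> frostman C \<alpha> (1 / \<omega>) A \<mu> \<longrightarrow> frostman C \<beta> (1 / \<omega>) R \<nu> \<longrightarrow>
     norm (\<Sum>p\<in>A. \<Sum>q\<in>R. of_real (\<mu> p * \<nu> q) * cis (\<omega> * \<Phi> (p, q))) \<le> D * \<omega> powr (- ?e)"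
    using so(3)[rule_format, OF C] by (elim exE conjE) (rule that)
  \<comment> \<open>For frequencies below \<open>\<omega>0\<close> only the trivial bound 1 is
    available; \<open>\<omega>0 powr b\<close> absorbs it.\<close>
  define D' where "D' = max D (\<omega>0 powr b)"
  have D'0: "0 \<le> D'" using D(1) by (simp add: D'_def)
  have "fourier_decay D' b (Delta \<Phi> A B)"
    unfolding fourier_decay_def
  proof (intro allI impI)
    fix \<delta> :: real assume \<delta>: "0 < \<delta>"
    obtain S \<mu> where S: "S \<subseteq> A \<inter> cball x0 \<sigma>" "frostman C1 \<alpha> \<delta> S \<mu>" using C1(2)[OF \<delta>] by blast
    obtain R \<nu> where R: "R \<subseteq> B \<inter> cball y0 \<sigma>" "frostman C2 \<beta> \<delta> R \<nu>" using C2(2)[OF \<delta>] by blast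
    obtain \<tau> where \<tau>: "prob_on (\<Phi> ` (S \<times> R)) \<tau>"
      "\<And>\<omega>. ft (\<Phi> ` (S \<times> R)) \<tau> \<omega> = (\<Sum>p\<in>S. \<Sum>q\<in>R. of_real (\<mu> p * \<nu> q) * cis (\<omega> * \<Phi> (p, q)))"
      using push_forward[of S \<mu> R \<nu> \<Phi>] S(2) R(2) unfolding frostman_def by blast
    have "norm (ft (\<Phi> ` (S \<times> R)) \<tau> \<omega>) \<le> D' * \<omega> powr (- b)" if w: "0 < \<omega>" "\<omega> \<le> 1 / \<delta>" for \<omega>
    proof (cases "\<omega>0 \<le> \<omega>")
      case True
      have dw: "\<delta> \<le> 1 / \<omega>" using w \<delta> by (simp add: field_simps)
      have "frostman C \<alpha> (1 / \<omega>) S \<mu>" "frostman C \<beta> (1 / \<omega>) R \<nu>"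
        by (rule frostman_mono[OF S(2) _ dw], simp add: C_def) (rule frostman_mono[OF R(2) _ dw], simp add: C_def)
      then have "norm (ft (\<Phi> ` (S \<times> R)) \<tau> \<omega>) \<le> D * \<omega> powr (- ?e)"
        unfolding \<tau>(2) using D(2) True S(1) R(1) by blast
      also have "\<dots> \<le> D' * \<omega> powr (- b)"
        using b True so(2) D(1) by (intro mult_mono powr_mono) (auto simp: D'_def)
      finally show ?thesis .
    next
      case False
      have "norm (ft (\<Phi> ` (S \<times> R)) \<tau> \<omega>) \<le> 1" by (rule ft_le_1[OF \<tau>(1)])
      also have "1 = \<omega>0 powr b * \<omega>0 powr (- b)" using so(2) by (simp add: powr_add[symmetric])
      also have "\<dots> \<le> D' * \<omega> powr (- b)"
        using False w b(1) D'0 by (intro mult_mono powr_mono2') (auto simp: D'_def)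
      finally show ?thesis .
    qed
    moreover have "\<Phi> ` (S \<times> R) \<subseteq> Delta \<Phi> A B" unfolding Delta_eq_image using S(1) R(1) by blast
    ultimately show "\<exists>Z \<tau>. prob_on Z \<tau> \<and> Z \<subseteq> Delta \<Phi> A B \<and>
       (\<forall>\<omega>>0. \<omega> \<le> 1 / \<delta> \<longrightarrow> norm (ft Z \<tau> \<omega>) \<le> D' * \<omega> powr (- b))"
      using \<tau>(1) by blast
  qed
  then show ?thesis using D'0 by blast
qed

text \<open>Neither dimension exceeds \<open>T\<close>, so a sum above \<open>T\<close> forces both
  to be positive; each can then be lowered by less than half of the surplus.\<close>

lemma split_exponents:
  fixes X Y :: ereal
  assumes "0 \<le> X" "0 \<le> Y" "X \<le> ereal m" "Y \<le> ereal n" "ereal T < X + Y" "m \<le> T" "n \<le> T"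
  obtains \<alpha> \<beta> where "0 < \<alpha>" "ereal \<alpha> < X" "0 < \<beta>" "ereal \<beta> < Y" "T < \<alpha> + \<beta>"
proof -
  obtain x where x: "X = ereal x" "x \<le> m" using assms(1,3) by (cases X) auto
  obtain y where y: "Y = ereal y" "y \<le> n" using assms(2,4) by (cases Y) auto
  have xy: "T < x + y" using assms(5) x y by simp
  then have pos: "0 < x" "0 < y" using x y assms(6,7) by auto
  define e where "e = min ((x + y - T) / 4) (min (x / 2) (y / 2))"
  have e: "0 < e" "e < x" "e < y" "2 * e < x + y - T" using xy pos by (auto simp: e_def min_def)
  show ?thesis by (rule that[of "x - e" "y - e"]) (use e x y in auto)
qed

lemma hausdorff_dim_nonneg: "0 \<le> hausdorff_dim A"
  unfolding hausdorff_dim_def by (intro INF_greatest) simp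

theorem theorem1p14:
  fixes X :: "(real^'m::finite) set" and Y :: "(real^'n::finite) set"
    and \<Phi> :: "(real^'m) \<times> (real^'n) \<Rightarrow> real"
    and r :: nat
    and A :: "(real^'m) set" and B :: "(real^'n) set"
  assumes "open X" and "X \<noteq> {}" and "open Y" and "Y \<noteq> {}"
    and "smooth_on (X \<times> Y) \<Phi>"
    and "\<forall>x\<in>X. \<forall>y\<in>Y. gradient (\<lambda>x'. \<Phi> (x', y)) x \<noteq> 0 \<and> gradient (\<lambda>y'. \<Phi> (x, y')) y \<noteq> 0"
    and "r \<ge> 1"
    and "\<forall>x\<in>X. \<forall>y\<in>Y. rank (mixed_hessian \<Phi> x y) \<ge> r"
    and "compact A" and "A \<subseteq> X" and "compact B" and "B \<subseteq> Y"
  shows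
    "(\<forall>u::real. 0 < u \<and> u < 1 \<and>
        hausdorff_dim A + hausdorff_dim B > ereal (real CARD('m) + real CARD('n) - real r + u)
        \<longrightarrow> hausdorff_dim (Delta \<Phi> A B) \<ge> ereal u)
     \<and> (hausdorff_dim A + hausdorff_dim B > ereal (real CARD('m) + real CARD('n) + 1 - real r)
        \<longrightarrow> emeasure lebesgue (Delta \<Phi> A B) > 0)
     \<and> (hausdorff_dim A + hausdorff_dim B > ereal (real CARD('m) + real CARD('n) + 2 - real r)
        \<longrightarrow> interior (Delta \<Phi> A B) \<noteq> {})"
proof -
  let ?m = "real CARD('m)" and ?n = "real CARD('n)" and ?S = "Delta \<Phi> A B"
  \<comment> \<open>Comparing r with the rank at one point bounds it by both dimensions; the
    threshold \<open>?m + ?n - real r + v\<close> is then at least \<open>?m\<close> and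
    \<open>?n\<close>, as \<open>split_exponents\<close> demands.\<close>
  obtain x y where "x \<in> X" "y \<in> Y" using assms(2,4) by blast
  then have "r \<le> min CARD('m) CARD('n)"
    using assms(8) rank_bound[of "mixed_hessian \<Phi> x y"] by (meson order_trans)
  then have r: "real r \<le> ?m" "real r \<le> ?n" by auto
  have comp: "compact ?S"
    unfolding Delta_eq_image
  proof (rule compact_continuous_image)
    show "continuous_on (A \<times> B) \<Phi>"
      by (rule continuous_on_subset[OF smooth_on_continuous[OF assms(5)]]) (use assms(10,12) in auto)
  qed (intro compact_Times assms(9,11))
  have dims: "hausdorff_dim A \<le> ereal ?m" "hausdorff_dim B \<le> ereal ?n"
    using hausdorff_dim_le_DIM[OF compact_imp_bounded[OF assms(9)]]
      hausdorff_dim_le_DIM[OF compact_imp_bounded[OF assms(11)]] by auto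
  \<comment> \<open>Two exponents are kept: exactly \<open>v / 2\<close> for the dimension bound,
    where twice the exponent must stay below 1, and a strictly larger b for the other two
    conclusions, where \<open>v / 2\<close> is the borderline case.\<close>
  have decay: "\<exists>b D. 0 \<le> D \<and> v / 2 < b \<and> fourier_decay D b ?S \<and> fourier_decay D (v / 2) ?S"
    if v: "0 < v" "ereal (?m + ?n - real r + v) < hausdorff_dim A + hausdorff_dim B" for v
  proof -
    obtain \<alpha> \<beta> where ab: "0 < \<alpha>" "ereal \<alpha> < hausdorff_dim A" "0 < \<beta>" "ereal \<beta> < hausdorff_dim B"
      "?m + ?n - real r + v < \<alpha> + \<beta>"
      by (rule split_exponents[OF hausdorff_dim_nonneg hausdorff_dim_nonneg dims v(2)]) (use r v in auto)
    define b where "b = (\<alpha> + \<beta> - ?m - ?n + real r) / 2"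
    have b: "v / 2 < b" using ab(5) by (simp add: b_def)
    note dec = Delta_fourier_decay[OF assms(5,1,3) _ assms(9-12) ab(1-4), of r]
    have 1: "\<exists>D\<ge>0. fourier_decay D b ?S" by (rule dec) (use assms(8) b v in \<open>auto simp: b_def\<close>)
    have 2: "\<exists>D\<ge>0. fourier_decay D (v / 2) ?S" by (rule dec) (use assms(8) b v in \<open>auto simp: b_def\<close>)
    have mono: "fourier_decay D' c ?S" if "fourier_decay D c ?S" "D \<le> D'" for D D' c
      using that unfolding fourier_decay_def by (meson mult_right_mono order_trans powr_ge_zero)
    obtain D1 D2 where D: "0 \<le> D1" "fourier_decay D1 b ?S" "fourier_decay D2 (v / 2) ?S" using 1 2 by blast
    have "fourier_decay (max D1 D2) b ?S" "fourier_decay (max D1 D2) (v / 2) ?S"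
      using mono[OF D(2)] mono[OF D(3)] by auto
    moreover have "0 \<le> max D1 D2" using D(1) by simp
    ultimately show ?thesis using b by blast
  qed
  have "ereal u \<le> hausdorff_dim ?S"
    if u: "0 < u" "u < 1" "hausdorff_dim A + hausdorff_dim B > ereal (?m + ?n - real r + u)" for u
  proof -
    obtain D where "0 \<le> D" "fourier_decay D (u / 2) ?S" using decay[OF u(1,3)] by blast
    from fourier_decay_hausdorff_dim[OF this(2) comp this(1)] show ?thesis using u by simp
  qed
  moreover have "emeasure lebesgue ?S > 0"
    if "hausdorff_dim A + hausdorff_dim B > ereal (?m + ?n + 1 - real r)"
  proof -
    have "ereal (?m + ?n - real r + 1) < hausdorff_dim A + hausdorff_dim B" using that by (simp add: algebra_simps)
    then obtain b D where "0 \<le> D" "1 / 2 < b" "fourier_decay D b ?S" using decay[of 1] by auto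
    then have "0 < emeasure lborel ?S" using fourier_decay_measure_pos[OF _ comp] by simp
    then show ?thesis using borel_compact[OF comp] by simp
  qed
  moreover have "interior ?S \<noteq> {}"
    if "hausdorff_dim A + hausdorff_dim B > ereal (?m + ?n + 2 - real r)"
  proof -
    have "ereal (?m + ?n - real r + 2) < hausdorff_dim A + hausdorff_dim B" using that by (simp add: algebra_simps)
    then obtain b D where "0 \<le> D" "1 < b" "fourier_decay D b ?S" using decay[of 2] by auto
    then show ?thesis using fourier_decay_interior[OF _ comp] by blast
  qed
  ultimately show ?thesis by blast
qed

end
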